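(* Let $X$ be the solution of the stochastic differential equation with random coefficients $$X(t) = X_0 + \int_0^t a(s,X(s),\omega)\,ds + \sum_{k=1}^m \int_0^t b_k(s,X(s),\omega)\,dW_k(s),\qquad t\ge 0,$$ in the setting described in the context. Let $\varphi:\mathbb{R}^d\to\mathbb{R}$, $\varphi\in C^2(\mathbb{R}^d)$, be a function whose gradient satisfies $\varphi'(x)\neq 0$ whenever $\varphi(x)=0$, and suppose that the set $D=\{x\in\mathbb{R}^d:\varphi(x)\ge 0\}$ is non-empty. Assume that $X_0\in D$ almost surely and that the following conditions hold almost surely: (V1) for any $t\ge 0$ and $x\in D$, $$\left(\varphi'(x), a(t,x)\right)+ \frac12\sum_{k=1}^m \sum_{i,l=1}^d b_{ki}(t,x)\,b_{kl}(t,x)\,\varphi''_{il}(x)\ge 0;$$ (V2) for any $t\ge 0$, $x\in D$, $k=1,\dots,m$, $$\left(\varphi'(x), b_k(t,x)\right)= 0.$$ Then $\mathsf{P}(X(t)\in D\text{ for all }t\ge 0)=1$.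
   Context: Here $(\cdot,\cdot)$ is the scalar product and $|\cdot|$ the Euclidean norm; $\varphi'(x)$ is the gradient of $\varphi$, $\varphi''_{il}=\partial^2\varphi/\partial x_i\partial x_l$; $b_{ki}$ is the $i$-th coordinate of $b_k$; the argument $\omega$ of the coefficients is often omitted. Setting. $(\Omega,\mathcal{F},\mathbb{F}=\{\mathcal{F}_t,t\ge0\},\mathsf{P})$ is a complete filtered probability space satisfying the usual assumptions; $W_1,\dots,W_m$ are independent standard $\mathbb{F}$-Wiener processes; $X_0$ is a bounded $\mathcal{F}_0$-measurable random vector in $\mathbb{R}^d$. The coefficients $a,b_k:[0,\infty)\times\mathbb{R}^d\times\Omega\to\mathbb{R}^d$, $k=1,\dots,m$, are measurable and satisfy, with a non-random constant $C$ (the inequalities in (H3), (H4) holding almost surely): (H1) for each $t\ge 0$ the functions $a(t,\cdot)$ and $b_k(t,\cdot)$, $k=1,\dots,m$, are $\mathcal{B}(\mathbb{R}^d)\otimes\mathcal{F}_t$-measurable; (H2) almost surely, the functions $(t,x)\mapsto a(t,x,\omega)$ and $(t,x)\mapsto b_k(t,x,\omega)$, $k=1,\dots,m$, are jointly continuous on $[0,\infty)\times\mathbb{R}^d$; (H3) for any $t\ge 0$: $|a(t,0)|+\sum_{k=1}^m|b_k(t,0)|\le C$; (H4) for any $t\ge 0$, $x,y\in\mathbb{R}^d$: $|a(t,x)-a(t,y)|+\sum_{k=1}^m|b_k(t,x)-b_k(t,y)|\le C|x-y|$. It is known that under these assumptions the equation has a unique solution in the class of adapted square integrable processes; $X$ denotes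 this (continuous) solution. *)

theory Defs
  imports "HOL-Probability.Probability"
begin

subsection \<open>Twice continuously differentiable functions\<close>

definition gradient :: "(real ^ 'd \<Rightarrow> real) \<Rightarrow> real ^ 'd \<Rightarrow> real ^ 'd" where
  "gradient f x = (\<chi> i. frechet_derivative f (at x) (axis i 1))"

definition hessian :: "(real ^ 'd \<Rightarrow> real) \<Rightarrow> real ^ 'd \<Rightarrow> real ^ 'd ^ 'd" where
  "hessian f x = (\<chi> i l. frechet_derivative (\<lambda>y. gradient f y $ l) (at x) (axis i 1))"

definition C2 :: "(real ^ 'd \<Rightarrow> real) \<Rightarrow> bool" where
  "C2 f \<longleftrightarrow> f differentiable_on UNIV \<and> gradient f differentiable_on UNIV
     \<and> continuous_on UNIV (hessian f)"


subsection \<open>Filtrations and Wiener processes\<close>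

text \<open>Time is the half-line of nonnegative reals inside \<^typ>\<open>real\<close>; values of filtrations and
  processes at negative times are never used.\<close>

locale usual_filtered_prob_space = prob_space M + complete_measure M
  for M :: "'w measure" +
  fixes F :: "real \<Rightarrow> 'w measure"
  assumes subalgebra_F: "\<And>t. 0 \<le> t \<Longrightarrow> subalgebra M (F t)"
    and F_mono: "\<And>s t. 0 \<le> s \<Longrightarrow> s \<le> t \<Longrightarrow> sets (F s) \<subseteq> sets (F t)"
    and F_right_continuous: "\<And>t. 0 \<le> t \<Longrightarrow> sets (F t) = (\<Inter>s\<in>{t<..}. sets (F s))"
    and F_null_sets: "null_sets M \<subseteq> sets (F 0)"

definition adapted ::
  "(real \<Rightarrow> 'w measure) \<Rightarrow> (real \<Rightarrow> 'w \<Rightarrow> 'v::euclidean_space) \<Rightarrow> bool" where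
  "adapted F Y \<longleftrightarrow> (\<forall>t\<ge>0. Y t \<in> borel_measurable (F t))"

definition measurable_process ::
  "'w measure \<Rightarrow> (real \<Rightarrow> 'w \<Rightarrow> 'v::euclidean_space) \<Rightarrow> bool" where
  "measurable_process M Y \<longleftrightarrow>
     (\<lambda>(t, \<omega>). Y t \<omega>) \<in> borel_measurable (restrict_space borel {0..} \<Otimes>\<^sub>M M)"

definition wiener_process ::
  "'w measure \<Rightarrow> (real \<Rightarrow> 'w measure) \<Rightarrow> (real \<Rightarrow> 'w \<Rightarrow> real) \<Rightarrow> bool" where
  "wiener_process M F W \<longleftrightarrow>
     adapted F W
     \<and> (AE \<omega> in M. W 0 \<omega> = 0)
     \<and> (AE \<omega> in M. continuous_on {0..} (\<lambda>t. W t \<omega>))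
     \<and> (\<forall>s t. 0 \<le> s \<and> s < t \<longrightarrow>
          distributed M lborel (\<lambda>\<omega>. W t \<omega> - W s \<omega>) (normal_density 0 (sqrt (t - s)))
          \<and> prob_space.indep_set M (sets (F s))
               (sets (vimage_algebra (space M) (\<lambda>\<omega>. W t \<omega> - W s \<omega>) borel)))"

definition independent_processes ::
  "'w measure \<Rightarrow> nat set \<Rightarrow> (nat \<Rightarrow> real \<Rightarrow> 'w \<Rightarrow> real) \<Rightarrow> bool" where
  "independent_processes M K W \<longleftrightarrow>
     prob_space.indep_vars M (\<lambda>_. Pi\<^sub>M {0..} (\<lambda>_. borel)) (\<lambda>k \<omega>. \<lambda>t\<in>{0..}. W k t \<omega>) K"


subsection \<open>The Ito integral\<close>

text \<open>A simple process is given by a number of steps \<open>n\<close>, nodes \<open>p 0 \<le> \<dots> \<le> p n\<close> and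
  bounded heights \<open>\<xi> i\<close>, known at time \<open>p i\<close>, on \<open>(p i, p (i + 1)]\<close>.\<close>

definition simple_data ::
  "'w measure \<Rightarrow> (real \<Rightarrow> 'w measure) \<Rightarrow> nat \<Rightarrow> (nat \<Rightarrow> real) \<Rightarrow> (nat \<Rightarrow> 'w \<Rightarrow> 'v::euclidean_space)
     \<Rightarrow> bool" where
  "simple_data M F n p \<xi> \<longleftrightarrow>
     0 \<le> p 0 \<and> (\<forall>i<n. p i \<le> p (Suc i))
     \<and> (\<forall>i<n. \<xi> i \<in> borel_measurable (F (p i)) \<and> bounded (\<xi> i ` space M))"

definition simple_process ::
  "nat \<Rightarrow> (nat \<Rightarrow> real) \<Rightarrow> (nat \<Rightarrow> 'w \<Rightarrow> 'v::euclidean_space) \<Rightarrow> real \<Rightarrow> 'w \<Rightarrow> 'v" where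
  "simple_process n p \<xi> t \<omega> = (\<Sum>i<n. indicator {p i<..p (Suc i)} t *\<^sub>R \<xi> i \<omega>)"

definition simple_ito ::
  "(real \<Rightarrow> 'w \<Rightarrow> real) \<Rightarrow> nat \<Rightarrow> (nat \<Rightarrow> real) \<Rightarrow> (nat \<Rightarrow> 'w \<Rightarrow> 'v::euclidean_space)
     \<Rightarrow> real \<Rightarrow> 'w \<Rightarrow> 'v" where
  "simple_ito W n p \<xi> t \<omega> =
     (\<Sum>i<n. (W (min t (p (Suc i))) \<omega> - W (min t (p i)) \<omega>) *\<^sub>R \<xi> i \<omega>)"

text \<open>\<open>Y\<close> is a continuous version of the process \<open>t \<mapsto> \<integral>\<^sub>0\<^sup>t H dW\<close>, for a measurable adapted
  integrand \<open>H\<close> that is square integrable on bounded time intervals: the usual \<open>L\<^sup>2\<close>-limit of integrals of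
  simple processes. Square integrability of \<open>H\<close> is a consequence of the first convergence, and
  \<open>Y\<close> is determined up to indistinguishability. Vector-valued integrands are integrated
  coordinatewise.\<close>

definition ito_integral ::
  "'w measure \<Rightarrow> (real \<Rightarrow> 'w measure) \<Rightarrow> (real \<Rightarrow> 'w \<Rightarrow> real)
     \<Rightarrow> (real \<Rightarrow> 'w \<Rightarrow> 'v::euclidean_space) \<Rightarrow> (real \<Rightarrow> 'w \<Rightarrow> 'v) \<Rightarrow> bool" where
  "ito_integral M F W H Y \<longleftrightarrow>
     measurable_process M H \<and> adapted F H
     \<and> adapted F Y \<and> (AE \<omega> in M. continuous_on {0..} (\<lambda>t. Y t \<omega>))
     \<and> (\<exists>n p \<xi>. (\<forall>j. simple_data M F (n j) (p j) (\<xi> j))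
          \<and> (\<forall>T\<ge>0.
              ((\<lambda>j. \<integral>\<^sup>+ \<omega>. (\<integral>\<^sup>+ s \<in> {0..T}.
                   ennreal ((norm (H s \<omega> - simple_process (n j) (p j) (\<xi> j) s \<omega>))\<^sup>2) \<partial>lborel) \<partial>M)
                \<longlonglongrightarrow> 0)
            \<and> ((\<lambda>j. \<integral>\<^sup>+ \<omega>. ennreal ((norm (Y T \<omega> - simple_ito W (n j) (p j) (\<xi> j) T \<omega>))\<^sup>2) \<partial>M)
                \<longlonglongrightarrow> 0)))"


subsection \<open>Stochastic differential equations with random coefficients\<close>

definition sde_solution ::
  "'w measure \<Rightarrow> (real \<Rightarrow> 'w measure) \<Rightarrow> nat \<Rightarrow> (nat \<Rightarrow> real \<Rightarrow> 'w \<Rightarrow> real)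
     \<Rightarrow> (real \<Rightarrow> 'v \<Rightarrow> 'w \<Rightarrow> 'v) \<Rightarrow> (nat \<Rightarrow> real \<Rightarrow> 'v \<Rightarrow> 'w \<Rightarrow> 'v)
     \<Rightarrow> ('w \<Rightarrow> 'v::euclidean_space) \<Rightarrow> (real \<Rightarrow> 'w \<Rightarrow> 'v) \<Rightarrow> bool" where
  "sde_solution M F m W a b X0 X \<longleftrightarrow>
     measurable_process M X \<and> adapted F X
     \<and> (AE \<omega> in M. continuous_on {0..} (\<lambda>t. X t \<omega>))
     \<and> (\<forall>T\<ge>0. (\<integral>\<^sup>+ \<omega>. (\<integral>\<^sup>+ s \<in> {0..T}. ennreal ((norm (X s \<omega>))\<^sup>2) \<partial>lborel) \<partial>M) < \<infinity>)
     \<and> (\<exists>Y. (\<forall>k\<in>{1..m}. ito_integral M F (W k) (\<lambda>s \<omega>. b k s (X s \<omega>) \<omega>) (Y k))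
          \<and> (AE \<omega> in M. \<forall>t\<ge>0.
               X t \<omega> = X0 \<omega> + (LINT s:{0..t}|lborel. a s (X s \<omega>) \<omega>) + (\<Sum>k=1..m. Y k t \<omega>)))"

end

theory Submission
  imports Defs
begin

text \<open>
  Let \<open>d\<close> be the distance to \<open>D\<close>. Ito's formula cannot be applied to a function of \<open>d\<close>, which is not smooth, and
  outside \<open>D\<close> the second derivatives of \<open>\<phi>\<close> are merely continuous, so the conditions do not extend there with an
  error linear in \<open>d\<close>. Instead \<open>d\<^sup>2\<close> is estimated over short time steps. If \<open>\<xi>\<close> is an (almost) nearest point
  of \<open>D\<close> to \<open>X(t)\<close>, then one Euler step from \<open>\<xi>\<close> stays, after a mean-zero correction of order \<open>h\<close>, within \<open>o(h)\<close>
  of \<open>D\<close>: this is Taylor's formula together with (V1) and (V2) at \<open>\<xi>\<close>. Comparing \<open>X(t + h)\<close> with this step, the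
  martingale parts drop out of the expectation and the Lipschitz condition gives
  \<open>E d\<^sup>2(X(t + h)) \<le> (1 + K h) E d\<^sup>2(X(t)) + o(h)\<close>, where the expectations are taken over the event that
  \<open>X\<close> was bounded by \<open>R\<close> at the previous grid times. Summing over a grid, refining it and letting \<open>R\<close> grow yields
  \<open>d(X(T)) = 0\<close> almost surely for each \<open>T\<close>, and continuity of the paths does the rest.
\<close>

subsection \<open>Euler steps in a superlevel set\<close>

text \<open>The correction is needed because (V1) controls only the conditional mean of the
  quadratic Taylor term. The fluctuation of that term is itself of order h, so one Euler step from
  the boundary may leave \<open>D\<close> by that much, and misses of this size, added up over 1/h
  steps, would not be small. A shift along the gradient trades the random quadratic form for its
  mean. The shift is as large as the miss but centred given the past, which explains the use of the
  squared distance: there it enters through an inner product with the current offset, of expectation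
  zero, and through its own square, of order h^2. Freezing the coefficients at time t leaves a
  centred noise error with mean square o(h), and a drift error that is not centred but has mean
  square o(h^2) and so can be weighted by 1/h. The growth rate K depends on \<open>C\<close> and
  \<open>m\<close> alone; the bound R, the Hessian and the gradient enter only the o(h) term. This
  lets the accuracy tend to zero for fixed R before R grows.\<close>

lemma C2_has_derivative:
  fixes f :: "real ^ 'd \<Rightarrow> real"
  assumes "C2 f"
  shows "(f has_derivative (\<lambda>u. gradient f x \<bullet> u)) (at x)"
proof -
  have "f differentiable (at x)"
    using assms by (auto simp: C2_def differentiable_on_def)
  then have d: "(f has_derivative frechet_derivative f (at x)) (at x)"
    using frechet_derivative_works by blast
  then have l: "linear (frechet_derivative f (at x))"
    by (simp add: has_derivative_linear)
  have "frechet_derivative f (at x) u = gradient f x \<bullet> u" for u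
  proof -
    have "frechet_derivative f (at x) u = frechet_derivative f (at x) (\<Sum>i\<in>UNIV. (u $ i) *\<^sub>R axis i 1)"
      by (simp add: basis_expansion scalar_mult_eq_scaleR[symmetric])
    also have "\<dots> = (\<Sum>i\<in>UNIV. (u $ i) * frechet_derivative f (at x) (axis i 1))"
      by (simp add: linear_sum[OF l] linear_cmul[OF l])
    finally show ?thesis
      by (simp add: gradient_def inner_vec_def mult.commute)
  qed
  then show ?thesis using d by (metis (no_types, lifting) ext)
qed

text \<open>In \<open>hessian\<close> the row index is the direction of differentiation and the
  column index the component of the gradient; hence the increment \<open>u\<close> stands to the
  left of the matrix and the test vector \<open>v\<close> to the right.\<close>

lemma C2_gradient_has_derivative:
  fixes f :: "real ^ 'd \<Rightarrow> real"
  assumes "C2 f"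
  shows "((\<lambda>y. gradient f y \<bullet> v) has_derivative (\<lambda>u. u \<bullet> (hessian f x *v v))) (at x)"
proof -
  have "gradient f differentiable (at x)"
    using assms by (auto simp: C2_def differentiable_on_def)
  then obtain g where g: "(gradient f has_derivative g) (at x)"
    by (auto simp: differentiable_def)
  have c: "((\<lambda>y. gradient f y $ l) has_derivative (\<lambda>u. g u $ l)) (at x)" for l
    using bounded_linear.has_derivative[OF bounded_linear_vec_nth g] .
  have h: "hessian f x $ i $ l = g (axis i 1) $ l" for i l
    using frechet_derivative_at[OF c[of l]] by (simp add: hessian_def) metis
  have lg: "linear g" using g by (simp add: has_derivative_linear)
  have gu: "g u $ l = (\<Sum>i\<in>UNIV. u $ i * hessian f x $ i $ l)" for u l
  proof -
    have "g u = g (\<Sum>i\<in>UNIV. (u $ i) *\<^sub>R axis i 1)"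
      by (simp add: basis_expansion scalar_mult_eq_scaleR[symmetric])
    also have "\<dots> = (\<Sum>i\<in>UNIV. (u $ i) *\<^sub>R g (axis i 1))"
      by (simp add: linear_sum[OF lg] linear_cmul[OF lg])
    finally show ?thesis by (simp add: h)
  qed
  have "g u \<bullet> v = u \<bullet> (hessian f x *v v)" for u
  proof -
    have "g u \<bullet> v = (\<Sum>l\<in>UNIV. \<Sum>i\<in>UNIV. u $ i * hessian f x $ i $ l * v $ l)"
      by (simp add: inner_vec_def gu sum_distrib_right)
    also have "\<dots> = (\<Sum>i\<in>UNIV. \<Sum>l\<in>UNIV. u $ i * hessian f x $ i $ l * v $ l)"
      by (rule sum.swap)
    also have "\<dots> = u \<bullet> (hessian f x *v v)"
      by (simp add: inner_vec_def matrix_vector_mult_def sum_distrib_left mult.assoc)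
    finally show ?thesis .
  qed
  moreover have "((\<lambda>y. gradient f y \<bullet> v) has_derivative (\<lambda>u. g u \<bullet> v)) (at x)"
    by (intro has_derivative_inner_left g)
  ultimately show ?thesis by simp
qed

lemma C2_continuous:
  assumes "C2 f"
  shows "continuous_on UNIV f" "continuous_on UNIV (gradient f)" "continuous_on UNIV (hessian f)"
  using assms by (auto simp: C2_def differentiable_imp_continuous_on)

text \<open>Restricting \<open>f\<close> to the segment reduces this to the Maclaurin theorem in one
  variable with Lagrange remainder. The Hessian stays at an intermediate point, so its uniform
  continuity on balls is what later controls the remainder.\<close>

lemma C2_Taylor:
  fixes f :: "real ^ 'd \<Rightarrow> real"
  assumes "C2 f"
  obtains s where "0 < s" "s < 1"
    "f (x + u) = f x + gradient f x \<bullet> u + 1/2 * (u \<bullet> (hessian f (x + s *\<^sub>R u) *v u))"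
proof -
  define g where "g m t = (if m = 0 then f (x + t *\<^sub>R u)
      else if m = 1 then gradient f (x + t *\<^sub>R u) \<bullet> u
      else u \<bullet> (hessian f (x + t *\<^sub>R u) *v u))" for m :: nat and t :: real
  have line: "((\<lambda>t. x + t *\<^sub>R u) has_derivative (\<lambda>t. t *\<^sub>R u)) (at t)" for t :: real
    by (auto intro!: derivative_eq_intros)
  have d0: "DERIV (g 0) t :> g 1 t" for t
    using has_derivative_compose[OF line C2_has_derivative[OF assms]]
    unfolding g_def has_field_derivative_def by (simp add: mult_commute_abs)
  have d1: "DERIV (g 1) t :> g 2 t" for t
    using has_derivative_compose[OF line C2_gradient_has_derivative[OF assms]]
    unfolding g_def has_field_derivative_def by (simp add: mult_commute_abs)
  have "\<exists>t. 0 < t \<and> t < 1 \<and> g 0 1 = (\<Sum>m<2. g m 0 / fact m * 1 ^ m) + g 2 t / fact 2 * 1 ^ 2"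
    by (rule Maclaurin) (use d0 d1 in \<open>auto simp: less_Suc_eq numeral_2_eq_2\<close>)
  then show ?thesis
    using that by (auto simp: g_def numeral_2_eq_2)
qed

section \<open>Quadratic forms in the increments and the mean-zero correction\<close>

lemma norm_matrix_vector_le:
  fixes A :: "real ^ 'n ^ 'm"
  shows "norm (A *v v) \<le> norm A * norm v"
proof -
  \<comment> \<open>\<open>norm A\<close> is the Frobenius norm, the Euclidean norm of the vector of
    row norms, so Cauchy-Schwarz in each row suffices.\<close>
  have "norm (A *v v) \<le> L2_set (\<lambda>i. norm (A $ i) * norm v) UNIV"
    unfolding norm_vec_def[of "A *v v"]
    by (rule L2_set_mono) (auto simp: matrix_vector_mul_component Cauchy_Schwarz_ineq2)
  also have "\<dots> = norm A * norm v"
    by (simp add: norm_vec_def[of A] L2_set_left_distrib)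
  finally show ?thesis .
qed

lemma abs_quadratic_form_le:
  fixes A :: "real ^ 'n ^ 'n"
  shows "\<bar>u \<bullet> (A *v v)\<bar> \<le> norm A * norm u * norm v"
proof -
  have "\<bar>u \<bullet> (A *v v)\<bar> \<le> norm u * norm (A *v v)"
    by (rule Cauchy_Schwarz_ineq2)
  also have "\<dots> \<le> norm u * (norm A * norm v)"
    by (intro mult_left_mono norm_matrix_vector_le) auto
  finally show ?thesis by (simp add: mult_ac)
qed

text \<open>Translates the coordinate sum in (V1) into the form in which Taylor's formula produces
  it.\<close>

lemma quadratic_form_eq_sum:
  fixes A :: "real ^ 'd ^ 'd"
  shows "v \<bullet> (A *v v) = (\<Sum>i\<in>UNIV. \<Sum>l\<in>UNIV. v $ i * v $ l * A $ i $ l)"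
  by (simp add: inner_vec_def matrix_vector_mult_def sum_distrib_left mult_ac)

lemma quadratic_form_sum:
  fixes A :: "real ^ 'n ^ 'n"
  shows "(\<Sum>k\<in>I. w k *\<^sub>R \<beta> k) \<bullet> (A *v (\<Sum>l\<in>I. w l *\<^sub>R \<beta> l))
    = (\<Sum>k\<in>I. \<Sum>l\<in>I. w k * w l * (\<beta> k \<bullet> (A *v \<beta> l)))"
proof -
  have "A *v (\<Sum>l\<in>I. w l *\<^sub>R \<beta> l) = (\<Sum>l\<in>I. w l *\<^sub>R (A *v \<beta> l))"
    by (simp add: linear_sum[OF matrix_vector_mul_linear] linear_cmul[OF matrix_vector_mul_linear])
  then show ?thesis
    by (simp add: inner_sum_left inner_sum_right sum_distrib_left mult.assoc mult.left_commute)
       (subst sum.swap, simp add: mult.left_commute)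
qed

text \<open>Minus the centred second-order part of \<open>1/2 * (H v, v)\<close> for \<open>v = \<Sum>\<^sub>k w\<^sub>k \<beta>\<^sub>k\<close>: for Gaussian
  increments \<open>w\<^sub>k\<close> of variance \<open>h\<close> it has size \<open>h\<close> but mean zero, so it costs only \<open>h\<^sup>2\<close> in mean square.\<close>

definition ito_correction ::
  "nat set \<Rightarrow> real ^ 'd ^ 'd \<Rightarrow> (nat \<Rightarrow> real ^ 'd) \<Rightarrow> real \<Rightarrow> (nat \<Rightarrow> real) \<Rightarrow> real" where
  "ito_correction I A \<beta> h w =
    - (1/2) * (\<Sum>k\<in>I. \<Sum>l\<in>I. (\<beta> k \<bullet> (A *v \<beta> l)) * (w k * w l - (if k = l then h else 0)))"

text \<open>The subtracted \<open>h\<close> survives only on the diagonal, so the double sum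
  separates into a full quadratic form and its mean. Added to the second-order Taylor term, the
  correction leaves exactly \<open>h\<close> times the second-order part of (V1).\<close>

lemma ito_correction_eq:
  assumes "finite I"
  shows "ito_correction I A \<beta> h w = h / 2 * (\<Sum>k\<in>I. \<beta> k \<bullet> (A *v \<beta> k))
    - 1/2 * ((\<Sum>k\<in>I. w k *\<^sub>R \<beta> k) \<bullet> (A *v (\<Sum>l\<in>I. w l *\<^sub>R \<beta> l)))"
proof -
  have "(\<Sum>k\<in>I. \<Sum>l\<in>I. (\<beta> k \<bullet> (A *v \<beta> l)) * (if k = l then h else 0))
      = h * (\<Sum>k\<in>I. \<beta> k \<bullet> (A *v \<beta> k))"
    using assms by (simp add: if_distrib[where f="\<lambda>x. _ * x"] sum_distrib_left mult.commute[of h] cong: if_cong)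
  then show ?thesis
    unfolding ito_correction_def quadratic_form_sum right_diff_distrib sum_subtractf
    by (simp add: mult_ac)
qed

lemma abs_le_sqrt_sum_squares:
  fixes w :: "nat \<Rightarrow> real"
  assumes "finite I" "k \<in> I"
  shows "\<bar>w k\<bar> \<le> sqrt (\<Sum>k\<in>I. (w k)\<^sup>2)"
  using assms by (intro real_le_rsqrt) (auto intro: member_le_sum[where f="\<lambda>k. (w k)\<^sup>2"])

text \<open>Every product of two increments, centred or not, is at most the sum of squares plus
  \<open>h\<close>. The square of the correction therefore has expectation of order
  \<open>h\<^sup>2\<close> once the fourth moments of the increments are known.\<close>

lemma abs_ito_correction_le:
  assumes "finite I" and h: "0 \<le> h" and K: "\<And>k. k \<in> I \<Longrightarrow> norm (\<beta> k) \<le> K"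
    and B: "norm A \<le> B"
  shows "\<bar>ito_correction I A \<beta> h w\<bar> \<le> B * K\<^sup>2 * (card I)\<^sup>2 * ((\<Sum>k\<in>I. (w k)\<^sup>2) + h)"
proof -
  define s where "s = (\<Sum>k\<in>I. (w k)\<^sup>2)"
  have s0: "0 \<le> s" by (auto simp: s_def intro: sum_nonneg)
  have B0: "0 \<le> B" using B norm_ge_zero order_trans by blast
  have "\<bar>(\<beta> k \<bullet> (A *v \<beta> l)) * (w k * w l - (if k = l then h else 0))\<bar> \<le> B * K\<^sup>2 * (s + h)"
    if kl: "k \<in> I" "l \<in> I" for k l
  proof -
    have "\<bar>\<beta> k \<bullet> (A *v \<beta> l)\<bar> \<le> norm A * norm (\<beta> k) * norm (\<beta> l)" by (rule abs_quadratic_form_le)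
    also have "\<dots> \<le> B * K * K"
      using K kl B B0 order_trans[OF norm_ge_zero K[OF kl(1)]] by (intro mult_mono) auto
    finally have 1: "\<bar>\<beta> k \<bullet> (A *v \<beta> l)\<bar> \<le> B * K\<^sup>2" by (simp add: power2_eq_square mult.assoc)
    have "\<bar>w k * w l\<bar> \<le> sqrt s * sqrt s"
      unfolding abs_mult s_def using kl assms(1) by (intro mult_mono abs_le_sqrt_sum_squares) (auto intro: sum_nonneg)
    then have "\<bar>w k * w l - (if k = l then h else 0)\<bar> \<le> s + h"
      using s0 h zero_le_square[of "w l"] by (cases "k = l") (auto simp: abs_le_iff simp del: zero_le_square)
    then show ?thesis using 1 by (auto simp: abs_mult intro!: mult_mono intro: order_trans[OF abs_ge_zero 1])
  qed
  then have "\<bar>\<Sum>k\<in>I. \<Sum>l\<in>I. (\<beta> k \<bullet> (A *v \<beta> l)) * (w k * w l - (if k = l then h else 0))\<bar>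
      \<le> (\<Sum>k\<in>I. \<Sum>l\<in>I. B * K\<^sup>2 * (s + h))"
    by (intro order_trans[OF sum_abs] sum_mono)
  also have "\<dots> = B * K\<^sup>2 * (card I)\<^sup>2 * (s + h)" by (simp add: power2_eq_square)
  finally show ?thesis
    by (simp add: ito_correction_def s_def abs_mult)
qed

lemma norm_sum_scaleR_le:
  fixes w :: "nat \<Rightarrow> real"
  assumes "finite I" and "\<And>k. k \<in> I \<Longrightarrow> norm (\<beta> k) \<le> K"
  shows "norm (\<Sum>k\<in>I. w k *\<^sub>R \<beta> k) \<le> K * card I * sqrt (\<Sum>k\<in>I. (w k)\<^sup>2)"
proof -
  have "norm (\<Sum>k\<in>I. w k *\<^sub>R \<beta> k) \<le> (\<Sum>k\<in>I. sqrt (\<Sum>k\<in>I. (w k)\<^sup>2) * K)"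
    using assms abs_le_sqrt_sum_squares[OF assms(1), of _ w]
    by (intro sum_norm_le) (auto intro!: mult_mono sum_nonneg)
  then show ?thesis by (simp add: mult_ac)
qed

text \<open>The direction along which \<open>f\<close> grows with unit speed. Away from the zero level set the gradient
  may vanish, but there no correction is needed and the direction is set to zero.\<close>

definition scaled_gradient :: "(real ^ 'd \<Rightarrow> real) \<Rightarrow> real \<Rightarrow> real \<Rightarrow> real ^ 'd \<Rightarrow> real ^ 'd" where
  "scaled_gradient f R c x =
    (if norm x \<le> R \<and> \<bar>f x\<bar> \<le> c then (1 / (norm (gradient f x))\<^sup>2) *\<^sub>R gradient f x else 0)"

lemma scaled_gradient_measurable [measurable]:
  fixes f :: "real ^ 'd \<Rightarrow> real"
  assumes "C2 f"
  shows "scaled_gradient f R c \<in> borel_measurable borel"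
proof -
  have [measurable]: "f \<in> borel_measurable borel" "gradient f \<in> borel_measurable borel"
    using C2_continuous[OF assms] by (auto intro: borel_measurable_continuous_onI)
  show ?thesis unfolding scaled_gradient_def[abs_def] by measurable
qed

text \<open>By compactness |f| + |gradient f| has a positive minimum on the ball; with
  \<open>c\<close> half of it, |f| <= c leaves at least c for the gradient. The gradient is thus
  under control in a whole layer around the zero set, not just on it.\<close>

lemma gradient_bound_near_zero_set:
  fixes f :: "real ^ 'd \<Rightarrow> real"
  assumes f: "C2 f" and grad: "\<And>x. f x = 0 \<Longrightarrow> gradient f x \<noteq> 0"
  obtains c where "c > 0" "\<And>x. norm x \<le> R \<Longrightarrow> \<bar>f x\<bar> \<le> c \<Longrightarrow> norm (gradient f x) \<ge> c"
proof (cases "R \<ge> 0")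
  case True
  have "continuous_on (cball 0 R) (\<lambda>x. \<bar>f x\<bar> + norm (gradient f x))"
    using C2_continuous[OF f] by (intro continuous_intros) (auto intro: continuous_on_subset)
  then have "\<exists>x\<in>cball 0 R. \<forall>y\<in>cball 0 R. \<bar>f x\<bar> + norm (gradient f x) \<le> \<bar>f y\<bar> + norm (gradient f y)"
    using True by (intro continuous_attains_inf) auto
  then obtain x0 where x0: "\<And>y. y \<in> cball 0 R \<Longrightarrow> \<bar>f x0\<bar> + norm (gradient f x0) \<le> \<bar>f y\<bar> + norm (gradient f y)"
    by blast
  define c where "c = (\<bar>f x0\<bar> + norm (gradient f x0)) / 2"
  have "c > 0" using grad[of x0] by (cases "f x0 = 0") (auto simp: c_def add_pos_nonneg)
  moreover have "norm (gradient f x) \<ge> c" if "norm x \<le> R" "\<bar>f x\<bar> \<le> c" for x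
    using x0[of x] that by (simp add: c_def field_simps)
  ultimately show ?thesis using that by blast
next
  case False
  show ?thesis
  proof (rule that[of 1])
    show "norm (gradient f x) \<ge> 1" if "norm x \<le> R" for x
      using that False norm_ge_zero[of x] by linarith
  qed simp
qed

lemma norm_scaled_gradient_le:
  assumes "c > 0" and "\<And>x. norm x \<le> R \<Longrightarrow> \<bar>f x\<bar> \<le> c \<Longrightarrow> norm (gradient f x) \<ge> c"
  shows "norm (scaled_gradient f R c x) \<le> 1 / c"
proof (cases "norm x \<le> R \<and> \<bar>f x\<bar> \<le> c")
  case True
  then have "c \<le> norm (gradient f x)" using assms(2) by blast
  then show ?thesis using True assms(1)
    by (simp add: scaled_gradient_def power2_eq_square frac_le)
qed (use assms in \<open>auto simp: scaled_gradient_def\<close>)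

text \<open>The drift and dispersion conditions at \<open>x\<close> make the Taylor expansion of \<open>f\<close> at the Euler step
  nonnegative up to \<open>o(h)\<close> once the mean-zero correction is added; a further push of size \<open>o(h)\<close>
  along the scaled gradient absorbs the remainder. For large increments \<open>w\<close> the point \<open>p = x\<close> serves.\<close>

lemma superlevel_point_near_Euler_step:
  fixes f :: "real ^ 'd \<Rightarrow> real" and I :: "nat set"
  assumes f: "C2 f" and I: "finite I" and K: "0 \<le> K" and c: "c > 0"
    and grad: "\<And>x. norm x \<le> R \<Longrightarrow> \<bar>f x\<bar> \<le> c \<Longrightarrow> norm (gradient f x) \<ge> c"
    and \<epsilon>: "\<epsilon> > 0"
  shows "\<exists>h0>0. \<exists>L\<ge>0. \<forall>x \<alpha> \<beta> h w s. 0 \<le> f x \<longrightarrow> norm x \<le> R \<longrightarrow> norm \<alpha> \<le> K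
      \<longrightarrow> (\<forall>k\<in>I. norm (\<beta> k) \<le> K \<and> gradient f x \<bullet> \<beta> k = 0)
      \<longrightarrow> gradient f x \<bullet> \<alpha> + 1/2 * (\<Sum>k\<in>I. \<beta> k \<bullet> (hessian f x *v \<beta> k)) \<ge> 0
      \<longrightarrow> 0 < h \<longrightarrow> h \<le> h0 \<longrightarrow> s = (\<Sum>k\<in>I. (w k)\<^sup>2)
      \<longrightarrow> (\<exists>p r. 0 \<le> f p \<and> norm (p - (x + h *\<^sub>R \<alpha> + (\<Sum>k\<in>I. w k *\<^sub>R \<beta> k)
              + ito_correction I (hessian f x) \<beta> h w *\<^sub>R scaled_gradient f R c x)) \<le> r
           \<and> r \<le> \<epsilon> * (s + h) + L * s\<^sup>2 \<and> r \<le> L * (s + h))"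
proof -
  define M where "M = real (card I)"
  have M: "0 \<le> M" by (simp add: M_def)
  have "compact (hessian f ` cball 0 (R+1))"
    using C2_continuous(3)[OF f] by (intro compact_continuous_image) (auto intro: continuous_on_subset)
  then obtain B where B: "\<And>x. x \<in> cball 0 (R+1) \<Longrightarrow> norm (hessian f x) \<le> B"
    using compact_imp_bounded bounded_iff by (metis imageI)
  \<comment> \<open>One constant \<open>P \<ge> 1\<close> dominates all bounds in sight, so the
    estimates below become powers of \<open>P\<close> times powers of
    \<open>\<sigma> = s + h\<close>.\<close>
  define P where "P = 1 + K + K * M + \<bar>B\<bar> * K\<^sup>2 * M\<^sup>2 + 1/c + \<bar>B\<bar>"
  have nonneg: "0 \<le> K * M" "0 \<le> \<bar>B\<bar> * K\<^sup>2 * M\<^sup>2" "0 < 1/c" "0 \<le> \<bar>B\<bar>" using K M c by auto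
  have P: "1 \<le> P" "K \<le> P" "K * M \<le> P" "\<bar>B\<bar> * K\<^sup>2 * M\<^sup>2 \<le> P" "1/c \<le> P" "\<bar>B\<bar> \<le> P"
    unfolding P_def using nonneg K by linarith+
  \<comment> \<open>\<open>e * \<sigma>\<close> will be the size of the extra push along
    \<open>n\<close>; since \<open>norm n \<le> P\<close>, it moves the point by at most
    \<open>\<epsilon> * \<sigma>\<close>.\<close>
  define e where "e = min 1 (\<epsilon> / P)"
  have e: "e > 0" "e \<le> 1" "e * P \<le> \<epsilon>" using \<epsilon> P(1) by (auto simp: e_def min_def field_simps)
  have "uniformly_continuous_on (cball 0 (R+1)) (hessian f)"
    using C2_continuous(3)[OF f] by (intro compact_uniformly_continuous) (auto intro: continuous_on_subset)
  \<comment> \<open>The step will satisfy \<open>norm u \<le> 4 * P\<^sup>2 * sqrt \<sigma>\<close>,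
    so this oscillation of the Hessian costs at most \<open>e * \<sigma>\<close> in the quadratic
    form.\<close>
  moreover have "e / (16 * P^4) > 0" using e P by simp
  ultimately obtain d1 where d1: "d1 > 0" "\<And>x y. x \<in> cball 0 (R+1) \<Longrightarrow> y \<in> cball 0 (R+1) \<Longrightarrow> dist y x < d1
      \<Longrightarrow> dist (hessian f y) (hessian f x) < e / (16 * P^4)"
    unfolding uniformly_continuous_on_def by metis
  have "uniformly_continuous_on (cball 0 (R+1)) f"
    using C2_continuous(1)[OF f] by (intro compact_uniformly_continuous) (auto intro: continuous_on_subset)
  then obtain d2 where d2: "d2 > 0" "\<And>x y. x \<in> cball 0 (R+1) \<Longrightarrow> y \<in> cball 0 (R+1) \<Longrightarrow> dist y x < d2
      \<Longrightarrow> dist (f y) (f x) < c"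
    using c unfolding uniformly_continuous_on_def by metis
  define d where "d = min 1 (min d1 d2)"
  have d: "d > 0" "d \<le> 1" "d \<le> d1" "d \<le> d2" using d1 d2 by (auto simp: d_def)
  \<comment> \<open>The first entry keeps the whole step shorter than \<open>d\<close>; the second
    makes the mixed second-order terms, of order \<open>\<sigma> * sqrt \<sigma>\<close>, smaller
    than \<open>e * \<sigma>\<close>.\<close>
  define \<tau> where "\<tau> = min (d / (5 * P\<^sup>2)) (e / (16 * P^5))"
  have \<tau>: "\<tau> > 0" "\<tau> * (5 * P\<^sup>2) \<le> d" "\<tau> * (16 * P^5) \<le> e"
    using d e P by (auto simp: \<tau>_def min_def field_simps)
  have "1 \<le> 5 * P\<^sup>2" using P(1) by (simp add: order_trans[OF _ mult_mono[of 1 5 1 "P\<^sup>2"]])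
  then have "\<tau> * 1 \<le> \<tau> * (5 * P\<^sup>2)" using \<tau>(1) by (intro mult_left_mono) auto
  then have \<tau>1: "\<tau> \<le> 1" using \<tau> d by linarith
  \<comment> \<open>Half of \<open>\<tau>\<^sup>2\<close>, so that
    \<open>s + h > \<tau>\<^sup>2\<close> can only be caused by large increments: then
    \<open>s > \<tau>\<^sup>2 / 2\<close>, and \<open>s\<close> dominates \<open>h\<close>.\<close>
  define h0 where "h0 = \<tau>\<^sup>2 / 2"
  define L1 where "L1 = P\<^sup>2 * (2 / \<tau> + 2)"
  \<comment> \<open>The summand \<open>P\<close> serves small steps, \<open>L1\<close> is the linear
    bound for large ones, and \<open>4 / \<tau>\<^sup>2\<close> turns \<open>\<sigma>\<close> into a
    multiple of \<open>s\<^sup>2\<close> there.\<close>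
  define L where "L = P + L1 * (1 + 4 / \<tau>\<^sup>2)"
  have L1: "0 \<le> L1" using \<tau> by (simp add: L1_def)
  have L: "P \<le> L" "L1 \<le> L" "L1 * (4 / \<tau>\<^sup>2) \<le> L" "0 \<le> L"
    using L1 P by (auto simp: L_def algebra_simps)
  have h0: "h0 > 0" using \<tau> by (simp add: h0_def)
  show ?thesis
  proof (rule exI[of _ h0], rule conjI[OF h0], rule exI[of _ L], rule conjI[OF L(4)], intro allI impI)
    fix x \<alpha> :: "real ^ 'd" and \<beta> h and w :: "nat \<Rightarrow> real" and s
    assume fx: "0 \<le> f x" and x: "norm x \<le> R" and \<alpha>: "norm \<alpha> \<le> K"
      and \<beta>': "\<forall>k\<in>I. norm (\<beta> k) \<le> K \<and> gradient f x \<bullet> \<beta> k = 0"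
      and drift: "gradient f x \<bullet> \<alpha> + 1/2 * (\<Sum>k\<in>I. \<beta> k \<bullet> (hessian f x *v \<beta> k)) \<ge> 0"
      and h: "0 < h" "h \<le> h0" and s: "s = (\<Sum>k\<in>I. (w k)\<^sup>2)"
    note \<beta> = bspec[OF \<beta>']
    define H where "H = hessian f x"
    define z where "z = (\<Sum>k\<in>I. w k *\<^sub>R \<beta> k)"
    define q where "q = ito_correction I H \<beta> h w"
    define n where "n = scaled_gradient f R c x"
    define \<sigma> where "\<sigma> = s + h"
    have s0: "0 \<le> s" unfolding s by (auto intro: sum_nonneg)
    have \<sigma>: "0 < \<sigma>" "s \<le> \<sigma>" "h \<le> \<sigma>" using s0 h by (auto simp: \<sigma>_def)
    have z: "norm z \<le> P * sqrt s"
    proof -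
      have "norm z \<le> K * M * sqrt s"
        unfolding z_def s M_def using I \<beta> by (intro norm_sum_scaleR_le) auto
      then show ?thesis using mult_right_mono[OF P(3), of "sqrt s"] s0 by simp
    qed
    have xB: "x \<in> cball 0 (R+1)" using x by simp
    have HB: "norm H \<le> \<bar>B\<bar>" using B[OF xB] by (simp add: H_def)
    have q: "\<bar>q\<bar> \<le> P * \<sigma>"
    proof -
      have "\<bar>q\<bar> \<le> \<bar>B\<bar> * K\<^sup>2 * (card I)\<^sup>2 * (s + h)"
        unfolding q_def s using h \<beta> HB I by (intro abs_ito_correction_le) auto
      also have "\<dots> \<le> P * \<sigma>"
        unfolding \<sigma>_def using P(4) s0 h by (intro mult_right_mono) (auto simp: M_def)
      finally show ?thesis .
    qed
    have n: "norm n \<le> P"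
    proof (cases "norm x \<le> R \<and> \<bar>f x\<bar> \<le> c")
      case True
      then have "c \<le> norm (gradient f x)" using grad by blast
      then have "norm n \<le> 1 / c" using True c
        by (simp add: n_def scaled_gradient_def power2_eq_square frac_le)
      then show ?thesis using P by simp
    next
      case False
      then show ?thesis using P by (auto simp: n_def scaled_gradient_def)
    qed
    have qn: "norm (q *\<^sub>R n) \<le> P * \<sigma> * P"
      unfolding norm_scaleR using q n P \<sigma> by (intro mult_mono) auto
    have h\<alpha>: "norm (h *\<^sub>R \<alpha>) \<le> P * h"
      using h mult_left_mono[OF order_trans[OF \<alpha> P(2)], of h] by (simp add: mult.commute)
    show "\<exists>p r. 0 \<le> f p \<and> norm (p - (x + h *\<^sub>R \<alpha> + (\<Sum>k\<in>I. w k *\<^sub>R \<beta> k)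
              + ito_correction I (hessian f x) \<beta> h w *\<^sub>R scaled_gradient f R c x)) \<le> r
           \<and> r \<le> \<epsilon> * (s + h) + L * s\<^sup>2 \<and> r \<le> L * (s + h)"
    proof (cases "\<sigma> \<le> \<tau>\<^sup>2")
      case True
      \<comment> \<open>Everything of order \<open>\<sigma>\<close> is collected in
        \<open>y\<close>: drift, correction and push. Only \<open>z\<close> is of order
        \<open>sqrt \<sigma>\<close>.\<close>
      define y where "y = h *\<^sub>R \<alpha> + (q + e * \<sigma>) *\<^sub>R n"
      define u where "u = z + y"
      have sq: "sqrt \<sigma> \<le> \<tau>" using True \<tau> by (simp add: real_le_lsqrt)
      have PP: "P \<le> P\<^sup>2" using P(1) by (simp add: self_le_power)
      have y: "norm y \<le> 3 * P\<^sup>2 * \<sigma>"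
      proof -
        have "norm y \<le> norm (h *\<^sub>R \<alpha>) + norm (q *\<^sub>R n) + norm ((e * \<sigma>) *\<^sub>R n)"
          unfolding y_def scaleR_add_left add.assoc[symmetric]
          by (intro order_trans[OF norm_triangle_ineq] add_mono order_refl)
        also have "norm ((e * \<sigma>) *\<^sub>R n) \<le> 1 * \<sigma> * P"
          unfolding norm_scaleR using e \<sigma> n by (intro mult_mono) (auto simp: abs_mult)
        finally have "norm y \<le> P * \<sigma> + P * \<sigma> * P + \<sigma> * P"
          using h\<alpha> qn mult_left_mono[OF \<sigma>(3), of P] P by linarith
        also have "\<dots> = (P + P\<^sup>2 + P) * \<sigma>" by (simp add: algebra_simps power2_eq_square)
        also have "\<dots> \<le> (3 * P\<^sup>2) * \<sigma>" using PP \<sigma> by (intro mult_right_mono) auto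
        finally show ?thesis by simp
      qed
      have \<sigma>sq: "\<sigma> \<le> sqrt \<sigma>" "\<sigma> = sqrt \<sigma> * sqrt \<sigma>"
      proof -
        show *: "\<sigma> = sqrt \<sigma> * sqrt \<sigma>" using \<sigma> by simp
        have "sqrt \<sigma> \<le> 1" using sq \<tau>1 by linarith
        then have "sqrt \<sigma> * sqrt \<sigma> \<le> 1 * sqrt \<sigma>" using \<sigma> by (intro mult_right_mono) auto
        then show "\<sigma> \<le> sqrt \<sigma>" using * by linarith
      qed
      have z': "norm z \<le> P\<^sup>2 * sqrt \<sigma>"
      proof -
        have "norm z \<le> P * sqrt \<sigma>"
          by (rule order_trans[OF z]) (use P \<sigma> in \<open>simp add: mult_left_mono\<close>)
        moreover have "P * sqrt \<sigma> \<le> P\<^sup>2 * sqrt \<sigma>" using PP \<sigma> by (intro mult_right_mono) auto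
        ultimately show ?thesis by linarith
      qed
      have u: "norm u \<le> 4 * P\<^sup>2 * sqrt \<sigma>"
      proof -
        have "norm u \<le> P\<^sup>2 * sqrt \<sigma> + 3 * P\<^sup>2 * sqrt \<sigma>"
        proof -
          have "3 * P\<^sup>2 * \<sigma> \<le> 3 * P\<^sup>2 * sqrt \<sigma>" by (rule mult_left_mono[OF \<sigma>sq(1)]) simp
          then show ?thesis unfolding u_def using norm_triangle_ineq[of z y] z' y by linarith
        qed
        then show ?thesis by linarith
      qed
      have ud: "norm u < d"
      proof -
        have "4 * P\<^sup>2 * sqrt \<sigma> \<le> 4 * P\<^sup>2 * \<tau>" using sq by (intro mult_left_mono) auto
        also have "\<dots> < \<tau> * (5 * P\<^sup>2)" using \<tau> P by simp
        finally show ?thesis using u \<tau> by linarith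
      qed
      define p where "p = x + u"
      have pe: "p - (x + h *\<^sub>R \<alpha> + z + q *\<^sub>R n) = (e * \<sigma>) *\<^sub>R n"
        by (simp add: p_def u_def y_def algebra_simps)
      have r: "norm (p - (x + h *\<^sub>R \<alpha> + z + q *\<^sub>R n)) \<le> e * \<sigma> * P"
        unfolding pe norm_scaleR using e \<sigma> n by (simp add: mult_left_mono)
      \<comment> \<open>Within the layer \<open>f x \<le> c\<close> the gradient is bounded below
        and Taylor's formula decides. Beyond it, \<open>f\<close> cannot fall by \<open>c\<close>
        over a distance below \<open>d2\<close>.\<close>
      have "0 \<le> f p"
      proof (cases "f x \<le> c")
        case True
        have ne: "gradient f x \<noteq> 0" using grad[OF x] True fx c by auto
        have gn: "gradient f x \<bullet> n = 1"
          using x True fx ne by (simp add: n_def scaled_gradient_def dot_square_norm)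
        have gz: "gradient f x \<bullet> z = 0" using \<beta> by (simp add: z_def inner_sum_right)
        obtain t where t: "0 < t" "t < 1"
          "f p = f x + gradient f x \<bullet> u + 1/2 * (u \<bullet> (hessian f (x + t *\<^sub>R u) *v u))"
          unfolding p_def using C2_Taylor[OF f] by blast
        have tu: "norm (t *\<^sub>R u) \<le> norm u" using t by (simp add: mult_left_le_one_le)
        have "norm (hessian f (x + t *\<^sub>R u) - H) \<le> e / (16 * P^4)"
        proof -
          have "x + t *\<^sub>R u \<in> cball 0 (R + 1)"
            unfolding mem_cball_0 using tu ud d norm_triangle_ineq[of x "t *\<^sub>R u"] x by linarith
          moreover have "norm (t *\<^sub>R u) < d1" using tu ud d by linarith
          ultimately show ?thesis
            using d1(2)[OF xB, of "x + t *\<^sub>R u"] by (simp add: dist_norm H_def)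
        qed
        then have "\<bar>u \<bullet> ((hessian f (x + t *\<^sub>R u) - H) *v u)\<bar> \<le> e / (16 * P^4) * norm u * norm u"
          by (intro order_trans[OF abs_quadratic_form_le] mult_right_mono) auto
        also have "\<dots> \<le> e / (16 * P^4) * (4 * P\<^sup>2 * sqrt \<sigma>) * (4 * P\<^sup>2 * sqrt \<sigma>)"
          using u e P \<sigma> by (intro mult_mono) auto
        also have "\<dots> = e * \<sigma>" using \<sigma> P by (simp add: field_simps power_def numeral_eq_Suc)
        finally have 1: "\<bar>u \<bullet> (hessian f (x + t *\<^sub>R u) *v u) - u \<bullet> (H *v u)\<bar> \<le> e * \<sigma>"
          by (simp add: matrix_vector_mult_diff_rdistrib inner_diff_right)
        have HP: "norm H \<le> P" using HB P(6) by linarith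
        \<comment> \<open>Replacing \<open>u\<close> by \<open>z\<close> costs two mixed terms, each
          containing \<open>y\<close> once and thus of order
          \<open>\<sigma> * sqrt \<sigma>\<close>; their coefficients 12 and 3 add up to 15.\<close>
        have "u \<bullet> (H *v u) - z \<bullet> (H *v z) = y \<bullet> (H *v u) + z \<bullet> (H *v y)"
          by (simp add: u_def matrix_vector_right_distrib inner_add_left inner_add_right)
        moreover have "\<bar>y \<bullet> (H *v u)\<bar> \<le> P * (3 * P\<^sup>2 * \<sigma>) * (4 * P\<^sup>2 * sqrt \<sigma>)"
          by (rule order_trans[OF abs_quadratic_form_le])
             (intro mult_mono HP y u; use \<sigma> P in simp)
        moreover have "\<bar>z \<bullet> (H *v y)\<bar> \<le> P * (P\<^sup>2 * sqrt \<sigma>) * (3 * P\<^sup>2 * \<sigma>)"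
          by (rule order_trans[OF abs_quadratic_form_le])
             (intro mult_mono HP y z'; use \<sigma> P in simp)
        ultimately have "\<bar>u \<bullet> (H *v u) - z \<bullet> (H *v z)\<bar> \<le> 15 * P^5 * sqrt \<sigma> * \<sigma>"
          by (simp add: power_def numeral_eq_Suc algebra_simps)
        also have "\<dots> \<le> e * \<sigma>"
        proof -
          have "15 * P^5 * sqrt \<sigma> \<le> 16 * P^5 * \<tau>" using sq P \<sigma> by (intro mult_mono) auto
          then have "15 * P^5 * sqrt \<sigma> \<le> e" using \<tau>(3) by (simp only: mult.commute)
          then show ?thesis using \<sigma> by (intro mult_right_mono) auto
        qed
        finally have 2: "\<bar>u \<bullet> (H *v u) - z \<bullet> (H *v z)\<bar> \<le> e * \<sigma>" .
        have 3: "q = h / 2 * (\<Sum>k\<in>I. \<beta> k \<bullet> (H *v \<beta> k)) - 1/2 * (z \<bullet> (H *v z))"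
          unfolding q_def z_def by (rule ito_correction_eq[OF I])
        have 4: "gradient f x \<bullet> u = h * (gradient f x \<bullet> \<alpha>) + q + e * \<sigma>"
          by (simp add: u_def y_def inner_add_right gz gn)
        have "0 \<le> h * (gradient f x \<bullet> \<alpha> + 1/2 * (\<Sum>k\<in>I. \<beta> k \<bullet> (H *v \<beta> k)))"
          using drift h by (simp add: H_def)
        then have "0 \<le> h * (gradient f x \<bullet> \<alpha>) + h / 2 * (\<Sum>k\<in>I. \<beta> k \<bullet> (H *v \<beta> k))"
          by (simp add: algebra_simps)
        \<comment> \<open>Taylor's factor 1/2 halves the two errors in facts 1 and 2, each at most
          \<open>e * \<sigma>\<close>; together they use up exactly the push
          \<open>e * \<sigma>\<close> in fact 4.\<close>
        then show ?thesis using t(3) 1 2 3 4 fx by linarith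
      next
        case False
        have "dist (f p) (f x) < c"
        proof -
          have "x + u \<in> cball 0 (R + 1)" "norm u < d2"
            unfolding mem_cball_0 using ud d x norm_triangle_ineq[of x u] by linarith+
          then show ?thesis using d2(2)[OF xB, of p] by (simp add: p_def dist_norm)
        qed
        then show ?thesis using False by (simp add: dist_real_def)
      qed
      moreover have "e * \<sigma> * P \<le> \<epsilon> * (s + h) + L * s\<^sup>2"
        using mult_right_mono[OF e(3), of \<sigma>] \<sigma> L by (simp add: \<sigma>_def mult_ac add_increasing2)
      moreover have "e * \<sigma> * P \<le> L * (s + h)"
      proof -
        have "e * P \<le> 1 * P" using e P by (intro mult_right_mono) auto
        then show ?thesis using mult_right_mono[of "e * P" L \<sigma>] L \<sigma> by (simp add: \<sigma>_def mult_ac)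
      qed
      ultimately show ?thesis using r unfolding z_def q_def n_def H_def by blast
    next
      case False
      \<comment> \<open>For large increments \<open>sqrt s\<close> is at most a multiple of
        \<open>s\<close>, so the whole Euler step is no longer than a multiple of
        \<open>\<sigma>\<close> and the starting point is near enough.\<close>
      then have sb: "s > \<tau>\<^sup>2 / 2" using h by (simp add: \<sigma>_def h0_def)
      then have \<sigma>s: "\<sigma> \<le> 2 * s" using h by (simp add: \<sigma>_def h0_def)
      have "4 * (\<tau> / 2)\<^sup>2 = \<tau>\<^sup>2" by (simp add: power_divide)
      then have "(\<tau> / 2)\<^sup>2 \<le> s" using sb s0 zero_le_power2[of \<tau>] by linarith
      then have "\<tau> / 2 \<le> sqrt s" by (rule real_le_rsqrt)
      then have "\<tau> / 2 * sqrt s \<le> sqrt s * sqrt s" using s0 by (intro mult_right_mono) auto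
      then have ss: "sqrt s \<le> 2 / \<tau> * s" using \<tau> s0 by (simp add: field_simps)
      have PP: "P \<le> P\<^sup>2" using P(1) by (simp add: self_le_power)
      have "norm (x - (x + h *\<^sub>R \<alpha> + z + q *\<^sub>R n)) \<le> norm (h *\<^sub>R \<alpha>) + norm z + norm (q *\<^sub>R n)"
      proof -
        have "norm (x - (x + h *\<^sub>R \<alpha> + z + q *\<^sub>R n)) = norm (h *\<^sub>R \<alpha> + z + q *\<^sub>R n)"
          by (subst norm_minus_commute) (simp add: add.assoc)
        then show ?thesis
          using norm_triangle_ineq[of "h *\<^sub>R \<alpha> + z" "q *\<^sub>R n"] norm_triangle_ineq[of "h *\<^sub>R \<alpha>" z]
          by linarith
      qed
      also have "\<dots> \<le> P * \<sigma> + P * (2 / \<tau> * \<sigma>) + P * \<sigma> * P"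
      proof -
        have "sqrt s \<le> 2 / \<tau> * \<sigma>"
          by (rule order_trans[OF ss]) (use \<sigma> \<tau> in \<open>simp add: divide_right_mono\<close>)
        then have "P * sqrt s \<le> P * (2 / \<tau> * \<sigma>)" using P(1) by (intro mult_left_mono) auto
        moreover have "P * h \<le> P * \<sigma>" using P(1) \<sigma>(3) by (intro mult_left_mono) auto
        ultimately show ?thesis using h\<alpha> z qn by linarith
      qed
      also have "\<dots> = (P + P * (2 / \<tau>) + P\<^sup>2) * \<sigma>" by (simp add: algebra_simps power2_eq_square)
      also have "\<dots> \<le> L1 * \<sigma>"
      proof -
        have "P * (2 / \<tau>) \<le> P\<^sup>2 * (2 / \<tau>)" using PP \<tau> by (intro mult_right_mono) auto
        then show ?thesis using PP \<sigma> by (intro mult_right_mono) (auto simp: L1_def algebra_simps)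
      qed
      finally have r: "norm (x - (x + h *\<^sub>R \<alpha> + z + q *\<^sub>R n)) \<le> L1 * \<sigma>" .
      have "L1 * \<sigma> \<le> L * (s + h)" unfolding \<sigma>_def[symmetric] using L \<sigma> by (intro mult_right_mono) auto
      moreover have "L1 * \<sigma> \<le> \<epsilon> * (s + h) + L * s\<^sup>2"
      proof -
        have "\<tau>\<^sup>2 / 2 * s \<le> s * s" using sb s0 by (intro mult_right_mono) auto
        then have "2 * s \<le> 4 / \<tau>\<^sup>2 * s\<^sup>2" using \<tau> by (simp add: field_simps power2_eq_square)
        then have "\<sigma> \<le> 4 / \<tau>\<^sup>2 * s\<^sup>2" using \<sigma>s by simp
        then have "L1 * \<sigma> \<le> L1 * (4 / \<tau>\<^sup>2 * s\<^sup>2)" using L1 by (intro mult_left_mono) auto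
        also have "\<dots> \<le> L * s\<^sup>2" using mult_right_mono[OF L(3), of "s\<^sup>2"] by (simp add: mult_ac)
        finally show ?thesis using \<epsilon> s0 h by (simp add: add_increasing)
      qed
      ultimately show ?thesis using r fx unfolding z_def q_def n_def H_def by blast
    qed
  qed
qed

subsection \<open>Square integrable functions\<close>

lemma integrable_inner_of_square_integrable:
  fixes f g :: "'a \<Rightarrow> 'b :: euclidean_space"
  assumes [measurable]: "f \<in> borel_measurable M" "g \<in> borel_measurable M"
    and "integrable M (\<lambda>x. (norm (f x))\<^sup>2)" "integrable M (\<lambda>x. (norm (g x))\<^sup>2)"
  shows "integrable M (\<lambda>x. f x \<bullet> g x)"
proof (rule Bochner_Integration.integrable_bound)
  show "integrable M (\<lambda>x. (norm (f x))\<^sup>2 + (norm (g x))\<^sup>2)" using assms by simp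
  have "\<bar>u \<bullet> v\<bar> \<le> (norm u)\<^sup>2 + (norm v)\<^sup>2" for u v :: 'b
    using Cauchy_Schwarz_ineq2[of u v] sum_squares_bound[of "norm u" "norm v"]
      mult_nonneg_nonneg[OF norm_ge_zero[of u] norm_ge_zero[of v]] by linarith
  then show "AE x in M. norm (f x \<bullet> g x) \<le> norm ((norm (f x))\<^sup>2 + (norm (g x))\<^sup>2)"
    by (auto intro!: AE_I2 simp: abs_of_nonneg)
qed simp

definition square_integrable :: "'a measure \<Rightarrow> ('a \<Rightarrow> 'b :: euclidean_space) \<Rightarrow> bool" where
  "square_integrable M f \<longleftrightarrow> f \<in> borel_measurable M \<and> integrable M (\<lambda>x. (norm (f x))\<^sup>2)"

lemma square_integrable_bound:
  fixes f :: "'a \<Rightarrow> 'b :: euclidean_space"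
  assumes "f \<in> borel_measurable M" "integrable M g" "AE x in M. (norm (f x))\<^sup>2 \<le> g x"
  shows "square_integrable M f"
  unfolding square_integrable_def
  using assms by (auto intro!: Bochner_Integration.integrable_bound[OF assms(2)])

lemma norm_add_square_le: "(norm (x + y))\<^sup>2 \<le> 2 * (norm x)\<^sup>2 + 2 * (norm y)\<^sup>2"
proof -
  have "(norm (x + y))\<^sup>2 \<le> (norm x + norm y)\<^sup>2" by (intro power_mono norm_triangle_ineq) auto
  also have "\<dots> \<le> 2 * (norm x)\<^sup>2 + 2 * (norm y)\<^sup>2"
    using sum_squares_bound[of "norm x" "norm y"] by (simp add: power2_sum)
  finally show ?thesis .
qed

lemma norm_add3_square_le: "(norm (x + y + z))\<^sup>2 \<le> 3 * (norm x)\<^sup>2 + 3 * (norm y)\<^sup>2 + 3 * (norm z)\<^sup>2"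
proof -
  have "(norm (x + y + z))\<^sup>2 \<le> (norm x + norm y + norm z)\<^sup>2"
    by (intro power_mono norm_triangle_le add_mono norm_triangle_ineq) auto
  also have "\<dots> \<le> 3 * (norm x)\<^sup>2 + 3 * (norm y)\<^sup>2 + 3 * (norm z)\<^sup>2"
    using sum_squares_bound[of "norm x" "norm y"] sum_squares_bound[of "norm x" "norm z"]
      sum_squares_bound[of "norm y" "norm z"] by (simp add: power2_eq_square algebra_simps)
  finally show ?thesis .
qed

lemma norm_sum_square_le:
  fixes f :: "'i \<Rightarrow> 'b :: real_normed_vector"
  assumes "finite I"
  shows "(norm (\<Sum>i\<in>I. f i))\<^sup>2 \<le> card I * (\<Sum>i\<in>I. (norm (f i))\<^sup>2)"
proof -
  have "(norm (\<Sum>i\<in>I. f i))\<^sup>2 \<le> (\<Sum>i\<in>I. norm (f i) * 1)\<^sup>2"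
    by (intro power_mono) (auto intro: norm_sum)
  also have "\<dots> \<le> (\<Sum>i\<in>I. (norm (f i))\<^sup>2) * (\<Sum>i\<in>I. 1\<^sup>2)"
    by (rule Cauchy_Schwarz_ineq_sum)
  finally show ?thesis by (simp add: mult.commute)
qed

lemma square_integrable_add:
  assumes "square_integrable M f" "square_integrable M g"
  shows "square_integrable M (\<lambda>x. f x + g x)"
  by (rule square_integrable_bound[where g="\<lambda>x. 2 * (norm (f x))\<^sup>2 + 2 * (norm (g x))\<^sup>2"])
     (use assms in \<open>auto simp: square_integrable_def norm_add_square_le\<close>)

lemma square_integrable_cmult:
  assumes "square_integrable M f"
  shows "square_integrable M (\<lambda>x. (c::real) *\<^sub>R f x)"
  using assms by (auto simp: square_integrable_def power_mult_distrib)

lemma square_integrable_diff: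
  assumes "square_integrable M f" "square_integrable M g"
  shows "square_integrable M (\<lambda>x. f x - g x)"
  using square_integrable_add[OF assms(1) square_integrable_cmult[OF assms(2), of "-1"]] by simp

lemma square_integrable_sum:
  assumes "finite I" "\<And>i. i \<in> I \<Longrightarrow> square_integrable M (f i)"
  shows "square_integrable M (\<lambda>x. \<Sum>i\<in>I. f i x)"
  using assms
proof (induction I)
  case empty
  then show ?case by (simp add: square_integrable_def)
qed (simp add: square_integrable_add)

lemma square_integrable_bounded_scaleR:
  assumes g: "g \<in> borel_measurable M" "\<And>x. x \<in> space M \<Longrightarrow> norm (g x) \<le> K"
    and f: "square_integrable M (f :: _ \<Rightarrow> real)"
  shows "square_integrable M (\<lambda>x. f x *\<^sub>R g x)"
proof (rule square_integrable_bound[where g="\<lambda>x. K\<^sup>2 * (norm (f x))\<^sup>2"])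
  show "AE x in M. (norm (f x *\<^sub>R g x))\<^sup>2 \<le> K\<^sup>2 * (norm (f x))\<^sup>2"
  proof (rule AE_I2)
    fix x assume "x \<in> space M"
    then have "(norm (g x))\<^sup>2 \<le> K\<^sup>2" using g(2) by (intro power_mono) auto
    then show "(norm (f x *\<^sub>R g x))\<^sup>2 \<le> K\<^sup>2 * (norm (f x))\<^sup>2"
      unfolding norm_scaleR power_mult_distrib real_norm_def by (subst mult.commute) (intro mult_right_mono, auto)
  qed
qed (use f g in \<open>auto simp: square_integrable_def\<close>)

lemma square_integrable_inner:
  assumes "square_integrable M f" "square_integrable M g"
  shows "integrable M (\<lambda>x. f x \<bullet> g x)"
  using assms by (auto simp: square_integrable_def intro: integrable_inner_of_square_integrable)

lemma (in finite_measure) square_integrable_bounded: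
  assumes "f \<in> borel_measurable M" "\<And>x. x \<in> space M \<Longrightarrow> norm (f x) \<le> K"
  shows "square_integrable M f"
  using assms by (intro square_integrable_bound[where g="\<lambda>_. K\<^sup>2"]) (auto intro!: AE_I2 power_mono)

lemma nn_integral_square_norm_finite_imp:
  fixes f :: "'a \<Rightarrow> 'b :: euclidean_space"
  assumes "f \<in> borel_measurable M" "(\<integral>\<^sup>+x. ennreal ((norm (f x))\<^sup>2) \<partial>M) < \<infinity>"
  shows "square_integrable M f"
  unfolding square_integrable_def using assms by (auto intro: integrableI_nonneg)

text \<open>Processes are only measurable on nonnegative times, hence the \<open>max 0\<close>.\<close>

lemma measurable_process_compose:
  assumes H: "measurable_process M H" and [measurable]: "f \<in> borel_measurable N" "g \<in> measurable N M"
  shows "(\<lambda>x. H (max 0 (f x)) (g x)) \<in> borel_measurable N"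
proof -
  have "(\<lambda>x. (max 0 (f x), g x)) \<in> measurable N (restrict_space borel {0..} \<Otimes>\<^sub>M M)"
    by (intro measurable_Pair measurable_restrict_space2) auto
  from measurable_compose[OF this H[unfolded measurable_process_def]] show ?thesis by simp
qed

text \<open>The overlap length computed here is also the covariance of the Wiener increments over
  the two intervals; the isometry for simple integrands rests on this coincidence.\<close>

lemma has_bochner_integral_indicator_product:
  "has_bochner_integral lborel (\<lambda>s. indicator {a<..b::real} s * indicator {c<..d} s) (max 0 (min b d - max a c))"
proof -
  have "(\<lambda>s. indicator {a<..b} s * indicator {c<..d} s :: real) = indicator {max a c<..min b d}"
    by (auto simp: fun_eq_iff indicator_def)
  moreover have "has_bochner_integral lborel (indicator {max a c<..min b d} :: real \<Rightarrow> real) (max 0 (min b d - max a c))"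
    by (simp add: has_bochner_integral_iff) (auto simp: max_def)
  ultimately show ?thesis by simp
qed

text \<open>Lets an integral over \<open>(t, u]\<close> be treated as an ordinary simple integral
  whose nodes are moved into \<open>[t, u]\<close>.\<close>

lemma indicator_clamped_interval:
  fixes t u x y s :: real
  assumes "t \<le> u"
  shows "indicator {max t (min u x)<..max t (min u y)} s = (indicator {t<..u} s * indicator {x<..y} s :: real)"
  using assms by (auto simp: indicator_def max_def min_def split: if_splits)

subsection \<open>Wiener increments and the Ito integral\<close>

context usual_filtered_prob_space
begin

lemma space_F: "0 \<le> t \<Longrightarrow> space (F t) = space M"
  using subalgebra_F by (auto simp: subalgebra_def)

lemma measurable_F_M:
  "0 \<le> t \<Longrightarrow> f \<in> measurable (F t) N \<Longrightarrow> f \<in> measurable M N"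
  using measurable_from_subalg[OF subalgebra_F] .

lemma measurable_F_mono:
  assumes "0 \<le> s" "s \<le> t" "f \<in> measurable (F s) N"
  shows "f \<in> measurable (F t) N"
  using assms F_mono[OF assms(1,2)] space_F[of s] space_F[of t] unfolding measurable_def by auto

lemma wiener_measurable_F:
  assumes "wiener_process M F V" "0 \<le> s" "s \<le> t"
  shows "V s \<in> borel_measurable (F t)"
  using assms measurable_F_mono[of s t "V s"] by (auto simp: wiener_process_def adapted_def)

lemma wiener_measurable:
  assumes "wiener_process M F V" "0 \<le> s"
  shows "V s \<in> borel_measurable M"
  using wiener_measurable_F[OF assms order_refl] measurable_F_M[OF assms(2)] by blast

text \<open>\<open>Z\<close> generates a sub-sigma-algebra of \<open>F s\<close>, so the
  independence of the increment from \<open>F s\<close>, stated for sigma-algebras, passes to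
  \<open>Z\<close>.\<close>

lemma wiener_increment_indep_var:
  fixes Z :: "'w \<Rightarrow> real"
  assumes V: "wiener_process M F V" and st: "0 \<le> s" "s < t"
    and Z: "Z \<in> borel_measurable (F s)"
  shows "indep_var borel Z borel (\<lambda>\<omega>. V t \<omega> - V s \<omega>)"
  unfolding indep_var_eq
proof (intro conjI)
  show "random_variable borel Z" using measurable_F_M[OF st(1) Z] .
  show "random_variable borel (\<lambda>\<omega>. V t \<omega> - V s \<omega>)"
    using wiener_measurable[OF V] st by simp
  have ind: "indep_set (sets (F s)) (sets (vimage_algebra (space M) (\<lambda>\<omega>. V t \<omega> - V s \<omega>) borel))"
    using V st by (auto simp: wiener_process_def)
  have "{Z -` A \<inter> space M |A. A \<in> sets borel} \<subseteq> sets (F s)"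
    using measurable_sets[OF Z] space_F[OF st(1)] by auto
  then have "sigma_sets (space M) {Z -` A \<inter> space M |A. A \<in> sets borel} \<subseteq> sets (F s)"
    using sets.sigma_sets_subset[of _ "F s"] space_F[OF st(1)] by simp
  then show "indep_set (sigma_sets (space M) {Z -` A \<inter> space M |A. A \<in> sets borel})
     (sigma_sets (space M) {(\<lambda>\<omega>. V t \<omega> - V s \<omega>) -` A \<inter> space M |A. A \<in> sets borel})"
    using ind unfolding sets_vimage_algebra indep_set_def
    by (elim indep_sets_mono_sets) (auto split: bool.splits)
qed

lemma wiener_increment_moments:
  assumes V: "wiener_process M F V" and st: "0 \<le> s" "s \<le> t"
  shows "integrable M (\<lambda>\<omega>. (V t \<omega> - V s \<omega>) ^ n)"
    and "expectation (\<lambda>\<omega>. V t \<omega> - V s \<omega>) = 0"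
    and "expectation (\<lambda>\<omega>. (V t \<omega> - V s \<omega>)\<^sup>2) = t - s"
    and "expectation (\<lambda>\<omega>. (V t \<omega> - V s \<omega>) ^ 4) = 3 * (t - s)\<^sup>2"
proof -
  have "integrable M (\<lambda>\<omega>. (V t \<omega> - V s \<omega>) ^ n) \<and> expectation (\<lambda>\<omega>. V t \<omega> - V s \<omega>) = 0
    \<and> expectation (\<lambda>\<omega>. (V t \<omega> - V s \<omega>)\<^sup>2) = t - s
    \<and> expectation (\<lambda>\<omega>. (V t \<omega> - V s \<omega>) ^ 4) = 3 * (t - s)\<^sup>2"
  \<comment> \<open>The definition of a Wiener process gives a density for s < t only; for s = t the
    increment vanishes identically.\<close>
  proof (cases "s = t")
    case False
    define \<sigma> where "\<sigma> = sqrt (t - s)"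
    have \<sigma>: "\<sigma> > 0" "\<sigma>\<^sup>2 = t - s" using False st by (auto simp: \<sigma>_def)
    have D: "distributed M lborel (\<lambda>\<omega>. V t \<omega> - V s \<omega>) (normal_density 0 \<sigma>)"
      using V st False by (auto simp: wiener_process_def \<sigma>_def)
    have "integrable lborel (\<lambda>x. normal_density 0 \<sigma> x * (x - 0) ^ n)"
      by (rule integrable_normal_moment[OF \<sigma>(1)])
    then have 1: "integrable M (\<lambda>\<omega>. (V t \<omega> - V s \<omega>) ^ n)"
      using distributed_integrable[OF D, of "\<lambda>x. x ^ n"] by simp
    have 2: "expectation (\<lambda>\<omega>. (V t \<omega> - V s \<omega>) ^ (2 * k)) = fact (2 * k) / ((2 / \<sigma>\<^sup>2)^k * fact k)" for k
      using integral_normal_moment_even[OF \<sigma>(1), of 0 k] distributed_integral[OF D, of "\<lambda>x. x ^ (2 * k)"]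
      by simp
    have "fact 4 = (24 :: real)" by (simp add: fact_numeral)
    then show ?thesis
      using 1 2[of 1] 2[of 2] \<sigma> normal_distributed_expectation[OF \<sigma>(1) D]
      by (simp add: power2_eq_square[of \<sigma>] \<sigma>(2)[unfolded power2_eq_square] power_divide eval_nat_numeral)
  qed simp
  then show "integrable M (\<lambda>\<omega>. (V t \<omega> - V s \<omega>) ^ n)"
    and "expectation (\<lambda>\<omega>. V t \<omega> - V s \<omega>) = 0"
    and "expectation (\<lambda>\<omega>. (V t \<omega> - V s \<omega>)\<^sup>2) = t - s"
    and "expectation (\<lambda>\<omega>. (V t \<omega> - V s \<omega>) ^ 4) = 3 * (t - s)\<^sup>2"
    by blast+
qed

lemma expectation_mult_increment_power:
  fixes Z :: "'w \<Rightarrow> real"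
  assumes V: "wiener_process M F V" and st: "0 \<le> s" "s \<le> t"
    and Z: "Z \<in> borel_measurable (F s)" "integrable M Z"
  shows "integrable M (\<lambda>\<omega>. Z \<omega> * (V t \<omega> - V s \<omega>) ^ n)"
    and "expectation (\<lambda>\<omega>. Z \<omega> * (V t \<omega> - V s \<omega>) ^ n)
      = expectation Z * expectation (\<lambda>\<omega>. (V t \<omega> - V s \<omega>) ^ n)"
proof -
  have "integrable M (\<lambda>\<omega>. Z \<omega> * (V t \<omega> - V s \<omega>) ^ n)
    \<and> expectation (\<lambda>\<omega>. Z \<omega> * (V t \<omega> - V s \<omega>) ^ n)
      = expectation Z * expectation (\<lambda>\<omega>. (V t \<omega> - V s \<omega>) ^ n)"
  proof (cases "s = t")
    case True
    then show ?thesis using Z by (cases n) (auto simp: prob_space)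
  next
    case False
    have "indep_var borel ((\<lambda>x. x) \<circ> Z) borel ((\<lambda>x. x ^ n) \<circ> (\<lambda>\<omega>. V t \<omega> - V s \<omega>))"
      using wiener_increment_indep_var[OF V _ _ Z(1), of t] st False by (intro indep_var_compose) auto
    then have "indep_var borel Z borel (\<lambda>\<omega>. (V t \<omega> - V s \<omega>) ^ n)" by (simp add: comp_def)
    then show ?thesis
      using Z wiener_increment_moments(1)[OF V st, of n]
      by (auto intro: indep_var_integrable indep_var_lebesgue_integral)
  qed
  then show "integrable M (\<lambda>\<omega>. Z \<omega> * (V t \<omega> - V s \<omega>) ^ n)"
    and "expectation (\<lambda>\<omega>. Z \<omega> * (V t \<omega> - V s \<omega>) ^ n)
      = expectation Z * expectation (\<lambda>\<omega>. (V t \<omega> - V s \<omega>) ^ n)" by blast+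
qed

lemma expectation_mult_increment:
  fixes Z :: "'w \<Rightarrow> real"
  assumes V: "wiener_process M F V" and st: "0 \<le> s" "s \<le> t"
    and Z: "Z \<in> borel_measurable (F s)" "integrable M Z"
  shows "integrable M (\<lambda>\<omega>. Z \<omega> * (V t \<omega> - V s \<omega>))"
    and "expectation (\<lambda>\<omega>. Z \<omega> * (V t \<omega> - V s \<omega>)) = 0"
    and "integrable M (\<lambda>\<omega>. Z \<omega> * (V t \<omega> - V s \<omega>)\<^sup>2)"
    and "expectation (\<lambda>\<omega>. Z \<omega> * (V t \<omega> - V s \<omega>)\<^sup>2) = expectation Z * (t - s)"
  using expectation_mult_increment_power[OF assms, of 1] expectation_mult_increment_power[OF assms, of 2]
    wiener_increment_moments[OF V st] by simp_all

lemma integrable_bounded_mult: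
  fixes f :: "'w \<Rightarrow> real"
  assumes "Z \<in> borel_measurable M" "\<And>\<omega>. \<omega> \<in> space M \<Longrightarrow> \<bar>Z \<omega>\<bar> \<le> K" "integrable M f"
  shows "integrable M (\<lambda>\<omega>. Z \<omega> * f \<omega>)"
proof (rule Bochner_Integration.integrable_bound)
  show "integrable M (\<lambda>\<omega>. K * f \<omega>)" using assms by simp
  show "AE \<omega> in M. norm (Z \<omega> * f \<omega>) \<le> norm (K * f \<omega>)"
    using assms(2) by (intro AE_I2) (force simp: abs_mult intro!: mult_right_mono)
qed (use assms in auto)

lemma integrable_bounded:
  fixes Z :: "'w \<Rightarrow> real"
  assumes "Z \<in> borel_measurable M" "\<And>\<omega>. \<omega> \<in> space M \<Longrightarrow> \<bar>Z \<omega>\<bar> \<le> K"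
  shows "integrable M Z"
  using integrable_bounded_mult[OF assms, of "\<lambda>_. 1"] by simp

text \<open>If the intervals do not overlap, the earlier increment joins \<open>Z\<close> in the
  past and the later one is centred. Otherwise both are cut at \<open>c\<close> and at the first
  right end point, and only the square over the common part contributes to the mean.\<close>

lemma expectation_increment_product_aux:
  fixes Z :: "'w \<Rightarrow> real"
  assumes V: "wiener_process M F V" and ab: "0 \<le> a" "a \<le> b" and cd: "c \<le> d" "a \<le> c"
    and Z: "Z \<in> borel_measurable (F c)" "\<And>\<omega>. \<omega> \<in> space M \<Longrightarrow> \<bar>Z \<omega>\<bar> \<le> K"
  shows "integrable M (\<lambda>\<omega>. Z \<omega> * ((V b \<omega> - V a \<omega>) * (V d \<omega> - V c \<omega>)))
    \<and> expectation (\<lambda>\<omega>. Z \<omega> * ((V b \<omega> - V a \<omega>) * (V d \<omega> - V c \<omega>)))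
      = expectation Z * max 0 (min b d - c)"
proof -
  have c0: "0 \<le> c" using ab cd by simp
  have ZM: "Z \<in> borel_measurable M" using measurable_F_M[OF c0 Z(1)] .
  note iZ = integrable_bounded[OF ZM Z(2)]
  have iI: "integrable M (\<lambda>\<omega>. V y \<omega> - V x \<omega>)" if "0 \<le> x" "x \<le> y" for x y
    using wiener_increment_moments(1)[OF V that, of 1] by simp
  show ?thesis
  proof (cases "b \<le> c")
    case True
    have "(\<lambda>\<omega>. Z \<omega> * (V b \<omega> - V a \<omega>)) \<in> borel_measurable (F c)"
      using Z(1) wiener_measurable_F[OF V] ab True cd by simp
    moreover have "integrable M (\<lambda>\<omega>. Z \<omega> * (V b \<omega> - V a \<omega>))"
      using integrable_bounded_mult[OF ZM Z(2) iI[OF ab]] .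
    ultimately show ?thesis
      using expectation_mult_increment(1,2)[OF V c0 cd(1), of "\<lambda>\<omega>. Z \<omega> * (V b \<omega> - V a \<omega>)"] True
      by (simp add: mult.assoc max_def)
  next
    case False
    define e where "e = min b d"
    have e: "c \<le> e" "e \<le> b" "e \<le> d" "e = b \<or> e = d" using False cd by (auto simp: e_def)
    have 1: "integrable M (\<lambda>\<omega>. (Z \<omega> * (V c \<omega> - V a \<omega>)) * (V d \<omega> - V c \<omega>))
        \<and> expectation (\<lambda>\<omega>. (Z \<omega> * (V c \<omega> - V a \<omega>)) * (V d \<omega> - V c \<omega>)) = 0"
      using Z(1) wiener_measurable_F[OF V] ab cd integrable_bounded_mult[OF ZM Z(2) iI[of a c]]
      by (intro conjI expectation_mult_increment[OF V c0 cd(1)]) auto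
    have 2: "integrable M (\<lambda>\<omega>. Z \<omega> * (V e \<omega> - V c \<omega>)\<^sup>2)
        \<and> expectation (\<lambda>\<omega>. Z \<omega> * (V e \<omega> - V c \<omega>)\<^sup>2) = expectation Z * (e - c)"
      using expectation_mult_increment(3,4)[OF V c0 e(1) Z(1) iZ] by blast
    have 3: "integrable M (\<lambda>\<omega>. (Z \<omega> * (V e \<omega> - V c \<omega>)) * (V f \<omega> - V e \<omega>))
        \<and> expectation (\<lambda>\<omega>. (Z \<omega> * (V e \<omega> - V c \<omega>)) * (V f \<omega> - V e \<omega>)) = 0" if "e \<le> f" for f
      using measurable_F_mono[OF c0 e(1) Z(1)] wiener_measurable_F[OF V] c0 e
        integrable_bounded_mult[OF ZM Z(2) iI[of c e]] that
      by (intro conjI expectation_mult_increment[OF V _ that]) auto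
    \<comment> \<open>At most one of the two intervals continues beyond \<open>e\<close>; its right
      end point is \<open>if e = b then d else b\<close>.\<close>
    have eq: "Z \<omega> * ((V b \<omega> - V a \<omega>) * (V d \<omega> - V c \<omega>))
       = (Z \<omega> * (V c \<omega> - V a \<omega>)) * (V d \<omega> - V c \<omega>) + Z \<omega> * (V e \<omega> - V c \<omega>)\<^sup>2
         + (Z \<omega> * (V e \<omega> - V c \<omega>)) * (V (if e = b then d else b) \<omega> - V e \<omega>)" for \<omega>
      using e(4) by (auto simp: algebra_simps power2_eq_square)
    have "e \<le> (if e = b then d else b)" using e by auto
    then show ?thesis
      unfolding eq using 1 2 3 e(1) by (auto simp: e_def)
  qed
qed

lemma expectation_increment_product:
  fixes Z :: "'w \<Rightarrow> real"
  assumes V: "wiener_process M F V" and ab: "0 \<le> a" "a \<le> b" and cd: "0 \<le> c" "c \<le> d"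
    and Z: "Z \<in> borel_measurable (F (max a c))" "\<And>\<omega>. \<omega> \<in> space M \<Longrightarrow> \<bar>Z \<omega>\<bar> \<le> K"
  shows "integrable M (\<lambda>\<omega>. Z \<omega> * ((V b \<omega> - V a \<omega>) * (V d \<omega> - V c \<omega>)))
    \<and> expectation (\<lambda>\<omega>. Z \<omega> * ((V b \<omega> - V a \<omega>) * (V d \<omega> - V c \<omega>)))
      = expectation Z * max 0 (min b d - max a c)"
proof (cases "a \<le> c")
  case True
  then show ?thesis
    using expectation_increment_product_aux[OF V ab cd(2) True _ Z(2)] Z(1) by (simp add: max_def)
next
  case False
  then show ?thesis
    using expectation_increment_product_aux[OF V cd ab(2) _ _ Z(2)] Z(1)
    by (simp add: max_def min.commute mult.commute[of "V b _ - V a _"])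
qed

text \<open>Both squares expand into double sums over pairs of steps. On either side a pair
  contributes the mean of \<open>\<zeta> i \<bullet> \<zeta> j\<close> times the overlap of its
  intervals, because this product is known at the later of the two left end points. The intervals
  may overlap arbitrarily, which allows a further step to be subtracted from a given simple
  process.\<close>

lemma simple_isometry:
  fixes \<zeta> :: "nat \<Rightarrow> 'w \<Rightarrow> 'v :: euclidean_space"
  assumes V: "wiener_process M F V" and J: "finite J"
    and ab: "\<And>i. i \<in> J \<Longrightarrow> 0 \<le> a i \<and> a i \<le> b i"
    and \<zeta>: "\<And>i. i \<in> J \<Longrightarrow> \<zeta> i \<in> borel_measurable (F (a i))"
      "\<And>i \<omega>. i \<in> J \<Longrightarrow> \<omega> \<in> space M \<Longrightarrow> norm (\<zeta> i \<omega>) \<le> K"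
  shows "(\<integral>\<^sup>+\<omega>. ennreal ((norm (\<Sum>i\<in>J. (V (b i) \<omega> - V (a i) \<omega>) *\<^sub>R \<zeta> i \<omega>))\<^sup>2) \<partial>M)
    = (\<integral>\<^sup>+\<omega>. (\<integral>\<^sup>+s. ennreal ((norm (\<Sum>i\<in>J. indicator {a i<..b i} s *\<^sub>R \<zeta> i \<omega>))\<^sup>2) \<partial>lborel) \<partial>M)"
proof -
  define len where "len i j = max 0 (min (b i) (b j) - max (a i) (a j))" for i j
  have \<zeta>M [measurable]: "\<zeta> i \<in> borel_measurable M" if "i \<in> J" for i
    using measurable_F_M[OF _ \<zeta>(1)[OF that]] ab[OF that] by blast
  have bd: "\<bar>\<zeta> i \<omega> \<bullet> \<zeta> j \<omega>\<bar> \<le> K * K" if "i \<in> J" "j \<in> J" "\<omega> \<in> space M" for i j \<omega>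
    using Cauchy_Schwarz_ineq2[of "\<zeta> i \<omega>" "\<zeta> j \<omega>"] \<zeta>(2)[OF that(1,3)] \<zeta>(2)[OF that(2,3)]
    by (meson mult_mono norm_ge_zero order_trans)
  have 1: "integrable M (\<lambda>\<omega>. (\<zeta> i \<omega> \<bullet> \<zeta> j \<omega>) * ((V (b i) \<omega> - V (a i) \<omega>) * (V (b j) \<omega> - V (a j) \<omega>)))
    \<and> expectation (\<lambda>\<omega>. (\<zeta> i \<omega> \<bullet> \<zeta> j \<omega>) * ((V (b i) \<omega> - V (a i) \<omega>) * (V (b j) \<omega> - V (a j) \<omega>)))
      = expectation (\<lambda>\<omega>. \<zeta> i \<omega> \<bullet> \<zeta> j \<omega>) * len i j" if ij: "i \<in> J" "j \<in> J" for i j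
    unfolding len_def
  proof (rule expectation_increment_product[OF V])
    show "(\<lambda>\<omega>. \<zeta> i \<omega> \<bullet> \<zeta> j \<omega>) \<in> borel_measurable (F (max (a i) (a j)))"
      using measurable_F_mono[OF _ _ \<zeta>(1), of i "max (a i) (a j)"]
        measurable_F_mono[OF _ _ \<zeta>(1), of j "max (a i) (a j)"] ij ab by simp
  qed (use ij ab bd in auto)
  have sqV: "(norm (\<Sum>i\<in>J. (V (b i) \<omega> - V (a i) \<omega>) *\<^sub>R \<zeta> i \<omega>))\<^sup>2
    = (\<Sum>i\<in>J. \<Sum>j\<in>J. (\<zeta> i \<omega> \<bullet> \<zeta> j \<omega>) * ((V (b i) \<omega> - V (a i) \<omega>) * (V (b j) \<omega> - V (a j) \<omega>)))" for \<omega>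
    unfolding power2_norm_eq_inner inner_sum_left inner_sum_right
    by (intro sum.cong refl) (simp add: mult_ac inner_commute)
  have sqI: "(norm (\<Sum>i\<in>J. indicator {a i<..b i} s *\<^sub>R \<zeta> i \<omega>))\<^sup>2
    = (\<Sum>i\<in>J. \<Sum>j\<in>J. (\<zeta> i \<omega> \<bullet> \<zeta> j \<omega>) * (indicator {a i<..b i} s * indicator {a j<..b j} s))" for \<omega> s
    unfolding power2_norm_eq_inner inner_sum_left inner_sum_right
    by (intro sum.cong refl) (simp add: mult_ac inner_commute)
  have hb: "has_bochner_integral lborel (\<lambda>s. (norm (\<Sum>i\<in>J. indicator {a i<..b i} s *\<^sub>R \<zeta> i \<omega>))\<^sup>2)
      (\<Sum>i\<in>J. \<Sum>j\<in>J. (\<zeta> i \<omega> \<bullet> \<zeta> j \<omega>) * len i j)" for \<omega>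
    unfolding sqI len_def
    by (intro has_bochner_integral_sum has_bochner_integral_mult_right has_bochner_integral_indicator_product)
  have inner: "(\<integral>\<^sup>+s. ennreal ((norm (\<Sum>i\<in>J. indicator {a i<..b i} s *\<^sub>R \<zeta> i \<omega>))\<^sup>2) \<partial>lborel)
      = ennreal (\<Sum>i\<in>J. \<Sum>j\<in>J. (\<zeta> i \<omega> \<bullet> \<zeta> j \<omega>) * len i j)" for \<omega>
    using hb[of \<omega>] by (subst nn_integral_eq_integral) (auto simp: has_bochner_integral_iff)
  have nn: "0 \<le> (\<Sum>i\<in>J. \<Sum>j\<in>J. (\<zeta> i \<omega> \<bullet> \<zeta> j \<omega>) * len i j)" for \<omega>
    using hb[of \<omega>] by (metis (no_types, lifting) has_bochner_integral_iff integral_nonneg_AE AE_I2 zero_le_power2)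
  have ibd: "integrable M (\<lambda>\<omega>. \<zeta> i \<omega> \<bullet> \<zeta> j \<omega>)" if "i \<in> J" "j \<in> J" for i j
    using that bd by (intro integrable_bounded[where K="K * K"]) auto
  have "(\<integral>\<^sup>+\<omega>. ennreal ((norm (\<Sum>i\<in>J. (V (b i) \<omega> - V (a i) \<omega>) *\<^sub>R \<zeta> i \<omega>))\<^sup>2) \<partial>M)
      = ennreal (expectation (\<lambda>\<omega>. (norm (\<Sum>i\<in>J. (V (b i) \<omega> - V (a i) \<omega>) *\<^sub>R \<zeta> i \<omega>))\<^sup>2))"
  proof (rule nn_integral_eq_integral)
    show "integrable M (\<lambda>\<omega>. (norm (\<Sum>i\<in>J. (V (b i) \<omega> - V (a i) \<omega>) *\<^sub>R \<zeta> i \<omega>))\<^sup>2)"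
      unfolding sqV using 1 by (intro Bochner_Integration.integrable_sum) auto
  qed simp
  also have "expectation (\<lambda>\<omega>. (norm (\<Sum>i\<in>J. (V (b i) \<omega> - V (a i) \<omega>) *\<^sub>R \<zeta> i \<omega>))\<^sup>2)
      = (\<Sum>i\<in>J. \<Sum>j\<in>J. expectation (\<lambda>\<omega>. \<zeta> i \<omega> \<bullet> \<zeta> j \<omega>) * len i j)"
    unfolding sqV using 1
    by (subst Bochner_Integration.integral_sum; (intro Bochner_Integration.integrable_sum)?; simp)+
  also have "\<dots> = expectation (\<lambda>\<omega>. \<Sum>i\<in>J. \<Sum>j\<in>J. (\<zeta> i \<omega> \<bullet> \<zeta> j \<omega>) * len i j)"
    using ibd by (subst Bochner_Integration.integral_sum; (intro Bochner_Integration.integrable_sum)?; simp)+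
  also have "ennreal \<dots> = (\<integral>\<^sup>+\<omega>. ennreal (\<Sum>i\<in>J. \<Sum>j\<in>J. (\<zeta> i \<omega> \<bullet> \<zeta> j \<omega>) * len i j) \<partial>M)"
    by (rule nn_integral_eq_integral[symmetric])
       (use ibd nn in \<open>auto intro!: Bochner_Integration.integrable_sum\<close>)
  finally show ?thesis by (simp only: inner)
qed

lemma wiener_increment_square_integrable:
  assumes V: "wiener_process M F V" and st: "0 \<le> s" "s \<le> t"
  shows "square_integrable M (\<lambda>\<omega>. V t \<omega> - V s \<omega>)"
  using wiener_increment_moments(1)[OF assms, of 2] wiener_measurable[OF V] st
  by (auto simp: square_integrable_def)

text \<open>Mutual independence of the Wiener processes does not say directly that the pair of increments is
  independent of the past. Splitting the interval into \<open>N\<close> parts, the off-diagonal products vanish because each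
  process is Wiener with respect to the filtration; the diagonal sum has second moment
  \<open>(u - t)\<^sup>2 / N\<close> by mutual independence.\<close>

lemma expectation_mult_independent_increments:
  fixes Z :: "'w \<Rightarrow> real"
  assumes V: "\<And>k. k \<in> I \<Longrightarrow> wiener_process M F (V k)" and ind: "independent_processes M I V"
    and kl: "k \<in> I" "l \<in> I" "k \<noteq> l" and tu: "0 \<le> t" "t \<le> u"
    and Z: "Z \<in> borel_measurable (F t)" "\<And>\<omega>. \<omega> \<in> space M \<Longrightarrow> \<bar>Z \<omega>\<bar> \<le> K"
  shows "integrable M (\<lambda>\<omega>. Z \<omega> * ((V k u \<omega> - V k t \<omega>) * (V l u \<omega> - V l t \<omega>)))"
    and "expectation (\<lambda>\<omega>. Z \<omega> * ((V k u \<omega> - V k t \<omega>) * (V l u \<omega> - V l t \<omega>))) = 0"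
proof -
  note Vk = V[OF kl(1)] and Vl = V[OF kl(2)]
  have ZM[measurable]: "Z \<in> borel_measurable M" using measurable_F_M[OF tu(1) Z(1)] .
  have I2: "integrable M (\<lambda>\<omega>. Z \<omega> * ((V k b \<omega> - V k a \<omega>) * (V l d \<omega> - V l c \<omega>)))"
    if "0 \<le> a" "a \<le> b" "0 \<le> c" "c \<le> d" for a b c d
    using square_integrable_inner[OF wiener_increment_square_integrable[OF Vk that(1,2)]
        wiener_increment_square_integrable[OF Vl that(3,4)]]
    by (intro integrable_bounded_mult[OF ZM Z(2)]) auto
  show "integrable M (\<lambda>\<omega>. Z \<omega> * ((V k u \<omega> - V k t \<omega>) * (V l u \<omega> - V l t \<omega>)))"
    using tu by (intro I2) auto
  obtain \<omega>0 where "\<omega>0 \<in> space M" using not_empty by blast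
  then have K: "0 \<le> K" using Z(2)[of \<omega>0] by linarith
  define x where "x = expectation (\<lambda>\<omega>. Z \<omega> * ((V k u \<omega> - V k t \<omega>) * (V l u \<omega> - V l t \<omega>)))"
  \<comment> \<open>A weight \<open>\<theta>\<close> does the work of Cauchy-Schwarz: the bound |S|
    <= \<theta> + S^2 / \<theta> separates the bounded factor \<open>Z\<close> from the second
    moment of the diagonal sum \<open>S\<close>.\<close>
  have bound: "\<bar>x\<bar> \<le> K * (\<theta> + (u - t)\<^sup>2 / (N * \<theta>))" if "\<theta> > 0" "N > 0" for \<theta> :: real and N :: nat
  proof -
    define c where "c i = t + real i * ((u - t) / N)" for i :: nat
    have c: "t \<le> c i" "c i \<le> c (Suc i)" "c 0 = t" "c N = u" "0 \<le> c i" "c (Suc i) - c i = (u - t) / N" for i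
    proof -
      have q: "0 \<le> (u - t) / N" using tu that by simp
      show "c (Suc i) - c i = (u - t) / N" unfolding c_def of_nat_Suc distrib_right by linarith
      then show "c i \<le> c (Suc i)" using q by linarith
      show "t \<le> c i" using mult_nonneg_nonneg[OF _ q, of "real i"] by (simp add: c_def)
      then show "0 \<le> c i" using tu by linarith
      show "c 0 = t" "c N = u" using that by (auto simp: c_def)
    qed
    have cm: "c i \<le> c j" if "i \<le> j" for i j
      using that tu by (auto simp: c_def intro!: divide_right_mono mult_right_mono)
    define D where "D k i \<omega> = V k (c (Suc i)) \<omega> - V k (c i) \<omega>" for k i \<omega>
    have tel: "(\<Sum>i<N. D k i \<omega>) = V k u \<omega> - V k t \<omega>" for k \<omega>
      unfolding D_def using sum_lessThan_telescope[of "\<lambda>i. V k (c i) \<omega>" N] c by simp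
    have DI: "integrable M (\<lambda>\<omega>. Z \<omega> * (D k i \<omega> * D l j \<omega>))" for i j
      unfolding D_def using c by (intro I2) auto
    have D1: "integrable M (D k' i)" if "k' \<in> I" for k' i
      using wiener_increment_moments(1)[OF V[OF that] c(5)[of i] c(2)[of i], of 1] by (simp add: D_def[abs_def])
    have DF: "D k' i \<in> borel_measurable (F (c j))" if "k' \<in> I" "i < j" for k' i j
      unfolding D_def[abs_def]
      using wiener_measurable_F[OF V[OF that(1)]] cm[of i j] cm[of "Suc i" j] that c by simp
    have ZF: "Z \<in> borel_measurable (F (c j))" for j
      using measurable_F_mono[OF tu(1) c(1) Z(1)] .
    \<comment> \<open>In an off-diagonal product the earlier increment belongs to the past of the
      later one, whichever process it comes from.\<close>
    have off: "expectation (\<lambda>\<omega>. Z \<omega> * (D k i \<omega> * D l j \<omega>)) = 0" if "i \<noteq> j" for i j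
    proof (cases "i < j")
      case True
      have "expectation (\<lambda>\<omega>. (Z \<omega> * D k i \<omega>) * (V l (c (Suc j)) \<omega> - V l (c j) \<omega>)) = 0"
        using DF[OF kl(1) True] ZF integrable_bounded_mult[OF ZM Z(2) D1[OF kl(1)]]
        by (intro expectation_mult_increment(2)[OF Vl c(5) c(2)]) auto
      then show ?thesis by (simp add: D_def mult_ac)
    next
      case False
      then have ji: "j < i" using that by simp
      have "expectation (\<lambda>\<omega>. (Z \<omega> * D l j \<omega>) * (V k (c (Suc i)) \<omega> - V k (c i) \<omega>)) = 0"
        using DF[OF kl(2) ji] ZF integrable_bounded_mult[OF ZM Z(2) D1[OF kl(2)]]
        by (intro expectation_mult_increment(2)[OF Vk c(5) c(2)]) auto
      then show ?thesis by (simp add: D_def mult_ac)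
    qed
    define S where "S \<omega> = (\<Sum>i<N. D k i \<omega> * D l i \<omega>)" for \<omega>
    have "x = expectation (\<lambda>\<omega>. \<Sum>i<N. \<Sum>j<N. Z \<omega> * (D k i \<omega> * D l j \<omega>))"
      unfolding x_def tel[symmetric] sum_product by (simp add: sum_distrib_left)
    also have "\<dots> = (\<Sum>i<N. \<Sum>j<N. expectation (\<lambda>\<omega>. Z \<omega> * (D k i \<omega> * D l j \<omega>)))"
      using DI by (subst Bochner_Integration.integral_sum; (intro Bochner_Integration.integrable_sum)?; simp)+
    also have "\<dots> = (\<Sum>i<N. expectation (\<lambda>\<omega>. Z \<omega> * (D k i \<omega> * D l i \<omega>)))"
    proof (rule sum.cong)
      fix i assume "i \<in> {..<N}"
      then have "(\<Sum>j<N. expectation (\<lambda>\<omega>. Z \<omega> * (D k i \<omega> * D l j \<omega>)))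
          = (\<Sum>j\<in>{i}. expectation (\<lambda>\<omega>. Z \<omega> * (D k i \<omega> * D l j \<omega>)))"
        using off[of i] by (intro sum.mono_neutral_right) auto
      then show "(\<Sum>j<N. expectation (\<lambda>\<omega>. Z \<omega> * (D k i \<omega> * D l j \<omega>)))
          = expectation (\<lambda>\<omega>. Z \<omega> * (D k i \<omega> * D l i \<omega>))" by simp
    qed simp
    also have "\<dots> = expectation (\<lambda>\<omega>. Z \<omega> * S \<omega>)"
      unfolding S_def sum_distrib_left using DI by (subst Bochner_Integration.integral_sum) auto
    finally have x: "x = expectation (\<lambda>\<omega>. Z \<omega> * S \<omega>)" .
    define q where "q = (u - t) / N"
    have prod: "integrable M (\<lambda>\<omega>. D k' i \<omega> * D k' j \<omega>)
        \<and> expectation (\<lambda>\<omega>. D k' i \<omega> * D k' j \<omega>) = (if i = j then q else 0)" if k': "k' \<in> I" for k' i j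
    proof -
      have len: "max 0 (min (c (Suc i)) (c (Suc j)) - max (c i) (c j)) = (if i = j then q else 0)"
      proof (cases "i = j")
        case True
        then show ?thesis using c(2,6)[of j] by (simp add: q_def max_def min_def)
      next
        case False
        then have "c (Suc i) \<le> c j \<or> c (Suc j) \<le> c i" using cm by (meson Suc_leI linorder_neqE_nat)
        then show ?thesis using False by auto
      qed
      show ?thesis
        using expectation_increment_product[OF V[OF k'] c(5)[of i] c(2)[of i] c(5)[of j] c(2)[of j], of "\<lambda>_. 1" 1]
        unfolding D_def len by (simp add: prob_space)
    qed
    \<comment> \<open>The product of two increments as a functional of a whole path, so that
      independence of the path-valued variables can be pushed forward.\<close>
    define \<Phi> where "\<Phi> i j w = (w (c (Suc i)) - w (c i)) * (w (c (Suc j)) - w (c j))" for i j and w :: "real \<Rightarrow> real"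
    have ivar: "indep_vars (\<lambda>_. borel) (\<lambda>k' \<omega>. D k' i \<omega> * D k' j \<omega>) {k, l}" for i j
    proof -
      have "indep_vars (\<lambda>_. borel) (\<lambda>k' \<omega>. \<Phi> i j (\<lambda>t\<in>{0..}. V k' t \<omega>)) {k, l}"
      proof (rule indep_vars_compose2[where M'="\<lambda>_. Pi\<^sub>M {0..} (\<lambda>_. borel)" and Y="\<lambda>_. \<Phi> i j"
            and X="\<lambda>k \<omega>. \<lambda>t\<in>{0..}. V k t \<omega>"])
        show "indep_vars (\<lambda>_. Pi\<^sub>M {0..} (\<lambda>_. borel)) (\<lambda>k \<omega>. \<lambda>t\<in>{0..}. V k t \<omega>) {k, l}"
          by (rule indep_vars_subset[where I=I]) (use ind kl in \<open>auto simp: independent_processes_def\<close>)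
        show "\<Phi> i j \<in> borel_measurable (Pi\<^sub>M {0..} (\<lambda>_. borel))"
          unfolding \<Phi>_def[abs_def] using c(5)
          by (intro borel_measurable_times borel_measurable_diff measurable_component_singleton) auto
      qed
      then show ?thesis using c(5) by (simp add: \<Phi>_def D_def)
    qed
    \<comment> \<open>Regrouped by process, the two factors are independent, and each has mean
      \<open>q\<close> on the diagonal and 0 off it.\<close>
    have quad: "integrable M (\<lambda>\<omega>. (D k i \<omega> * D k j \<omega>) * (D l i \<omega> * D l j \<omega>))
      \<and> expectation (\<lambda>\<omega>. (D k i \<omega> * D k j \<omega>) * (D l i \<omega> * D l j \<omega>)) = (if i = j then q\<^sup>2 else 0)" for i j
    proof -
      have "integrable M (\<lambda>\<omega>. D k' i \<omega> * D k' j \<omega>)" if "k' \<in> {k, l}" for k'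
        using prod that kl by blast
      then show ?thesis
        using indep_vars_integrable[OF _ ivar[of i j]] indep_vars_lebesgue_integral[OF _ ivar[of i j]]
          prod[OF kl(1), of i j] prod[OF kl(2), of i j] kl(3) by (simp add: power2_eq_square)
    qed
    have S2: "(S \<omega>)\<^sup>2 = (\<Sum>i<N. \<Sum>j<N. (D k i \<omega> * D k j \<omega>) * (D l i \<omega> * D l j \<omega>))" for \<omega>
      unfolding S_def power2_eq_square sum_product by (intro sum.cong refl) (simp add: mult_ac)
    have iS2: "integrable M (\<lambda>\<omega>. (S \<omega>)\<^sup>2)"
      unfolding S2 using quad by (intro Bochner_Integration.integrable_sum) auto
    have "expectation (\<lambda>\<omega>. (S \<omega>)\<^sup>2) = (\<Sum>i<N. \<Sum>j<N. if i = j then q\<^sup>2 else 0)"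
      unfolding S2 using quad
      by (subst Bochner_Integration.integral_sum; (intro Bochner_Integration.integrable_sum)?; simp)+
    also have "\<dots> = N * q\<^sup>2" by simp
    also have "\<dots> = (u - t)\<^sup>2 / N" using that by (simp add: q_def power2_eq_square field_simps)
    finally have ES2: "expectation (\<lambda>\<omega>. (S \<omega>)\<^sup>2) = (u - t)\<^sup>2 / N" .
    have pt: "\<bar>Z \<omega> * S \<omega>\<bar> \<le> K * (\<theta> + (S \<omega>)\<^sup>2 / \<theta>)" if "\<omega> \<in> space M" for \<omega>
    proof -
      have "\<bar>S \<omega>\<bar> * \<theta> \<le> \<theta> * \<theta> + (S \<omega>)\<^sup>2"
        using sum_squares_bound[of "\<bar>S \<omega>\<bar>" \<theta>] \<open>\<theta> > 0\<close> mult_nonneg_nonneg[of "\<bar>S \<omega>\<bar>" \<theta>]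
        unfolding power2_abs power2_eq_square by linarith
      then have "\<bar>S \<omega>\<bar> \<le> \<theta> + (S \<omega>)\<^sup>2 / \<theta>" using \<open>\<theta> > 0\<close> by (simp add: field_simps)
      then show ?thesis using Z(2)[OF that] K unfolding abs_mult by (intro mult_mono) auto
    qed
    have iZS: "integrable M (\<lambda>\<omega>. Z \<omega> * S \<omega>)"
      unfolding S_def sum_distrib_left using DI by (intro Bochner_Integration.integrable_sum) auto
    have iB: "integrable M (\<lambda>\<omega>. K * (\<theta> + (S \<omega>)\<^sup>2 / \<theta>))" using iS2 by simp
    have "\<bar>x\<bar> \<le> expectation (\<lambda>\<omega>. \<bar>Z \<omega> * S \<omega>\<bar>)"
      unfolding x by (rule integral_abs_bound)
    also have "\<dots> \<le> expectation (\<lambda>\<omega>. K * (\<theta> + (S \<omega>)\<^sup>2 / \<theta>))"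
      using iZS iB pt by (intro integral_mono) auto
    also have "\<dots> = K * (\<theta> + (u - t)\<^sup>2 / (N * \<theta>))"
      using iS2 ES2 by (simp add: prob_space)
    finally show ?thesis .
  qed
  have "\<bar>x\<bar> \<le> 0"
  proof (rule field_le_epsilon)
    fix e :: real assume e: "e > 0"
    \<comment> \<open>\<open>\<theta>\<close> settles the first summand of \<open>bound\<close>;
      then \<open>N\<close> is taken so large that the second is at most \<open>\<theta>\<close> as
      well. The 1 in \<open>K + 1\<close> guards against \<open>K = 0\<close>.\<close>
    define \<theta> where "\<theta> = e / (2 * (K + 1))"
    have \<theta>: "\<theta> > 0" "K * (2 * \<theta>) \<le> e" using e K by (auto simp: \<theta>_def field_simps)
    obtain N :: nat where N: "real N > (u - t)\<^sup>2 / \<theta>\<^sup>2" using reals_Archimedean2 by blast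
    moreover have "0 \<le> (u - t)\<^sup>2 / \<theta>\<^sup>2" by simp
    ultimately have N0: "N > 0" by linarith
    have "(u - t)\<^sup>2 / (N * \<theta>) \<le> \<theta>"
      using N N0 \<theta> by (simp add: field_simps power2_eq_square)
    then have "K * (\<theta> + (u - t)\<^sup>2 / (N * \<theta>)) \<le> K * (2 * \<theta>)" using K by (intro mult_left_mono) auto
    then show "\<bar>x\<bar> \<le> 0 + e" using bound[OF \<theta>(1) N0] \<theta>(2) by linarith
  qed
  then show "expectation (\<lambda>\<omega>. Z \<omega> * ((V k u \<omega> - V k t \<omega>) * (V l u \<omega> - V l t \<omega>))) = 0"
    by (simp add: x_def)
qed

section \<open>Increments of Ito integrals: isometry and orthogonality to the past\<close>

lemma simple_data_nodes:
  assumes "simple_data M F n p \<xi>" "i \<le> n"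
  shows "0 \<le> p i"
  using assms(2)
proof (induction i)
  case 0
  then show ?case using assms by (simp add: simple_data_def)
next
  case (Suc i)
  then show ?case using assms(1) order_trans[of 0 "p i" "p (Suc i)"] by (auto simp: simple_data_def)
qed

lemma simple_data_bounded:
  assumes "simple_data M F n p \<xi>"
  obtains K where "\<And>i \<omega>. i < n \<Longrightarrow> \<omega> \<in> space M \<Longrightarrow> norm (\<xi> i \<omega>) \<le> K"
proof -
  have "bounded (\<Union>i\<in>{..<n}. \<xi> i ` space M)"
    using assms by (intro bounded_UN) (auto simp: simple_data_def)
  then show ?thesis using that unfolding bounded_iff by blast
qed

lemma measurable_simple_process_compose:
  fixes \<xi> :: "nat \<Rightarrow> 'w \<Rightarrow> 'v :: euclidean_space"
  assumes S: "simple_data M F n p \<xi>" and fg: "f \<in> borel_measurable N" "g \<in> measurable N M"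
  shows "(\<lambda>x. simple_process n p \<xi> (f x) (g x)) \<in> borel_measurable N"
  unfolding simple_process_def
proof (intro borel_measurable_sum borel_measurable_scaleR)
  fix i assume i: "i \<in> {..<n}"
  show "(\<lambda>x. indicator {p i<..p (Suc i)} (f x) :: real) \<in> borel_measurable N"
    using fg(1) by measurable
  have "\<xi> i \<in> borel_measurable M"
    using i S simple_data_nodes[OF S, of i] by (intro measurable_F_M[of "p i"]) (auto simp: simple_data_def)
  then show "(\<lambda>x. \<xi> i (g x)) \<in> borel_measurable N" using fg(2) by measurable
qed

text \<open>For each node \<open>x\<close>, \<open>V (min u x) - V (min t x)\<close> is the value at
  the node moved into \<open>[t, u]\<close> minus \<open>V t\<close>, and \<open>V t\<close> cancels
  between neighbouring nodes.\<close>

lemma simple_ito_increment: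
  fixes V :: "real \<Rightarrow> 'w \<Rightarrow> real"
  assumes "t \<le> u"
  shows "simple_ito V n p \<xi> u \<omega> - simple_ito V n p \<xi> t \<omega>
    = (\<Sum>i<n. (V (max t (min u (p (Suc i)))) \<omega> - V (max t (min u (p i))) \<omega>) *\<^sub>R \<xi> i \<omega>)"
proof -
  have *: "V (min u x) \<omega> - V (min t x) \<omega> = V (max t (min u x)) \<omega> - V t \<omega>" for x
    using assms by (auto simp: min_def max_def)
  show ?thesis
    unfolding simple_ito_def sum_subtractf[symmetric] scaleR_diff_left[symmetric]
    by (intro sum.cong refl arg_cong2[where f=scaleR]) (use * in \<open>smt (verit)\<close>)
qed

text \<open>The isometry applies to the difference as a whole: the event \<open>A\<close> is
  absorbed into the heights, whose intervals start no earlier than \<open>t\<close>, when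
  \<open>A\<close> is already decided.\<close>

lemma simple_ito_increment_estimate:
  fixes \<eta> :: "'w \<Rightarrow> 'v :: euclidean_space"
  assumes V: "wiener_process M F V" and S: "simple_data M F n p \<xi>" and tu: "0 \<le> t" "t \<le> u"
    and A: "A \<in> sets (F t)"
    and \<eta>: "\<eta> \<in> borel_measurable (F t)" "\<And>\<omega>. \<omega> \<in> space M \<Longrightarrow> norm (\<eta> \<omega>) \<le> K"
  shows "(\<integral>\<^sup>+\<omega>. ennreal ((norm (indicator A \<omega> *\<^sub>R (simple_ito V n p \<xi> u \<omega> - simple_ito V n p \<xi> t \<omega>
            - (V u \<omega> - V t \<omega>) *\<^sub>R \<eta> \<omega>)))\<^sup>2) \<partial>M)
    = (\<integral>\<^sup>+\<omega>. (\<integral>\<^sup>+s. ennreal ((norm (indicator {t<..u} s *\<^sub>R indicator A \<omega> *\<^sub>R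
            (simple_process n p \<xi> s \<omega> - \<eta> \<omega>)))\<^sup>2) \<partial>lborel) \<partial>M)"
proof -
  obtain L where L: "\<And>i \<omega>. i < n \<Longrightarrow> \<omega> \<in> space M \<Longrightarrow> norm (\<xi> i \<omega>) \<le> L"
    using simple_data_bounded[OF S] by blast
  \<comment> \<open>The nodes are clamped to \<open>[t, u]\<close>; the subtracted \<open>\<eta>\<close> is one more, overlapping step on \<open>(t, u]\<close>.\<close>
  define cl where "cl x = max t (min u x)" for x
  define a where "a i = (if i < n then cl (p i) else t)" for i
  define b where "b i = (if i < n then cl (p (Suc i)) else u)" for i
  \<comment> \<open>A step starting at or after \<open>u\<close> has an empty clamped interval. Its
    height is set to 0 because \<open>\<xi> i\<close> need not be known at the clamped node, which
    then lies before \<open>p i\<close> or at it.\<close>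
  define \<zeta> where "\<zeta> i \<omega> = (if i < n then (if p i < u then indicator A \<omega> *\<^sub>R \<xi> i \<omega> else 0)
      else - (indicator A \<omega> *\<^sub>R \<eta> \<omega>))" for i \<omega>
  have A': "(indicator A :: 'w \<Rightarrow> real) \<in> borel_measurable (F s)" if "t \<le> s" for s
    using measurable_F_mono[OF tu(1) that, of "indicator A :: 'w \<Rightarrow> real" borel] A by simp
  have ito: "(\<Sum>i\<in>{..n}. (V (b i) \<omega> - V (a i) \<omega>) *\<^sub>R \<zeta> i \<omega>)
     = indicator A \<omega> *\<^sub>R (simple_ito V n p \<xi> u \<omega> - simple_ito V n p \<xi> t \<omega> - (V u \<omega> - V t \<omega>) *\<^sub>R \<eta> \<omega>)" for \<omega>
  proof -
    have "(\<Sum>i<n. (V (b i) \<omega> - V (a i) \<omega>) *\<^sub>R \<zeta> i \<omega>)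
        = indicator A \<omega> *\<^sub>R (simple_ito V n p \<xi> u \<omega> - simple_ito V n p \<xi> t \<omega>)"
      unfolding simple_ito_increment[OF tu(2)] scaleR_sum_right
    proof (rule sum.cong)
      fix i assume i: "i \<in> {..<n}"
      have "p i \<le> p (Suc i)" using S i by (simp add: simple_data_def)
      then show "(V (b i) \<omega> - V (a i) \<omega>) *\<^sub>R \<zeta> i \<omega>
        = indicator A \<omega> *\<^sub>R (V (max t (min u (p (Suc i)))) \<omega> - V (max t (min u (p i))) \<omega>) *\<^sub>R \<xi> i \<omega>"
        using i tu by (auto simp: a_def b_def \<zeta>_def cl_def mult.commute min_def)
    qed simp
    then show ?thesis
      by (simp add: lessThan_Suc_atMost[symmetric] a_def b_def \<zeta>_def scaleR_diff_right mult.commute)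
  qed
  have proc: "(\<Sum>i\<in>{..n}. indicator {a i<..b i} s *\<^sub>R \<zeta> i \<omega>)
     = indicator {t<..u} s *\<^sub>R indicator A \<omega> *\<^sub>R (simple_process n p \<xi> s \<omega> - \<eta> \<omega>)" for \<omega> s
  proof -
    have "(\<Sum>i<n. indicator {a i<..b i} s *\<^sub>R \<zeta> i \<omega>)
        = indicator {t<..u} s *\<^sub>R indicator A \<omega> *\<^sub>R simple_process n p \<xi> s \<omega>"
      unfolding simple_process_def scaleR_sum_right
    proof (rule sum.cong)
      fix i assume i: "i \<in> {..<n}"
      have "indicator {a i<..b i} s = (indicator {t<..u} s * indicator {p i<..p (Suc i)} s :: real)"
        using i indicator_clamped_interval[OF tu(2)] by (simp add: a_def b_def cl_def)
      moreover have "indicator {t<..u} s * indicator {p i<..p (Suc i)} s = (0 :: real)" if "\<not> p i < u"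
        using that by (auto simp: indicator_def)
      ultimately show "indicator {a i<..b i} s *\<^sub>R \<zeta> i \<omega>
        = indicator {t<..u} s *\<^sub>R indicator A \<omega> *\<^sub>R indicator {p i<..p (Suc i)} s *\<^sub>R \<xi> i \<omega>"
        using i by (auto simp: \<zeta>_def mult_ac)
    qed simp
    then show ?thesis
      by (simp add: lessThan_Suc_atMost[symmetric] a_def b_def \<zeta>_def scaleR_diff_right)
  qed
  have "(\<integral>\<^sup>+\<omega>. ennreal ((norm (\<Sum>i\<in>{..n}. (V (b i) \<omega> - V (a i) \<omega>) *\<^sub>R \<zeta> i \<omega>))\<^sup>2) \<partial>M)
    = (\<integral>\<^sup>+\<omega>. (\<integral>\<^sup>+s. ennreal ((norm (\<Sum>i\<in>{..n}. indicator {a i<..b i} s *\<^sub>R \<zeta> i \<omega>))\<^sup>2) \<partial>lborel) \<partial>M)"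
  proof (rule simple_isometry[OF V])
    show "0 \<le> a i \<and> a i \<le> b i" if "i \<in> {..n}" for i
      using S tu that by (auto simp: a_def b_def cl_def simple_data_def intro!: max.mono min.mono)
    show "\<zeta> i \<in> borel_measurable (F (a i))" if "i \<in> {..n}" for i
    proof (cases "i < n \<and> p i < u")
      case True
      then have "\<xi> i \<in> borel_measurable (F (a i))"
        using S simple_data_nodes[OF S, of i]
        by (intro measurable_F_mono[of "p i" "a i"]) (auto simp: simple_data_def a_def cl_def)
      then show ?thesis using True A'[of "a i"] by (simp add: \<zeta>_def[abs_def] a_def cl_def)
    next
      case False
      then show ?thesis using \<eta>(1) A'[of t] by (cases "i < n") (auto simp: \<zeta>_def[abs_def] a_def)
    qed
    show "norm (\<zeta> i \<omega>) \<le> max L K" if "i \<in> {..n}" "\<omega> \<in> space M" for i \<omega>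
    proof -
      have "0 \<le> K" using \<eta>(2)[OF that(2)] norm_ge_zero order_trans by blast
      then show ?thesis
        using L[OF _ that(2), of i] \<eta>(2)[OF that(2)] by (auto simp: \<zeta>_def indicator_def max_def)
    qed
  qed simp
  then show ?thesis by (simp only: ito proc)
qed

lemma simple_ito_square_integrable:
  fixes \<xi> :: "nat \<Rightarrow> 'w \<Rightarrow> 'v :: euclidean_space"
  assumes V: "wiener_process M F V" and S: "simple_data M F n p \<xi>" and t: "0 \<le> t"
  shows "square_integrable M (simple_ito V n p \<xi> t)"
  unfolding simple_ito_def[abs_def]
proof (rule square_integrable_sum)
  fix i assume i: "i \<in> {..<n}"
  obtain L where L: "\<And>i \<omega>. i < n \<Longrightarrow> \<omega> \<in> space M \<Longrightarrow> norm (\<xi> i \<omega>) \<le> L"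
    using simple_data_bounded[OF S] by blast
  have p: "0 \<le> p i" "p i \<le> p (Suc i)" using i S simple_data_nodes[OF S, of i] by (auto simp: simple_data_def)
  show "square_integrable M (\<lambda>\<omega>. (V (min t (p (Suc i))) \<omega> - V (min t (p i)) \<omega>) *\<^sub>R \<xi> i \<omega>)"
  proof (rule square_integrable_bounded_scaleR)
    show "\<xi> i \<in> borel_measurable M"
      using i S by (intro measurable_F_M[OF p(1)]) (auto simp: simple_data_def)
    show "square_integrable M (\<lambda>\<omega>. V (min t (p (Suc i))) \<omega> - V (min t (p i)) \<omega>)"
      using p t by (intro wiener_increment_square_integrable[OF V]) (auto intro: min.mono)
  qed (use i L in auto)
qed simp

text \<open>In each clamped step both \<open>Z\<close> and the height are known at the left end
  point, and the increment of \<open>V\<close> has mean zero given that past. Steps beyond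
  \<open>u\<close> collapse.\<close>

lemma simple_ito_increment_orthogonal:
  fixes Z :: "'w \<Rightarrow> 'v :: euclidean_space"
  assumes V: "wiener_process M F V" and S: "simple_data M F n p \<xi>" and tu: "0 \<le> t" "t \<le> u"
    and Z: "Z \<in> borel_measurable (F t)" "\<And>\<omega>. \<omega> \<in> space M \<Longrightarrow> norm (Z \<omega>) \<le> K"
  shows "expectation (\<lambda>\<omega>. Z \<omega> \<bullet> (simple_ito V n p \<xi> u \<omega> - simple_ito V n p \<xi> t \<omega>)) = 0"
proof -
  obtain L where L: "\<And>i \<omega>. i < n \<Longrightarrow> \<omega> \<in> space M \<Longrightarrow> norm (\<xi> i \<omega>) \<le> L"
    using simple_data_bounded[OF S] by blast
  define cl where "cl x = max t (min u x)" for x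
  have "integrable M (\<lambda>\<omega>. (Z \<omega> \<bullet> \<xi> i \<omega>) * (V (cl (p (Suc i))) \<omega> - V (cl (p i)) \<omega>))
      \<and> expectation (\<lambda>\<omega>. (Z \<omega> \<bullet> \<xi> i \<omega>) * (V (cl (p (Suc i))) \<omega> - V (cl (p i)) \<omega>)) = 0" if i: "i < n" for i
  proof (cases "p i < u")
    case True
    have p: "0 \<le> p i" "p i \<le> p (Suc i)" using i S simple_data_nodes[OF S, of i] by (auto simp: simple_data_def)
    have cl: "0 \<le> cl (p i)" "cl (p i) \<le> cl (p (Suc i))" "t \<le> cl (p i)" "p i \<le> cl (p i)"
      using tu p True by (auto simp: cl_def intro!: max.mono min.mono)
    have "Z \<in> borel_measurable (F (cl (p i)))" using measurable_F_mono[OF tu(1) cl(3) Z(1)] .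
    moreover have "\<xi> i \<in> borel_measurable (F (cl (p i)))"
      using S i by (intro measurable_F_mono[OF p(1) cl(4)]) (auto simp: simple_data_def)
    ultimately have m: "(\<lambda>\<omega>. Z \<omega> \<bullet> \<xi> i \<omega>) \<in> borel_measurable (F (cl (p i)))" by simp
    have "\<bar>Z \<omega> \<bullet> \<xi> i \<omega>\<bar> \<le> K * L" if "\<omega> \<in> space M" for \<omega>
      using Cauchy_Schwarz_ineq2[of "Z \<omega>" "\<xi> i \<omega>"] Z(2)[OF that] L[OF i that]
      by (meson mult_mono norm_ge_zero order_trans)
    then have "integrable M (\<lambda>\<omega>. Z \<omega> \<bullet> \<xi> i \<omega>)"
      using integrable_bounded measurable_F_M[OF cl(1) m] by blast
    then show ?thesis using expectation_mult_increment(1,2)[OF V cl(1,2) m] by blast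
  next
    case False
    have "p i \<le> p (Suc i)" using i S by (auto simp: simple_data_def)
    then have "cl (p (Suc i)) = cl (p i)" using False tu by (auto simp: cl_def)
    then show ?thesis by simp
  qed
  then show ?thesis
    unfolding simple_ito_increment[OF tu(2)] inner_sum_right inner_scaleR_right cl_def[symmetric]
    by (subst Bochner_Integration.integral_sum) (auto simp: mult.commute)
qed

lemma ito_integral_measurable:
  assumes "ito_integral M F V H Y" "0 \<le> t"
  shows "Y t \<in> borel_measurable M"
  using assms measurable_F_M[OF assms(2)] by (auto simp: ito_integral_def adapted_def)

text \<open>Some simple integral lies at finite mean-square distance from \<open>Y t\<close>, and
  simple integrals are square integrable.\<close>

lemma ito_integral_square_integrable:
  fixes H :: "real \<Rightarrow> 'w \<Rightarrow> 'v :: euclidean_space"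
  assumes V: "wiener_process M F V" and Y: "ito_integral M F V H Y" and t: "0 \<le> t"
  shows "square_integrable M (Y t)"
proof -
  obtain n p \<xi> where S: "\<And>j. simple_data M F (n j) (p j) (\<xi> j)"
    and lim0: "\<And>T. 0 \<le> T \<Longrightarrow> (\<lambda>j. \<integral>\<^sup>+ \<omega>. (\<integral>\<^sup>+ s \<in> {0..T}. ennreal ((norm (H s \<omega> - simple_process (n j) (p j) (\<xi> j) s \<omega>))\<^sup>2) \<partial>lborel) \<partial>M) \<longlonglongrightarrow> 0"
    and lim: "\<And>T. 0 \<le> T \<Longrightarrow> (\<lambda>j. \<integral>\<^sup>+ \<omega>. ennreal ((norm (Y T \<omega> - simple_ito V (n j) (p j) (\<xi> j) T \<omega>))\<^sup>2) \<partial>M) \<longlonglongrightarrow> 0"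
    using Y unfolding ito_integral_def by blast
  have "eventually (\<lambda>j. (\<integral>\<^sup>+ \<omega>. ennreal ((norm (Y t \<omega> - simple_ito V (n j) (p j) (\<xi> j) t \<omega>))\<^sup>2) \<partial>M) < 1) sequentially"
    using order_tendstoD(2)[OF lim[OF t], of 1] by simp
  then obtain j where "(\<integral>\<^sup>+ \<omega>. ennreal ((norm (Y t \<omega> - simple_ito V (n j) (p j) (\<xi> j) t \<omega>))\<^sup>2) \<partial>M) < 1"
    by (auto simp: eventually_sequentially)
  then have "(\<integral>\<^sup>+ \<omega>. ennreal ((norm (Y t \<omega> - simple_ito V (n j) (p j) (\<xi> j) t \<omega>))\<^sup>2) \<partial>M) < \<infinity>"
    by (rule order.strict_trans) simp
  moreover note sq = simple_ito_square_integrable[OF V S t, of j]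
  moreover have "(\<lambda>\<omega>. Y t \<omega> - simple_ito V (n j) (p j) (\<xi> j) t \<omega>) \<in> borel_measurable M"
    using ito_integral_measurable[OF Y t] sq by (auto simp: square_integrable_def)
  ultimately have "square_integrable M (\<lambda>\<omega>. Y t \<omega> - simple_ito V (n j) (p j) (\<xi> j) t \<omega>)"
    by (intro nn_integral_square_norm_finite_imp)
  from square_integrable_add[OF this sq] show ?thesis by simp
qed

text \<open>Limit of the exact identity for simple integrands. The factor 6 is 3 times 2, from two
  triangle inequalities for squares: three terms for the approximations at \<open>u\<close> and at
  \<open>t\<close> and the simple increment, two for passing from the simple process to
  \<open>H\<close>.\<close>

lemma ito_integral_increment_estimate:
  fixes \<eta> :: "'w \<Rightarrow> 'v :: euclidean_space"
  assumes V: "wiener_process M F V" and Y: "ito_integral M F V H Y" and tu: "0 \<le> t" "t \<le> u"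
    and A: "A \<in> sets (F t)"
    and \<eta>: "\<eta> \<in> borel_measurable (F t)" "\<And>\<omega>. \<omega> \<in> space M \<Longrightarrow> norm (\<eta> \<omega>) \<le> K"
  shows "(\<integral>\<^sup>+\<omega>. ennreal ((norm (indicator A \<omega> *\<^sub>R (Y u \<omega> - Y t \<omega> - (V u \<omega> - V t \<omega>) *\<^sub>R \<eta> \<omega>)))\<^sup>2) \<partial>M)
    \<le> 6 * (\<integral>\<^sup>+\<omega>. indicator A \<omega> * (\<integral>\<^sup>+s\<in>{t..u}. ennreal ((norm (H s \<omega> - \<eta> \<omega>))\<^sup>2) \<partial>lborel) \<partial>M)"
proof -
  obtain n p \<xi> where S: "\<And>j. simple_data M F (n j) (p j) (\<xi> j)"
    and lim0: "\<And>T. 0 \<le> T \<Longrightarrow> (\<lambda>j. \<integral>\<^sup>+ \<omega>. (\<integral>\<^sup>+ s \<in> {0..T}. ennreal ((norm (H s \<omega> - simple_process (n j) (p j) (\<xi> j) s \<omega>))\<^sup>2) \<partial>lborel) \<partial>M) \<longlonglongrightarrow> 0"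
    and lim: "\<And>T. 0 \<le> T \<Longrightarrow> (\<lambda>j. \<integral>\<^sup>+ \<omega>. ennreal ((norm (Y T \<omega> - simple_ito V (n j) (p j) (\<xi> j) T \<omega>))\<^sup>2) \<partial>M) \<longlonglongrightarrow> 0"
    using Y unfolding ito_integral_def by blast
  have u0: "0 \<le> u" using tu by simp
  have mH: "measurable_process M H" using Y by (simp add: ito_integral_def)
  note Hm[measurable (raw)] = measurable_process_compose[OF mH]
  note Ym[measurable] = ito_integral_measurable[OF Y tu(1)] ito_integral_measurable[OF Y u0]
  note Vm[measurable] = wiener_measurable[OF V tu(1)] wiener_measurable[OF V u0]
  note \<eta>m[measurable] = measurable_F_M[OF tu(1) \<eta>(1)]
  have A_M[measurable]: "A \<in> sets M" using A subalgebra_F[OF tu(1)] by (auto simp: subalgebra_def)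
  \<comment> \<open>Makes the integrand jointly measurable on the whole time line; on the interval
    of integration nothing changes.\<close>
  have H_eq: "ennreal ((norm (H s \<omega> - y))\<^sup>2) * indicator {r..u} s
      = ennreal ((norm (H (max 0 s) \<omega> - y))\<^sup>2) * indicator {r..u} s" if "0 \<le> r" for r s \<omega> y
    using that by (auto simp: indicator_def max_def)
  define R where "R = (\<integral>\<^sup>+\<omega>. indicator A \<omega> * (\<integral>\<^sup>+s\<in>{t..u}. ennreal ((norm (H s \<omega> - \<eta> \<omega>))\<^sup>2) \<partial>lborel) \<partial>M)"
  define e0 where "e0 j = (\<integral>\<^sup>+ \<omega>. (\<integral>\<^sup>+ s \<in> {0..u}. ennreal ((norm (H s \<omega> - simple_process (n j) (p j) (\<xi> j) s \<omega>))\<^sup>2) \<partial>lborel) \<partial>M)" for j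
  define e1 where "e1 j = (\<integral>\<^sup>+ \<omega>. ennreal ((norm (Y t \<omega> - simple_ito V (n j) (p j) (\<xi> j) t \<omega>))\<^sup>2) \<partial>M)" for j
  define e2 where "e2 j = (\<integral>\<^sup>+ \<omega>. ennreal ((norm (Y u \<omega> - simple_ito V (n j) (p j) (\<xi> j) u \<omega>))\<^sup>2) \<partial>M)" for j
  let ?L = "\<integral>\<^sup>+\<omega>. ennreal ((norm (indicator A \<omega> *\<^sub>R (Y u \<omega> - Y t \<omega> - (V u \<omega> - V t \<omega>) *\<^sub>R \<eta> \<omega>)))\<^sup>2) \<partial>M"
  have bound: "?L \<le> 3 * e2 j + 3 * e1 j + 3 * (2 * e0 j + 2 * R)" for j
  proof -
    define Q where "Q \<omega> = simple_ito V (n j) (p j) (\<xi> j) u \<omega> - simple_ito V (n j) (p j) (\<xi> j) t \<omega>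
        - (V u \<omega> - V t \<omega>) *\<^sub>R \<eta> \<omega>" for \<omega>
    have Sm[measurable]: "simple_ito V (n j) (p j) (\<xi> j) t \<in> borel_measurable M"
      "simple_ito V (n j) (p j) (\<xi> j) u \<in> borel_measurable M"
      using simple_ito_square_integrable[OF V S tu(1), of j] simple_ito_square_integrable[OF V S u0, of j]
      by (auto simp: square_integrable_def)
    note [measurable (raw)] = measurable_simple_process_compose[OF S[of j]]
    have Q: "(\<integral>\<^sup>+\<omega>. ennreal ((norm (indicator A \<omega> *\<^sub>R Q \<omega>))\<^sup>2) \<partial>M) \<le> 2 * e0 j + 2 * R"
    proof -
      have pt: "ennreal ((norm (indicator {t<..u} s *\<^sub>R indicator A \<omega> *\<^sub>R (simple_process (n j) (p j) (\<xi> j) s \<omega> - \<eta> \<omega>)))\<^sup>2)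
        \<le> 2 * (ennreal ((norm (H s \<omega> - simple_process (n j) (p j) (\<xi> j) s \<omega>))\<^sup>2) * indicator {0..u} s)
          + 2 * (indicator A \<omega> * (ennreal ((norm (H s \<omega> - \<eta> \<omega>))\<^sup>2) * indicator {t..u} s))" for s \<omega>
      proof (cases "s \<in> {t<..u} \<and> \<omega> \<in> A")
        case True
        have "(norm (simple_process (n j) (p j) (\<xi> j) s \<omega> - \<eta> \<omega>))\<^sup>2
          \<le> 2 * (norm (H s \<omega> - simple_process (n j) (p j) (\<xi> j) s \<omega>))\<^sup>2 + 2 * (norm (H s \<omega> - \<eta> \<omega>))\<^sup>2"
          using norm_add_square_le[of "simple_process (n j) (p j) (\<xi> j) s \<omega> - H s \<omega>" "H s \<omega> - \<eta> \<omega>"]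
          by (simp add: norm_minus_commute)
        then have "ennreal ((norm (simple_process (n j) (p j) (\<xi> j) s \<omega> - \<eta> \<omega>))\<^sup>2)
          \<le> ennreal (2 * (norm (H s \<omega> - simple_process (n j) (p j) (\<xi> j) s \<omega>))\<^sup>2 + 2 * (norm (H s \<omega> - \<eta> \<omega>))\<^sup>2)"
          by (rule ennreal_leI)
        then show ?thesis using True tu by (simp add: ennreal_mult)
      qed (auto simp: indicator_def)
      have "(\<integral>\<^sup>+\<omega>. ennreal ((norm (indicator A \<omega> *\<^sub>R Q \<omega>))\<^sup>2) \<partial>M)
        = (\<integral>\<^sup>+\<omega>. (\<integral>\<^sup>+s. ennreal ((norm (indicator {t<..u} s *\<^sub>R indicator A \<omega> *\<^sub>R
            (simple_process (n j) (p j) (\<xi> j) s \<omega> - \<eta> \<omega>)))\<^sup>2) \<partial>lborel) \<partial>M)"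
        unfolding Q_def by (rule simple_ito_increment_estimate[OF V S tu A \<eta>])
      also have "\<dots> \<le> (\<integral>\<^sup>+\<omega>. (\<integral>\<^sup>+s. 2 * (ennreal ((norm (H s \<omega> - simple_process (n j) (p j) (\<xi> j) s \<omega>))\<^sup>2) * indicator {0..u} s)
          + 2 * (indicator A \<omega> * (ennreal ((norm (H s \<omega> - \<eta> \<omega>))\<^sup>2) * indicator {t..u} s)) \<partial>lborel) \<partial>M)"
        by (intro nn_integral_mono pt)
      also have "\<dots> = (\<integral>\<^sup>+\<omega>. 2 * (\<integral>\<^sup>+s\<in>{0..u}. ennreal ((norm (H s \<omega> - simple_process (n j) (p j) (\<xi> j) s \<omega>))\<^sup>2) \<partial>lborel)
          + 2 * (indicator A \<omega> * (\<integral>\<^sup>+s\<in>{t..u}. ennreal ((norm (H s \<omega> - \<eta> \<omega>))\<^sup>2) \<partial>lborel)) \<partial>M)"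
        unfolding H_eq[OF order_refl] H_eq[OF tu(1)]
        by (intro nn_integral_cong) (simp add: nn_integral_add nn_integral_cmult)
      also have "\<dots> = 2 * e0 j + 2 * R"
        unfolding e0_def R_def H_eq[OF order_refl] H_eq[OF tu(1)]
        by (subst nn_integral_add) (measurable, simp add: nn_integral_cmult)
      finally show ?thesis .
    qed
    have "?L \<le> (\<integral>\<^sup>+\<omega>. 3 * ennreal ((norm (Y u \<omega> - simple_ito V (n j) (p j) (\<xi> j) u \<omega>))\<^sup>2)
        + 3 * ennreal ((norm (Y t \<omega> - simple_ito V (n j) (p j) (\<xi> j) t \<omega>))\<^sup>2)
        + 3 * ennreal ((norm (indicator A \<omega> *\<^sub>R Q \<omega>))\<^sup>2) \<partial>M)"
    proof (rule nn_integral_mono)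
      fix \<omega>
      have "(norm (indicator A \<omega> *\<^sub>R (Y u \<omega> - Y t \<omega> - (V u \<omega> - V t \<omega>) *\<^sub>R \<eta> \<omega>)))\<^sup>2
        \<le> 3 * (norm (Y u \<omega> - simple_ito V (n j) (p j) (\<xi> j) u \<omega>))\<^sup>2
          + 3 * (norm (Y t \<omega> - simple_ito V (n j) (p j) (\<xi> j) t \<omega>))\<^sup>2
          + 3 * (norm (indicator A \<omega> *\<^sub>R Q \<omega>))\<^sup>2"
        using norm_add3_square_le[of "Y u \<omega> - simple_ito V (n j) (p j) (\<xi> j) u \<omega>"
            "- (Y t \<omega> - simple_ito V (n j) (p j) (\<xi> j) t \<omega>)" "Q \<omega>"]
        by (cases "\<omega> \<in> A") (simp_all add: Q_def norm_minus_commute algebra_simps)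
      from ennreal_leI[OF this]
      show "ennreal ((norm (indicator A \<omega> *\<^sub>R (Y u \<omega> - Y t \<omega> - (V u \<omega> - V t \<omega>) *\<^sub>R \<eta> \<omega>)))\<^sup>2)
        \<le> 3 * ennreal ((norm (Y u \<omega> - simple_ito V (n j) (p j) (\<xi> j) u \<omega>))\<^sup>2)
        + 3 * ennreal ((norm (Y t \<omega> - simple_ito V (n j) (p j) (\<xi> j) t \<omega>))\<^sup>2)
        + 3 * ennreal ((norm (indicator A \<omega> *\<^sub>R Q \<omega>))\<^sup>2)"
        by (simp add: ennreal_mult)
    qed
    also have "\<dots> = 3 * e2 j + 3 * e1 j + 3 * (\<integral>\<^sup>+\<omega>. ennreal ((norm (indicator A \<omega> *\<^sub>R Q \<omega>))\<^sup>2) \<partial>M)"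
      unfolding e1_def e2_def Q_def by (simp add: nn_integral_add nn_integral_cmult)
    also have "\<dots> \<le> 3 * e2 j + 3 * e1 j + 3 * (2 * e0 j + 2 * R)"
      using Q by (intro add_mono mult_left_mono) auto
    finally show ?thesis .
  qed
  have "(\<lambda>j. 3 * e2 j + 3 * e1 j + 3 * (2 * e0 j + 2 * R)) \<longlonglongrightarrow> 3 * 0 + 3 * 0 + 3 * (2 * 0 + 2 * R)"
    unfolding e0_def e1_def e2_def
    by (intro tendsto_add ennreal_tendsto_cmult tendsto_const lim0[OF u0] lim[OF tu(1)] lim[OF u0]) auto
  then have "?L \<le> 3 * 0 + 3 * 0 + 3 * (2 * 0 + 2 * R)"
    by (rule tendsto_lowerbound) (use bound in auto)
  also have "\<dots> = 6 * R" by (simp add: mult.assoc[symmetric])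
  finally show ?thesis by (simp add: R_def)
qed

text \<open>Orthogonality holds for simple integrals and survives the mean-square limit because
  \<open>Z\<close> is bounded. The limit in \<open>j\<close> is taken for a fixed weight
  \<open>\<theta>\<close>, which then tends to 0.\<close>

lemma ito_integral_increment_orthogonal:
  fixes Z :: "'w \<Rightarrow> 'v :: euclidean_space"
  assumes V: "wiener_process M F V" and Y: "ito_integral M F V H Y" and tu: "0 \<le> t" "t \<le> u"
    and Z: "Z \<in> borel_measurable (F t)" "\<And>\<omega>. \<omega> \<in> space M \<Longrightarrow> norm (Z \<omega>) \<le> K"
  shows "integrable M (\<lambda>\<omega>. Z \<omega> \<bullet> (Y u \<omega> - Y t \<omega>))"
    and "expectation (\<lambda>\<omega>. Z \<omega> \<bullet> (Y u \<omega> - Y t \<omega>)) = 0"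
proof -
  obtain n p \<xi> where S: "\<And>j. simple_data M F (n j) (p j) (\<xi> j)"
    and lim0: "\<And>T. 0 \<le> T \<Longrightarrow> (\<lambda>j. \<integral>\<^sup>+ \<omega>. (\<integral>\<^sup>+ s \<in> {0..T}. ennreal ((norm (H s \<omega> - simple_process (n j) (p j) (\<xi> j) s \<omega>))\<^sup>2) \<partial>lborel) \<partial>M) \<longlonglongrightarrow> 0"
    and lim: "\<And>T. 0 \<le> T \<Longrightarrow> (\<lambda>j. \<integral>\<^sup>+ \<omega>. ennreal ((norm (Y T \<omega> - simple_ito V (n j) (p j) (\<xi> j) T \<omega>))\<^sup>2) \<partial>M) \<longlonglongrightarrow> 0"
    using Y unfolding ito_integral_def by blast
  have u0: "0 \<le> u" using tu by simp
  note ZM = measurable_F_M[OF tu(1) Z(1)]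
  have sqZ: "square_integrable M Z" using square_integrable_bounded[OF ZM Z(2)] .
  note sqY = ito_integral_square_integrable[OF V Y]
  show "integrable M (\<lambda>\<omega>. Z \<omega> \<bullet> (Y u \<omega> - Y t \<omega>))"
    using square_integrable_inner[OF sqZ square_integrable_diff[OF sqY[OF u0] sqY[OF tu(1)]]] .
  define x where "x = expectation (\<lambda>\<omega>. Z \<omega> \<bullet> (Y u \<omega> - Y t \<omega>))"
  obtain \<omega>0 where "\<omega>0 \<in> space M" using not_empty by blast
  then have K: "0 \<le> K" using Z(2)[of \<omega>0] norm_ge_zero order_trans by blast
  define d where "d r j \<omega> = Y r \<omega> - simple_ito V (n j) (p j) (\<xi> j) r \<omega>" for r j \<omega>
  have sqd: "square_integrable M (d r j)" if "0 \<le> r" for r j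
    unfolding d_def[abs_def]
    by (intro square_integrable_diff sqY simple_ito_square_integrable[OF V S] that)
  have nnd: "(\<integral>\<^sup>+ \<omega>. ennreal ((norm (d r j \<omega>))\<^sup>2) \<partial>M) = ennreal (expectation (\<lambda>\<omega>. (norm (d r j \<omega>))\<^sup>2))" if "0 \<le> r" for r j
    using sqd[OF that, of j] by (intro nn_integral_eq_integral) (auto simp: square_integrable_def)
  have limd: "(\<lambda>j. expectation (\<lambda>\<omega>. (norm (d r j \<omega>))\<^sup>2)) \<longlonglongrightarrow> 0" if "r = t \<or> r = u" for r
  proof -
    have r0: "0 \<le> r" using that tu by auto
    have "(\<lambda>j. ennreal (expectation (\<lambda>\<omega>. (norm (d r j \<omega>))\<^sup>2))) \<longlonglongrightarrow> ennreal 0"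
      using lim[OF r0] unfolding nnd[OF r0, symmetric] by (simp add: d_def)
    then show ?thesis by (rule tendsto_ennrealD) auto
  qed
  have bound: "\<bar>x\<bar> \<le> K * (2 * \<theta> + (expectation (\<lambda>\<omega>. (norm (d u j \<omega>))\<^sup>2) + expectation (\<lambda>\<omega>. (norm (d t j \<omega>))\<^sup>2)) / \<theta>)"
    if \<theta>: "\<theta> > 0" for \<theta> j
  proof -
    have "expectation (\<lambda>\<omega>. Z \<omega> \<bullet> (d u j \<omega> - d t j \<omega>))
      = expectation (\<lambda>\<omega>. Z \<omega> \<bullet> (Y u \<omega> - Y t \<omega>) - Z \<omega> \<bullet> (simple_ito V (n j) (p j) (\<xi> j) u \<omega> - simple_ito V (n j) (p j) (\<xi> j) t \<omega>))"
      by (simp add: d_def inner_diff_right algebra_simps)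
    also have "\<dots> = x - expectation (\<lambda>\<omega>. Z \<omega> \<bullet> (simple_ito V (n j) (p j) (\<xi> j) u \<omega> - simple_ito V (n j) (p j) (\<xi> j) t \<omega>))"
      unfolding x_def
      by (intro Bochner_Integration.integral_diff square_integrable_inner[OF sqZ] square_integrable_diff sqY
          simple_ito_square_integrable[OF V S] u0 tu)
    also have "\<dots> = x" using simple_ito_increment_orthogonal[OF V S tu Z] by simp
    finally have x: "x = expectation (\<lambda>\<omega>. Z \<omega> \<bullet> (d u j \<omega> - d t j \<omega>))" by simp
    have id: "integrable M (\<lambda>\<omega>. (norm (d u j \<omega>))\<^sup>2)" "integrable M (\<lambda>\<omega>. (norm (d t j \<omega>))\<^sup>2)"
      using sqd[OF u0] sqd[OF tu(1)] by (auto simp: square_integrable_def)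
    have nle: "norm y \<le> \<theta> + (norm y)\<^sup>2 / \<theta>" for y :: 'v
    proof -
      have "norm y * \<theta> \<le> \<theta> * \<theta> + (norm y)\<^sup>2"
        using sum_squares_bound[of "norm y" \<theta>] mult_nonneg_nonneg[OF norm_ge_zero[of y] less_imp_le[OF \<theta>]]
          zero_le_square[of \<theta>] zero_le_square[of "norm y"]
        unfolding power2_eq_square by linarith
      then show ?thesis using \<theta> by (simp add: field_simps)
    qed
    have "\<bar>x\<bar> \<le> expectation (\<lambda>\<omega>. \<bar>Z \<omega> \<bullet> (d u j \<omega> - d t j \<omega>)\<bar>)"
      unfolding x by (rule integral_abs_bound)
    also have "\<dots> \<le> expectation (\<lambda>\<omega>. K * (2 * \<theta> + ((norm (d u j \<omega>))\<^sup>2 + (norm (d t j \<omega>))\<^sup>2) / \<theta>))"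
    proof (rule integral_mono)
      show "integrable M (\<lambda>\<omega>. \<bar>Z \<omega> \<bullet> (d u j \<omega> - d t j \<omega>)\<bar>)"
        by (intro integrable_abs square_integrable_inner[OF sqZ] square_integrable_diff sqd u0 tu)
      fix \<omega> assume \<omega>: "\<omega> \<in> space M"
      have "\<bar>Z \<omega> \<bullet> (d u j \<omega> - d t j \<omega>)\<bar> \<le> norm (Z \<omega>) * norm (d u j \<omega> - d t j \<omega>)" by (rule Cauchy_Schwarz_ineq2)
      also have "\<dots> \<le> K * (norm (d u j \<omega>) + norm (d t j \<omega>))"
        using Z(2)[OF \<omega>] K by (intro mult_mono norm_triangle_ineq4) auto
      also have "\<dots> \<le> K * (2 * \<theta> + ((norm (d u j \<omega>))\<^sup>2 + (norm (d t j \<omega>))\<^sup>2) / \<theta>)"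
        using nle[of "d u j \<omega>"] nle[of "d t j \<omega>"] K by (intro mult_left_mono) (auto simp: add_divide_distrib)
      finally show "\<bar>Z \<omega> \<bullet> (d u j \<omega> - d t j \<omega>)\<bar> \<le> K * (2 * \<theta> + ((norm (d u j \<omega>))\<^sup>2 + (norm (d t j \<omega>))\<^sup>2) / \<theta>)" .
    qed (use id in simp)
    also have "\<dots> = K * (2 * \<theta> + (expectation (\<lambda>\<omega>. (norm (d u j \<omega>))\<^sup>2) + expectation (\<lambda>\<omega>. (norm (d t j \<omega>))\<^sup>2)) / \<theta>)"
      using id by (simp add: prob_space)
    finally show ?thesis .
  qed
  have "\<bar>x\<bar> \<le> K * (2 * \<theta>)" if \<theta>: "\<theta> > 0" for \<theta>
  proof -
    have "(\<lambda>j. K * (2 * \<theta> + (expectation (\<lambda>\<omega>. (norm (d u j \<omega>))\<^sup>2) + expectation (\<lambda>\<omega>. (norm (d t j \<omega>))\<^sup>2)) / \<theta>))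
        \<longlonglongrightarrow> K * (2 * \<theta> + (0 + 0) / \<theta>)"
      using \<theta> by (intro tendsto_intros limd) auto
    then have "\<bar>x\<bar> \<le> K * (2 * \<theta> + (0 + 0) / \<theta>)"
      by (rule tendsto_lowerbound) (use bound[OF \<theta>] in auto)
    then show ?thesis by simp
  qed
  then have "\<bar>x\<bar> \<le> 0 + e" if "e > 0" for e
  proof -
    have "e / (2 * (K + 1)) > 0" using K that by simp
    from \<open>\<And>\<theta>. \<theta> > 0 \<Longrightarrow> \<bar>x\<bar> \<le> K * (2 * \<theta>)\<close>[OF this]
    have "\<bar>x\<bar> \<le> K / (K + 1) * e" using K by (simp add: field_simps)
    also have "\<dots> \<le> 1 * e" using K that by (intro mult_right_mono) auto
    finally show ?thesis by simp
  qed
  then have "\<bar>x\<bar> \<le> 0" by (rule field_le_epsilon)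
  then show "expectation (\<lambda>\<omega>. Z \<omega> \<bullet> (Y u \<omega> - Y t \<omega>)) = 0" by (simp add: x_def)
qed

end

subsection \<open>Mean square continuity of the solution\<close>

text \<open>Cauchy-Schwarz in time, obtained by integrating 2 \<theta> |f| <= |f|^2 + \<theta>^2
  with \<theta> the mean value of |f|. The extended nonnegative form is ready for a second
  integration over the probability space.\<close>

lemma set_integral_norm_square_le:
  fixes f :: "real \<Rightarrow> 'v :: euclidean_space"
  assumes f: "continuous_on {t..u} f" and tu: "t \<le> u"
  shows "ennreal ((norm (LINT s:{t..u}|lborel. f s))\<^sup>2) \<le> ennreal (u - t) * (\<integral>\<^sup>+s\<in>{t..u}. ennreal ((norm (f s))\<^sup>2) \<partial>lborel)"
proof (cases "t = u")
  case True
  have "(LINT s:{u..u}|lborel. f s) = 0"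
    unfolding set_lebesgue_integral_def
    by (intro integral_eq_zero_AE AE_I'[of "{u}"]) (auto simp: indicator_def)
  then show ?thesis using True by simp
next
  case False
  then have tu': "0 < u - t" using tu by simp
  have i0: "set_integrable lborel {t..u} f" "set_integrable lborel {t..u} (\<lambda>s. norm (f s))"
    "set_integrable lborel {t..u} (\<lambda>s. (norm (f s))\<^sup>2)" "set_integrable lborel {t..u} (\<lambda>s. c :: real)" for c
    using f by (auto intro!: borel_integrable_atLeastAtMost' continuous_intros)
  define I where "I = (LINT s:{t..u}|lborel. norm (f s))"
  define Q where "Q = (LINT s:{t..u}|lborel. (norm (f s))\<^sup>2)"
  define \<theta> where "\<theta> = I / (u - t)"
  have "(LINT s:{t..u}|lborel. 2 * \<theta> * norm (f s)) \<le> (LINT s:{t..u}|lborel. (norm (f s))\<^sup>2 + \<theta>\<^sup>2)"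
    using i0 sum_squares_bound[of "norm (f _)" \<theta>]
    by (intro set_integral_mono set_integral_add) (auto simp: mult_ac)
  also have "\<dots> = Q + (LINT s:{t..u}|lborel. \<theta>\<^sup>2)"
    unfolding Q_def using i0 by (intro set_integral_add) auto
  also have "(LINT s:{t..u}|lborel. \<theta>\<^sup>2) = \<theta>\<^sup>2 * (u - t)"
    using tu by (simp add: set_lebesgue_integral_def)
  finally have "2 * \<theta> * I \<le> Q + \<theta>\<^sup>2 * (u - t)" by (simp add: I_def)
  moreover have I: "I = \<theta> * (u - t)" using tu' by (simp add: \<theta>_def)
  ultimately have "\<theta> * I \<le> Q" by (simp add: power2_eq_square mult.assoc)
  then have "(u - t) * (\<theta> * I) \<le> (u - t) * Q" using tu' by (intro mult_left_mono) auto
  then have IQ: "I\<^sup>2 \<le> (u - t) * Q"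
    using I by (simp add: power2_eq_square mult_ac)
  have "norm (LINT s:{t..u}|lborel. f s) \<le> I"
    unfolding I_def by (rule set_integral_norm_bound[OF i0(1)])
  then have "(norm (LINT s:{t..u}|lborel. f s))\<^sup>2 \<le> I\<^sup>2" by (intro power_mono) auto
  then have "ennreal ((norm (LINT s:{t..u}|lborel. f s))\<^sup>2) \<le> ennreal ((u - t) * Q)"
    using IQ by (intro ennreal_leI) linarith
  also have "\<dots> = ennreal (u - t) * ennreal Q"
    using tu' by (intro ennreal_mult) (auto simp: Q_def set_lebesgue_integral_def)
  also have "ennreal Q = (\<integral>\<^sup>+s. ennreal (indicator {t..u} s *\<^sub>R (norm (f s))\<^sup>2) \<partial>lborel)"
    using i0(3) unfolding Q_def set_lebesgue_integral_def set_integrable_def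
    by (intro nn_integral_eq_integral[symmetric]) auto
  also have "\<dots> = (\<integral>\<^sup>+s\<in>{t..u}. ennreal ((norm (f s))\<^sup>2) \<partial>lborel)"
    by (intro nn_integral_cong) (auto simp: indicator_def)
  finally show ?thesis .
qed

text \<open>As in the proof of uniform continuity on a compact interval, a sequence of bad pairs
  would accumulate at one point \<open>r\<close>, where the relaxed triangle inequality contradicts
  the convergence. The factor 2 is the one a squared distance satisfies.\<close>

lemma uniform_of_pointwise_quasimetric:
  fixes g :: "real \<Rightarrow> real \<Rightarrow> real"
  assumes tri: "\<And>s t r. 0 \<le> s \<Longrightarrow> 0 \<le> t \<Longrightarrow> 0 \<le> r \<Longrightarrow> g s t \<le> 2 * g s r + 2 * g t r"
    and lim: "\<And>r s. 0 \<le> r \<Longrightarrow> (\<And>n. 0 \<le> s n) \<Longrightarrow> s \<longlonglongrightarrow> r \<Longrightarrow> (\<lambda>n. g (s n) r) \<longlonglongrightarrow> 0"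
    and e: "e > 0"
  shows "\<exists>d>0. \<forall>s\<in>{0..T}. \<forall>t\<in>{0..T}. \<bar>s - t\<bar> < d \<longrightarrow> g s t < e"
proof (rule ccontr)
  assume "\<not> ?thesis"
  then have "\<exists>s t. s \<in> {0..T} \<and> t \<in> {0..T} \<and> \<bar>s - t\<bar> < 1 / real (Suc n) \<and> e \<le> g s t" for n
    by (metis not_less of_nat_0_less_iff zero_less_Suc zero_less_divide_1_iff)
  then obtain s t where st: "\<And>n. s n \<in> {0..T}" "\<And>n. t n \<in> {0..T}"
    "\<And>n. \<bar>s n - t n\<bar> < 1 / real (Suc n)" "\<And>n. e \<le> g (s n) (t n)" by metis
  obtain r \<sigma> where r: "r \<in> {0..T}" "strict_mono \<sigma>" "(s \<circ> \<sigma>) \<longlonglongrightarrow> r"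
    using compact_Icc[of 0 T] st(1) unfolding compact_def by metis
  have "(\<lambda>n. s n - t n) \<longlonglongrightarrow> 0"
  proof (rule Lim_null_comparison)
    show "\<forall>\<^sub>F n in sequentially. norm (s n - t n) \<le> 1 / real (Suc n)"
      using st(3) by (intro always_eventually) (auto intro: less_imp_le)
    show "(\<lambda>n. 1 / real (Suc n)) \<longlonglongrightarrow> 0" by (rule LIMSEQ_Suc[OF lim_1_over_n])
  qed
  from tendsto_diff[OF r(3) LIMSEQ_subseq_LIMSEQ[OF this r(2)]]
  have t: "(t \<circ> \<sigma>) \<longlonglongrightarrow> r" by (simp add: comp_def)
  have "(\<lambda>n. 2 * g (s (\<sigma> n)) r + 2 * g (t (\<sigma> n)) r) \<longlonglongrightarrow> 2 * 0 + 2 * 0"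
    using r t st(1,2) by (intro tendsto_intros lim) (auto simp: comp_def)
  moreover have "e \<le> 2 * g (s (\<sigma> n)) r + 2 * g (t (\<sigma> n)) r" for n
    using tri[of "s (\<sigma> n)" "t (\<sigma> n)" r] st(1,2)[of "\<sigma> n"] st(4)[of "\<sigma> n"] r(1) by auto
  ultimately have "e \<le> 2 * 0 + 2 * 0"
    by (intro tendsto_lowerbound[of _ _ sequentially]) auto
  then show False using e by simp
qed

locale random_coefficient_sde = usual_filtered_prob_space M F
  for M :: "'w measure" and F :: "real \<Rightarrow> 'w measure" +
  fixes m :: nat
    and W :: "nat \<Rightarrow> real \<Rightarrow> 'w \<Rightarrow> real"
    and a :: "real \<Rightarrow> real ^ 'd \<Rightarrow> 'w \<Rightarrow> real ^ 'd"
    and b :: "nat \<Rightarrow> real \<Rightarrow> real ^ 'd \<Rightarrow> 'w \<Rightarrow> real ^ 'd"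
    and C :: real
    and X0 :: "'w \<Rightarrow> real ^ 'd"
    and X :: "real \<Rightarrow> 'w \<Rightarrow> real ^ 'd"
  assumes wiener: "\<And>k. k \<in> {1..m} \<Longrightarrow> wiener_process M F (W k)"
    and indep: "independent_processes M {1..m} W"
    and X0_meas: "X0 \<in> borel_measurable (F 0)"
    and X0_bounded: "\<exists>K. AE \<omega> in M. norm (X0 \<omega>) \<le> K"
    and a_meas: "(\<lambda>(t, x, \<omega>). a t x \<omega>)
        \<in> borel_measurable (restrict_space borel {0..} \<Otimes>\<^sub>M borel \<Otimes>\<^sub>M M)"
    and b_meas: "\<And>k. k \<in> {1..m} \<Longrightarrow> (\<lambda>(t, x, \<omega>). b k t x \<omega>)
        \<in> borel_measurable (restrict_space borel {0..} \<Otimes>\<^sub>M borel \<Otimes>\<^sub>M M)"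
    and H1_a: "\<And>t. 0 \<le> t \<Longrightarrow> (\<lambda>(x, \<omega>). a t x \<omega>) \<in> borel_measurable (borel \<Otimes>\<^sub>M F t)"
    and H1_b: "\<And>t k. 0 \<le> t \<Longrightarrow> k \<in> {1..m} \<Longrightarrow>
        (\<lambda>(x, \<omega>). b k t x \<omega>) \<in> borel_measurable (borel \<Otimes>\<^sub>M F t)"
    and H2: "AE \<omega> in M. continuous_on ({0..} \<times> UNIV) (\<lambda>(t, x). a t x \<omega>)
        \<and> (\<forall>k\<in>{1..m}. continuous_on ({0..} \<times> UNIV) (\<lambda>(t, x). b k t x \<omega>))"
    and H3: "\<And>t. 0 \<le> t \<Longrightarrow> AE \<omega> in M. norm (a t 0 \<omega>) + (\<Sum>k=1..m. norm (b k t 0 \<omega>)) \<le> C"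
    and H4: "\<And>t x y. 0 \<le> t \<Longrightarrow> AE \<omega> in M.
        norm (a t x \<omega> - a t y \<omega>) + (\<Sum>k=1..m. norm (b k t x \<omega> - b k t y \<omega>)) \<le> C * norm (x - y)"
    and X_sol: "sde_solution M F m W a b X0 X"
begin

section \<open>Almost sure regularity of the coefficients, and increments of the solution\<close>

lemma X_process: "measurable_process M X" "adapted F X" "AE \<omega> in M. continuous_on {0..} (\<lambda>t. X t \<omega>)"
  using X_sol by (auto simp: sde_solution_def)

lemma X_measurable_F: "0 \<le> t \<Longrightarrow> X t \<in> borel_measurable (F t)"
  using X_process(2) by (simp add: adapted_def)

lemma X_measurable: "0 \<le> t \<Longrightarrow> X t \<in> borel_measurable M"
  using X_measurable_F measurable_F_M by blast

lemma C_nonneg: "0 \<le> C"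
proof -
  have "AE \<omega> in M. 0 \<le> C"
    using H3[OF order_refl]
  proof eventually_elim
    case (elim \<omega>)
    then show ?case by (meson add_nonneg_nonneg norm_ge_zero order_trans sum_nonneg)
  qed
  then show ?thesis by (simp add: AE_const)
qed

text \<open>Collects what the drift and every dispersion coefficient share, so that each estimate is
  proved once. The quantifiers over time and space stand inside the almost sure statement: one null
  set serves all arguments, so random ones such as \<open>X t \<omega>\<close> may be
  inserted.\<close>

definition regular_coefficient :: "(real \<Rightarrow> real ^ 'd \<Rightarrow> 'w \<Rightarrow> real ^ 'd) \<Rightarrow> bool" where
  "regular_coefficient c \<longleftrightarrow>
    (\<lambda>(t, x, \<omega>). c t x \<omega>) \<in> borel_measurable (restrict_space borel {0..} \<Otimes>\<^sub>M borel \<Otimes>\<^sub>M M)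
    \<and> (\<forall>t\<ge>0. (\<lambda>(x, \<omega>). c t x \<omega>) \<in> borel_measurable (borel \<Otimes>\<^sub>M F t))
    \<and> (AE \<omega> in M. continuous_on ({0..} \<times> UNIV) (\<lambda>(t, x). c t x \<omega>)
        \<and> (\<forall>t\<ge>0. \<forall>x y. norm (c t x \<omega> - c t y \<omega>) \<le> C * norm (x - y))
        \<and> (\<forall>t\<ge>0. norm (c t 0 \<omega>) \<le> C))"

text \<open>In (H3) and (H4) the null set may depend on the arguments. Countably many null sets are
  discarded along a dense set of triples \<open>(t, x, y)\<close>, and the joint continuity in (H2)
  extends both inequalities to all arguments.\<close>

lemma coefficients_bound:
  "AE \<omega> in M. \<forall>t\<ge>0. (\<forall>x y. norm (a t x \<omega> - a t y \<omega>) + (\<Sum>k=1..m. norm (b k t x \<omega> - b k t y \<omega>)) \<le> C * norm (x - y))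
    \<and> norm (a t 0 \<omega>) + (\<Sum>k=1..m. norm (b k t 0 \<omega>)) \<le> C"
proof -
  define S :: "(real \<times> (real ^ 'd) \<times> (real ^ 'd)) set" where "S = {0..} \<times> UNIV"
  have S: "closed S" unfolding S_def by (intro closed_Times) auto
  obtain T where T: "countable T" "T \<subseteq> S" "S \<subseteq> closure T" using separable[of S] by blast
  have clT: "closure T = S" using T S by (simp add: closure_minimal subset_antisym)
  have 1: "AE \<omega> in M. \<forall>(t, x, y)\<in>T. norm (a t x \<omega> - a t y \<omega>) + (\<Sum>k=1..m. norm (b k t x \<omega> - b k t y \<omega>)) \<le> C * norm (x - y)"
    unfolding AE_ball_countable[OF T(1)] using T(2) H4 by (force simp: S_def)
  have 2: "AE \<omega> in M. \<forall>(t, x, y)\<in>T. norm (a t 0 \<omega>) + (\<Sum>k=1..m. norm (b k t 0 \<omega>)) \<le> C"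
    unfolding AE_ball_countable[OF T(1)] using T(2) H3 by (force simp: S_def)
  show ?thesis
    using 1 2 H2
  proof eventually_elim
    case (elim \<omega>)
    have ca: "continuous_on S (\<lambda>p. a (fst p) (f p) \<omega>)" if "continuous_on S f" for f
      using continuous_on_compose2[OF conjunct1[OF elim(3)], of S "\<lambda>p. (fst p, f p)"] that
      by (force simp: S_def intro!: continuous_intros)
    have cb: "continuous_on S (\<lambda>p. b k (fst p) (f p) \<omega>)" if "continuous_on S f" "k \<in> {1..m}" for f k
      using continuous_on_compose2[OF bspec[OF conjunct2[OF elim(3)] that(2)], of S "\<lambda>p. (fst p, f p)"] that(1)
      by (force simp: S_def intro!: continuous_intros)
    have "0 \<le> C * norm (fst (snd p) - snd (snd p)) - (norm (a (fst p) (fst (snd p)) \<omega> - a (fst p) (snd (snd p)) \<omega>)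
         + (\<Sum>k=1..m. norm (b k (fst p) (fst (snd p)) \<omega> - b k (fst p) (snd (snd p)) \<omega>)))" if "p \<in> S" for p
    proof (rule continuous_ge_on_closure[where S=T])
      show "continuous_on (closure T) (\<lambda>p. C * norm (fst (snd p) - snd (snd p)) - (norm (a (fst p) (fst (snd p)) \<omega> - a (fst p) (snd (snd p)) \<omega>)
         + (\<Sum>k=1..m. norm (b k (fst p) (fst (snd p)) \<omega> - b k (fst p) (snd (snd p)) \<omega>))))"
        unfolding clT by (intro continuous_intros ca cb) auto
    qed (use elim(1) that clT in auto)
    note A = this
    have "0 \<le> C - (norm (a (fst p) 0 \<omega>) + (\<Sum>k=1..m. norm (b k (fst p) 0 \<omega>)))" if "p \<in> S" for p
    proof (rule continuous_ge_on_closure[where S=T])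
      show "continuous_on (closure T) (\<lambda>p. C - (norm (a (fst p) 0 \<omega>) + (\<Sum>k=1..m. norm (b k (fst p) 0 \<omega>))))"
        unfolding clT by (intro continuous_intros ca cb) auto
    qed (use elim(2) that clT in auto)
    note B = this
    show ?case
    proof (intro allI impI conjI)
      fix t :: real assume t: "0 \<le> t"
      show "norm (a t x \<omega> - a t y \<omega>) + (\<Sum>k=1..m. norm (b k t x \<omega> - b k t y \<omega>)) \<le> C * norm (x - y)" for x y
        using A[of "(t, x, y)"] t by (simp add: S_def)
      show "norm (a t 0 \<omega>) + (\<Sum>k=1..m. norm (b k t 0 \<omega>)) \<le> C"
        using B[of "(t, 0, 0)"] t by (simp add: S_def)
    qed
  qed
qed

lemma regular_a: "regular_coefficient a"
  unfolding regular_coefficient_def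
proof (intro conjI)
  show "AE \<omega> in M. continuous_on ({0..} \<times> UNIV) (\<lambda>(t, x). a t x \<omega>)
        \<and> (\<forall>t\<ge>0. \<forall>x y. norm (a t x \<omega> - a t y \<omega>) \<le> C * norm (x - y))
        \<and> (\<forall>t\<ge>0. norm (a t 0 \<omega>) \<le> C)"
    using coefficients_bound H2
  proof eventually_elim
    case (elim \<omega>)
    have "0 \<le> (\<Sum>k=1..m. norm (b k t x \<omega> - b k t y \<omega>))" "0 \<le> (\<Sum>k=1..m. norm (b k t 0 \<omega>))" for t x y
      by (auto intro: sum_nonneg)
    then show ?case using elim by (smt (verit))
  qed
qed (use a_meas H1_a in auto)

lemma regular_b:
  assumes k: "k \<in> {1..m}"
  shows "regular_coefficient (b k)"
  unfolding regular_coefficient_def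
proof (intro conjI)
  show "AE \<omega> in M. continuous_on ({0..} \<times> UNIV) (\<lambda>(t, x). b k t x \<omega>)
        \<and> (\<forall>t\<ge>0. \<forall>x y. norm (b k t x \<omega> - b k t y \<omega>) \<le> C * norm (x - y))
        \<and> (\<forall>t\<ge>0. norm (b k t 0 \<omega>) \<le> C)"
    using coefficients_bound H2
  proof eventually_elim
    case (elim \<omega>)
    have le: "f k \<le> z + (\<Sum>k=1..m. f k)" if "\<And>k. 0 \<le> f k" "0 \<le> z" for f :: "nat \<Rightarrow> real" and z
      using member_le_sum[OF k, of f] that by simp
    show ?case
    proof (intro conjI allI impI)
      show "continuous_on ({0..} \<times> UNIV) (\<lambda>(t, x). b k t x \<omega>)" using elim k by blast
      fix t :: real assume t: "0 \<le> t"
      show "norm (b k t x \<omega> - b k t y \<omega>) \<le> C * norm (x - y)" for x y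
        using elim(1) t le[of "\<lambda>k. norm (b k t x \<omega> - b k t y \<omega>)" "norm (a t x \<omega> - a t y \<omega>)"]
        by (meson norm_ge_zero order_trans)
      show "norm (b k t 0 \<omega>) \<le> C"
        using elim(1) t le[of "\<lambda>k. norm (b k t 0 \<omega>)" "norm (a t 0 \<omega>)"]
        by (meson norm_ge_zero order_trans)
    qed
  qed
qed (use b_meas[OF k] H1_b[OF _ k] in auto)

lemma regular_measurable_F:
  assumes c: "regular_coefficient c" and t: "0 \<le> t" and f: "f \<in> borel_measurable (F t)"
  shows "(\<lambda>\<omega>. c t (f \<omega>) \<omega>) \<in> borel_measurable (F t)"
proof -
  have "(\<lambda>\<omega>. (f \<omega>, \<omega>)) \<in> measurable (F t) (borel \<Otimes>\<^sub>M F t)"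
    using f by measurable
  moreover have "(\<lambda>(x, \<omega>). c t x \<omega>) \<in> borel_measurable (borel \<Otimes>\<^sub>M F t)"
    using c t by (simp add: regular_coefficient_def)
  ultimately have "(\<lambda>\<omega>. (\<lambda>(x, \<omega>). c t x \<omega>) (f \<omega>, \<omega>)) \<in> borel_measurable (F t)"
    by (rule measurable_compose)
  then show ?thesis by simp
qed

lemma regular_measurable:
  assumes c: "regular_coefficient c" and t: "0 \<le> t" and f: "f \<in> borel_measurable M"
  shows "(\<lambda>\<omega>. c t (f \<omega>) \<omega>) \<in> borel_measurable M"
proof -
  have "(\<lambda>\<omega>. \<omega>) \<in> measurable M (F t)"
    using measurable_F_M[OF t, of "\<lambda>\<omega>. \<omega>" "F t"] by simp
  then have "(\<lambda>\<omega>. (f \<omega>, \<omega>)) \<in> measurable M (borel \<Otimes>\<^sub>M F t)"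
    using f by (intro measurable_Pair)
  moreover have "(\<lambda>(x, \<omega>). c t x \<omega>) \<in> borel_measurable (borel \<Otimes>\<^sub>M F t)"
    using c t by (simp add: regular_coefficient_def)
  ultimately have "(\<lambda>\<omega>. (\<lambda>(x, \<omega>). c t x \<omega>) (f \<omega>, \<omega>)) \<in> borel_measurable M"
    by (rule measurable_compose)
  then show ?thesis by simp
qed

lemma regular_process:
  assumes c: "regular_coefficient c"
  shows "measurable_process M (\<lambda>s \<omega>. c s (X s \<omega>) \<omega>)"
proof -
  have [measurable]: "(\<lambda>p. X (fst p) (snd p)) \<in> borel_measurable (restrict_space borel {0..} \<Otimes>\<^sub>M M)"
    using X_process(1) by (simp add: measurable_process_def case_prod_beta)
  have "(\<lambda>p. (fst p, X (fst p) (snd p), snd p))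
      \<in> measurable (restrict_space borel {0..} \<Otimes>\<^sub>M M) (restrict_space borel {0..} \<Otimes>\<^sub>M borel \<Otimes>\<^sub>M M)"
    by measurable
  moreover have "(\<lambda>(t, x, \<omega>). c t x \<omega>) \<in> borel_measurable (restrict_space borel {0..} \<Otimes>\<^sub>M borel \<Otimes>\<^sub>M M)"
    using c by (simp add: regular_coefficient_def)
  ultimately have "(\<lambda>p. (\<lambda>(t, x, \<omega>). c t x \<omega>) (fst p, X (fst p) (snd p), snd p))
      \<in> borel_measurable (restrict_space borel {0..} \<Otimes>\<^sub>M M)"
    by (rule measurable_compose)
  then show ?thesis by (simp add: measurable_process_def case_prod_beta)
qed

lemma regular_growth:
  assumes c: "regular_coefficient c"
  shows "AE \<omega> in M. \<forall>t\<ge>0. \<forall>x. norm (c t x \<omega>) \<le> C * (1 + norm x)"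
proof -
  have "AE \<omega> in M. (\<forall>t\<ge>0. \<forall>x y. norm (c t x \<omega> - c t y \<omega>) \<le> C * norm (x - y)) \<and> (\<forall>t\<ge>0. norm (c t 0 \<omega>) \<le> C)"
    using c by (auto simp: regular_coefficient_def elim!: eventually_mono)
  then show ?thesis
  proof eventually_elim
    case (elim \<omega>)
    show ?case
    proof (intro allI impI)
      fix t :: real and x :: "real ^ 'd" assume t: "0 \<le> t"
      have "norm (c t x \<omega> - c t 0 \<omega>) \<le> C * norm (x - 0)" "norm (c t 0 \<omega>) \<le> C" using elim t by blast+
      then show "norm (c t x \<omega>) \<le> C * (1 + norm x)"
        using norm_triangle_ineq2[of "c t x \<omega>" "c t 0 \<omega>"] by (simp add: algebra_simps)
    qed
  qed
qed

lemma regular_growth_square: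
  assumes c: "regular_coefficient c"
  shows "AE \<omega> in M. \<forall>t\<ge>0. \<forall>x. (norm (c t x \<omega>))\<^sup>2 \<le> 2 * C\<^sup>2 * (1 + (norm x)\<^sup>2)"
  using regular_growth[OF c]
proof eventually_elim
  case (elim \<omega>)
  show ?case
  proof (intro allI impI)
    fix t :: real and x :: "real ^ 'd" assume t: "0 \<le> t"
    have "(norm (c t x \<omega>))\<^sup>2 \<le> (C * (1 + norm x))\<^sup>2" using elim t by (intro power_mono) auto
    also have "\<dots> = C\<^sup>2 * (1 + norm x)\<^sup>2" by (simp add: power_mult_distrib)
    also have "\<dots> \<le> C\<^sup>2 * (2 * (1 + (norm x)\<^sup>2))"
      using sum_squares_bound[of 1 "norm x"] by (intro mult_left_mono) (auto simp: power2_sum)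
    finally show "(norm (c t x \<omega>))\<^sup>2 \<le> 2 * C\<^sup>2 * (1 + (norm x)\<^sup>2)" by (simp only: mult_ac)
  qed
qed

lemma regular_path_continuous:
  assumes c: "regular_coefficient c"
  shows "AE \<omega> in M. continuous_on {0..} (\<lambda>s. c s (X s \<omega>) \<omega>)"
proof -
  have "AE \<omega> in M. continuous_on ({0..} \<times> UNIV) (\<lambda>(t, x). c t x \<omega>)"
    using c by (auto simp: regular_coefficient_def elim!: eventually_mono)
  then show ?thesis
    using X_process(3)
  proof eventually_elim
    case (elim \<omega>)
    show ?case
      using continuous_on_compose2[OF elim(1), of "{0..}" "\<lambda>s. (s, X s \<omega>)"] elim(2)
      by (force intro!: continuous_intros)
  qed
qed

text \<open>The integrals \<open>Y k\<close> are fixed once for all times, and the equation at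
  \<open>t\<close> is subtracted from the one at \<open>u\<close>. That \<open>Y k\<close> starts at
  0 is not written into \<open>ito_integral\<close>; it follows because every approximating simple
  integral vanishes at time 0.\<close>

lemma X_increment:
  "\<exists>Y. (\<forall>k\<in>{1..m}. ito_integral M F (W k) (\<lambda>s \<omega>. b k s (X s \<omega>) \<omega>) (Y k))
    \<and> (AE \<omega> in M. X 0 \<omega> = X0 \<omega>)
    \<and> (\<forall>t u. 0 \<le> t \<longrightarrow> t \<le> u \<longrightarrow> (AE \<omega> in M.
        X u \<omega> - X t \<omega> = (LINT s:{t..u}|lborel. a s (X s \<omega>) \<omega>) + (\<Sum>k=1..m. Y k u \<omega> - Y k t \<omega>)))"
proof -
  obtain Y where Y: "\<And>k. k \<in> {1..m} \<Longrightarrow> ito_integral M F (W k) (\<lambda>s \<omega>. b k s (X s \<omega>) \<omega>) (Y k)"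
    and X: "AE \<omega> in M. \<forall>t\<ge>0. X t \<omega> = X0 \<omega> + (LINT s:{0..t}|lborel. a s (X s \<omega>) \<omega>) + (\<Sum>k=1..m. Y k t \<omega>)"
    using X_sol unfolding sde_solution_def by blast
  have Y0: "AE \<omega> in M. Y k 0 \<omega> = 0" if k: "k \<in> {1..m}" for k
  proof -
    obtain n p \<xi> where S: "\<And>j. simple_data M F (n j) (p j) (\<xi> j)"
      and lim: "\<And>T. 0 \<le> T \<Longrightarrow> (\<lambda>j. \<integral>\<^sup>+ \<omega>. ennreal ((norm (Y k T \<omega> - simple_ito (W k) (n j) (p j) (\<xi> j) T \<omega>))\<^sup>2) \<partial>M) \<longlonglongrightarrow> 0"
      using Y[OF k] unfolding ito_integral_def by blast
    have "simple_ito (W k) (n j) (p j) (\<xi> j) 0 \<omega> = 0" for j \<omega>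
      unfolding simple_ito_def
      using simple_data_nodes[OF S, of _ j] by (intro sum.neutral ballI) (simp add: min_absorb1 Suc_leI)
    then have "(\<lambda>j::nat. \<integral>\<^sup>+ \<omega>. ennreal ((norm (Y k 0 \<omega>))\<^sup>2) \<partial>M) \<longlonglongrightarrow> 0"
      using lim[OF order_refl] by simp
    then have "(\<integral>\<^sup>+ \<omega>. ennreal ((norm (Y k 0 \<omega>))\<^sup>2) \<partial>M) = 0"
      by (simp add: LIMSEQ_const_iff)
    then show ?thesis
      using ito_integral_measurable[OF Y[OF k] order_refl] by (simp add: nn_integral_0_iff_AE)
  qed
  show ?thesis
  proof (intro exI[of _ Y] conjI ballI allI impI Y)
    have "AE \<omega> in M. \<forall>k\<in>{1..m}. Y k 0 \<omega> = 0" using Y0 by (intro AE_ball_countable[THEN iffD2]) auto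
    then show "AE \<omega> in M. X 0 \<omega> = X0 \<omega>"
      using X
    proof eventually_elim
      case (elim \<omega>)
      have "(LINT s:{0..0}|lborel. a s (X s \<omega>) \<omega>) = 0"
        unfolding set_lebesgue_integral_def
        by (intro integral_eq_zero_AE AE_I'[of "{0}"]) (auto simp: indicator_def)
      then show ?case using elim by simp
    qed
    fix t u :: real assume tu: "0 \<le> t" "t \<le> u"
    show "AE \<omega> in M. X u \<omega> - X t \<omega> = (LINT s:{t..u}|lborel. a s (X s \<omega>) \<omega>) + (\<Sum>k=1..m. Y k u \<omega> - Y k t \<omega>)"
      using X regular_path_continuous[OF regular_a]
    proof eventually_elim
      case (elim \<omega>)
      have i: "set_integrable lborel {r..v} (\<lambda>s. a s (X s \<omega>) \<omega>)" if "0 \<le> r" for r v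
        using elim(2) that by (intro borel_integrable_atLeastAtMost') (auto elim!: continuous_on_subset)
      have i2: "set_integrable lborel {t<..u} (\<lambda>s. a s (X s \<omega>) \<omega>)"
        by (rule set_integrable_subset[OF i[OF tu(1), of u]]) auto
      have "(LINT s:{0..u}|lborel. a s (X s \<omega>) \<omega>)
          = (LINT s:{0..t}|lborel. a s (X s \<omega>) \<omega>) + (LINT s:{t<..u}|lborel. a s (X s \<omega>) \<omega>)"
      proof -
        have "{0..u} = {0..t} \<union> {t<..u}" using tu by auto
        then show ?thesis
          using i i2 tu by (simp only:, intro set_integral_Un) auto
      qed
      moreover have "(LINT s:{t<..u}|lborel. a s (X s \<omega>) \<omega>) = (LINT s:{t..u}|lborel. a s (X s \<omega>) \<omega>)"
        unfolding set_lebesgue_integral_def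
      proof (rule integral_cong_AE)
        show "(\<lambda>s. indicator {t<..u} s *\<^sub>R a s (X s \<omega>) \<omega>) \<in> borel_measurable lborel"
          using i2 unfolding set_integrable_def by (rule borel_measurable_integrable)
        show "(\<lambda>s. indicator {t..u} s *\<^sub>R a s (X s \<omega>) \<omega>) \<in> borel_measurable lborel"
          using i[OF tu(1), of u] unfolding set_integrable_def by (rule borel_measurable_integrable)
        show "AE s in lborel. indicator {t<..u} s *\<^sub>R a s (X s \<omega>) \<omega> = indicator {t..u} s *\<^sub>R a s (X s \<omega>) \<omega>"
          by (rule AE_I'[of "{t}"]) (auto simp: indicator_def)
      qed
      ultimately show ?case
        using elim(1) tu by (simp add: sum_subtractf)
    qed
  qed
qed

section \<open>Second moments of the solution\<close>

lemma nn_integral_path_eq: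
  fixes f :: "real \<Rightarrow> 'w \<Rightarrow> ennreal"
  assumes f: "(\<lambda>(s, \<omega>). f (max 0 s) \<omega>) \<in> borel_measurable (borel \<Otimes>\<^sub>M M)" and t: "0 \<le> t"
  shows "(\<integral>\<^sup>+\<omega>. (\<integral>\<^sup>+s\<in>{t..u}. f s \<omega> \<partial>lborel) \<partial>M) = (\<integral>\<^sup>+s\<in>{t..u}. (\<integral>\<^sup>+\<omega>. f s \<omega> \<partial>M) \<partial>lborel)"
proof -
  interpret pair_sigma_finite lborel M ..
  have m: "(\<lambda>(s, \<omega>). f (max 0 s) \<omega> * indicator {t..u} s) \<in> borel_measurable (lborel \<Otimes>\<^sub>M M)"
    using f by (simp add: case_prod_beta)
  have eq: "f s \<omega> * indicator {t..u} s = f (max 0 s) \<omega> * indicator {t..u} s" for s \<omega>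
    using t by (auto simp: indicator_def max_def)
  have "(\<integral>\<^sup>+\<omega>. (\<integral>\<^sup>+s\<in>{t..u}. f s \<omega> \<partial>lborel) \<partial>M) = (\<integral>\<^sup>+s. (\<integral>\<^sup>+\<omega>. f (max 0 s) \<omega> * indicator {t..u} s \<partial>M) \<partial>lborel)"
    unfolding eq by (rule Fubini'[OF m])
  also have "\<dots> = (\<integral>\<^sup>+s\<in>{t..u}. (\<integral>\<^sup>+\<omega>. f s \<omega> \<partial>M) \<partial>lborel)"
    unfolding eq[symmetric] by (intro nn_integral_cong) (auto simp: indicator_def)
  finally show ?thesis .
qed

text \<open>Valued in the extended nonnegative reals, since the solution class provides only a
  finite time integral; finiteness at each single time is proved afterwards.\<close>

definition energy :: "real \<Rightarrow> ennreal" where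
  "energy s = (\<integral>\<^sup>+\<omega>. ennreal ((norm (X s \<omega>))\<^sup>2) \<partial>M)"

lemma energy_integral_finite:
  assumes "0 \<le> T"
  shows "(\<integral>\<^sup>+s\<in>{0..T}. energy s \<partial>lborel) < \<infinity>"
proof -
  note Xm [measurable (raw)] = measurable_process_compose[OF X_process(1)]
  have "(\<integral>\<^sup>+s\<in>{0..T}. energy s \<partial>lborel) = (\<integral>\<^sup>+\<omega>. (\<integral>\<^sup>+s\<in>{0..T}. ennreal ((norm (X s \<omega>))\<^sup>2) \<partial>lborel) \<partial>M)"
    unfolding energy_def by (rule nn_integral_path_eq[OF _ order_refl, symmetric]) measurable
  also have "\<dots> < \<infinity>" using X_sol assms by (simp add: sde_solution_def)
  finally show ?thesis .
qed

lemma coefficient_energy: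
  assumes c: "regular_coefficient c" and t: "0 \<le> t"
  shows "(\<integral>\<^sup>+\<omega>. (\<integral>\<^sup>+s\<in>{t..u}. ennreal ((norm (c s (X s \<omega>) \<omega>))\<^sup>2) \<partial>lborel) \<partial>M)
    \<le> ennreal (2 * C\<^sup>2) * (\<integral>\<^sup>+s\<in>{t..u}. (1 + energy s) \<partial>lborel)"
proof -
  note cm [measurable (raw)] = measurable_process_compose[OF regular_process[OF c]]
  note Xm [measurable (raw)] = measurable_process_compose[OF X_process(1)]
  have en: "(\<integral>\<^sup>+\<omega>. ennreal ((norm (c s (X s \<omega>) \<omega>))\<^sup>2) \<partial>M) \<le> ennreal (2 * C\<^sup>2) * (1 + energy s)" if s: "0 \<le> s" for s
  proof -
    have [measurable]: "X s \<in> borel_measurable M" by (rule X_measurable[OF s])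
    have "(\<integral>\<^sup>+\<omega>. ennreal ((norm (c s (X s \<omega>) \<omega>))\<^sup>2) \<partial>M) \<le> (\<integral>\<^sup>+\<omega>. ennreal (2 * C\<^sup>2) * (1 + ennreal ((norm (X s \<omega>))\<^sup>2)) \<partial>M)"
    proof (rule nn_integral_mono_AE)
      show "AE \<omega> in M. ennreal ((norm (c s (X s \<omega>) \<omega>))\<^sup>2) \<le> ennreal (2 * C\<^sup>2) * (1 + ennreal ((norm (X s \<omega>))\<^sup>2))"
        using regular_growth_square[OF c]
      proof eventually_elim
        case (elim \<omega>)
        then have "ennreal ((norm (c s (X s \<omega>) \<omega>))\<^sup>2) \<le> ennreal (2 * C\<^sup>2 * (1 + (norm (X s \<omega>))\<^sup>2))"
          using s by (intro ennreal_leI) blast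
        then show ?case by (simp add: ennreal_mult)
      qed
    qed
    also have "\<dots> = ennreal (2 * C\<^sup>2) * (1 + energy s)"
      unfolding energy_def by (simp add: nn_integral_cmult nn_integral_add emeasure_space_1)
    finally show ?thesis .
  qed
  have "(\<integral>\<^sup>+\<omega>. (\<integral>\<^sup>+s\<in>{t..u}. ennreal ((norm (c s (X s \<omega>) \<omega>))\<^sup>2) \<partial>lborel) \<partial>M)
      = (\<integral>\<^sup>+s\<in>{t..u}. (\<integral>\<^sup>+\<omega>. ennreal ((norm (c s (X s \<omega>) \<omega>))\<^sup>2) \<partial>M) \<partial>lborel)"
    by (rule nn_integral_path_eq[OF _ t]) measurable
  also have "\<dots> \<le> (\<integral>\<^sup>+s. ennreal (2 * C\<^sup>2) * ((1 + energy (max 0 s)) * indicator {t..u} s) \<partial>lborel)"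
    using en t by (intro nn_integral_mono) (auto simp: indicator_def max_def)
  also have "\<dots> = ennreal (2 * C\<^sup>2) * (\<integral>\<^sup>+s. (1 + energy (max 0 s)) * indicator {t..u} s \<partial>lborel)"
    unfolding energy_def by (rule nn_integral_cmult) measurable
  also have "(\<integral>\<^sup>+s. (1 + energy (max 0 s)) * indicator {t..u} s \<partial>lborel) = (\<integral>\<^sup>+s\<in>{t..u}. (1 + energy s) \<partial>lborel)"
    using t by (intro nn_integral_cong) (auto simp: indicator_def max_def)
  finally show ?thesis .
qed

text \<open>Cauchy-Schwarz in time handles the drift, and the isometry estimate with frozen value 0
  handles each noise term. Only the time integral of the energy appears on the right, and that is
  already known to be finite.\<close>

lemma X_increment_energy:
  assumes tu: "0 \<le> t" "t \<le> u"
  shows "(\<integral>\<^sup>+\<omega>. ennreal ((norm (X u \<omega> - X t \<omega>))\<^sup>2) \<partial>M)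
    \<le> ennreal (4 * C\<^sup>2 * ((u - t) + 6 * m\<^sup>2)) * (\<integral>\<^sup>+s\<in>{t..u}. (1 + energy s) \<partial>lborel)"
proof -
  obtain Y where Y: "\<And>k. k \<in> {1..m} \<Longrightarrow> ito_integral M F (W k) (\<lambda>s \<omega>. b k s (X s \<omega>) \<omega>) (Y k)"
    and inc: "AE \<omega> in M. X u \<omega> - X t \<omega> = (LINT s:{t..u}|lborel. a s (X s \<omega>) \<omega>) + (\<Sum>k=1..m. Y k u \<omega> - Y k t \<omega>)"
    using X_increment tu by blast
  have u: "0 \<le> u" using tu by simp
  let ?E = "\<integral>\<^sup>+s\<in>{t..u}. (1 + energy s) \<partial>lborel"
  note am [measurable (raw)] = measurable_process_compose[OF regular_process[OF regular_a]]
  have [measurable]: "Y k u \<in> borel_measurable M" "Y k t \<in> borel_measurable M" if "k \<in> {1..m}" for k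
    using ito_integral_measurable[OF Y[OF that]] tu u by auto
  have a_eq: "indicator {t..u} s *\<^sub>R a s (X s \<omega>) \<omega> = indicator {t..u} s *\<^sub>R a (max 0 s) (X (max 0 s) \<omega>) \<omega>" for s \<omega>
    using tu by (auto simp: indicator_def max_def)
  have [measurable]: "(\<lambda>\<omega>. LINT s:{t..u}|lborel. a s (X s \<omega>) \<omega>) \<in> borel_measurable M"
    unfolding set_lebesgue_integral_def a_eq by measurable
  have A: "(\<integral>\<^sup>+\<omega>. ennreal ((norm (LINT s:{t..u}|lborel. a s (X s \<omega>) \<omega>))\<^sup>2) \<partial>M) \<le> ennreal (u - t) * (ennreal (2 * C\<^sup>2) * ?E)"
  proof -
    have a_eq2: "ennreal ((norm (a s (X s \<omega>) \<omega>))\<^sup>2) * indicator {t..u} s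
        = ennreal ((norm (a (max 0 s) (X (max 0 s) \<omega>) \<omega>))\<^sup>2) * indicator {t..u} s" for s \<omega>
      using tu by (auto simp: indicator_def max_def)
    have "(\<integral>\<^sup>+\<omega>. ennreal ((norm (LINT s:{t..u}|lborel. a s (X s \<omega>) \<omega>))\<^sup>2) \<partial>M)
       \<le> (\<integral>\<^sup>+\<omega>. ennreal (u - t) * (\<integral>\<^sup>+s\<in>{t..u}. ennreal ((norm (a s (X s \<omega>) \<omega>))\<^sup>2) \<partial>lborel) \<partial>M)"
    proof (rule nn_integral_mono_AE)
      show "AE \<omega> in M. ennreal ((norm (LINT s:{t..u}|lborel. a s (X s \<omega>) \<omega>))\<^sup>2)
         \<le> ennreal (u - t) * (\<integral>\<^sup>+s\<in>{t..u}. ennreal ((norm (a s (X s \<omega>) \<omega>))\<^sup>2) \<partial>lborel)"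
        using regular_path_continuous[OF regular_a]
      proof eventually_elim
        case (elim \<omega>)
        show ?case
          using tu elim by (intro set_integral_norm_square_le) (auto elim: continuous_on_subset)
      qed
    qed
    also have "\<dots> = ennreal (u - t) * (\<integral>\<^sup>+\<omega>. (\<integral>\<^sup>+s\<in>{t..u}. ennreal ((norm (a s (X s \<omega>) \<omega>))\<^sup>2) \<partial>lborel) \<partial>M)"
      unfolding a_eq2 by (rule nn_integral_cmult) measurable
    also have "\<dots> \<le> ennreal (u - t) * (ennreal (2 * C\<^sup>2) * ?E)"
      by (intro mult_left_mono coefficient_energy[OF regular_a tu(1)]) auto
    finally show ?thesis .
  qed
  have B: "(\<integral>\<^sup>+\<omega>. ennreal ((norm (Y k u \<omega> - Y k t \<omega>))\<^sup>2) \<partial>M) \<le> 6 * (ennreal (2 * C\<^sup>2) * ?E)" if k: "k \<in> {1..m}" for k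
  proof -
    have "space M \<in> sets (F t)" using space_F[OF tu(1)] sets.top[of "F t"] by simp
    from ito_integral_increment_estimate[OF wiener[OF k] Y[OF k] tu this, of "\<lambda>_. 0" 0]
    have "(\<integral>\<^sup>+\<omega>. ennreal ((norm (Y k u \<omega> - Y k t \<omega>))\<^sup>2) \<partial>M)
      \<le> 6 * (\<integral>\<^sup>+\<omega>. (\<integral>\<^sup>+s\<in>{t..u}. ennreal ((norm (b k s (X s \<omega>) \<omega>))\<^sup>2) \<partial>lborel) \<partial>M)"
      by (simp cong: nn_integral_cong)
    also have "\<dots> \<le> 6 * (ennreal (2 * C\<^sup>2) * ?E)"
      by (intro mult_left_mono coefficient_energy[OF regular_b[OF k] tu(1)]) auto
    finally show ?thesis .
  qed
  have "(\<integral>\<^sup>+\<omega>. ennreal ((norm (X u \<omega> - X t \<omega>))\<^sup>2) \<partial>M)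
    \<le> (\<integral>\<^sup>+\<omega>. 2 * ennreal ((norm (LINT s:{t..u}|lborel. a s (X s \<omega>) \<omega>))\<^sup>2)
        + (\<Sum>k=1..m. ennreal (2 * m) * ennreal ((norm (Y k u \<omega> - Y k t \<omega>))\<^sup>2)) \<partial>M)"
  proof (rule nn_integral_mono_AE)
    show "AE \<omega> in M. ennreal ((norm (X u \<omega> - X t \<omega>))\<^sup>2)
      \<le> 2 * ennreal ((norm (LINT s:{t..u}|lborel. a s (X s \<omega>) \<omega>))\<^sup>2)
        + (\<Sum>k=1..m. ennreal (2 * m) * ennreal ((norm (Y k u \<omega> - Y k t \<omega>))\<^sup>2))"
      using inc
    proof eventually_elim
      case (elim \<omega>)
      have "(norm (X u \<omega> - X t \<omega>))\<^sup>2 \<le> 2 * (norm (LINT s:{t..u}|lborel. a s (X s \<omega>) \<omega>))\<^sup>2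
          + 2 * (m * (\<Sum>k=1..m. (norm (Y k u \<omega> - Y k t \<omega>))\<^sup>2))"
        unfolding elim
        using norm_sum_square_le[of "{1..m}" "\<lambda>k. Y k u \<omega> - Y k t \<omega>"]
        by (intro order_trans[OF norm_add_square_le] add_left_mono mult_left_mono) auto
      also have "\<dots> = 2 * (norm (LINT s:{t..u}|lborel. a s (X s \<omega>) \<omega>))\<^sup>2
          + (\<Sum>k=1..m. 2 * m * (norm (Y k u \<omega> - Y k t \<omega>))\<^sup>2)"
        by (simp add: sum_distrib_left mult.assoc)
      finally have "ennreal ((norm (X u \<omega> - X t \<omega>))\<^sup>2) \<le> ennreal (2 * (norm (LINT s:{t..u}|lborel. a s (X s \<omega>) \<omega>))\<^sup>2
          + (\<Sum>k=1..m. 2 * m * (norm (Y k u \<omega> - Y k t \<omega>))\<^sup>2))" by (rule ennreal_leI)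
      also have "\<dots> = 2 * ennreal ((norm (LINT s:{t..u}|lborel. a s (X s \<omega>) \<omega>))\<^sup>2)
        + (\<Sum>k=1..m. ennreal (2 * m) * ennreal ((norm (Y k u \<omega> - Y k t \<omega>))\<^sup>2))"
      proof -
        have "(\<Sum>k=1..m. ennreal (2 * m) * ennreal ((norm (Y k u \<omega> - Y k t \<omega>))\<^sup>2))
          = (\<Sum>k=1..m. ennreal (2 * m * (norm (Y k u \<omega> - Y k t \<omega>))\<^sup>2))"
          by (intro sum.cong refl) (subst ennreal_mult, auto)
        also have "\<dots> = ennreal (\<Sum>k=1..m. 2 * m * (norm (Y k u \<omega> - Y k t \<omega>))\<^sup>2)"
          by (rule sum_ennreal) auto
        finally show ?thesis by (subst ennreal_plus) (auto simp: ennreal_mult intro: sum_nonneg)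
      qed
      finally show ?case .
    qed
  qed
  also have "\<dots> = 2 * (\<integral>\<^sup>+\<omega>. ennreal ((norm (LINT s:{t..u}|lborel. a s (X s \<omega>) \<omega>))\<^sup>2) \<partial>M)
      + (\<Sum>k=1..m. ennreal (2 * m) * (\<integral>\<^sup>+\<omega>. ennreal ((norm (Y k u \<omega> - Y k t \<omega>))\<^sup>2) \<partial>M))"
  proof -
    have "(\<integral>\<^sup>+\<omega>. (\<Sum>k=1..m. ennreal (2 * m) * ennreal ((norm (Y k u \<omega> - Y k t \<omega>))\<^sup>2)) \<partial>M)
        = (\<Sum>k=1..m. ennreal (2 * m) * (\<integral>\<^sup>+\<omega>. ennreal ((norm (Y k u \<omega> - Y k t \<omega>))\<^sup>2) \<partial>M))"
      by (subst nn_integral_sum, measurable, intro sum.cong refl nn_integral_cmult, measurable)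
    then show ?thesis by (subst nn_integral_add) (measurable, simp add: nn_integral_cmult)
  qed
  also have "\<dots> \<le> 2 * (ennreal (u - t) * (ennreal (2 * C\<^sup>2) * ?E)) + (\<Sum>k=1..m. ennreal (2 * m) * (6 * (ennreal (2 * C\<^sup>2) * ?E)))"
    by (intro add_mono mult_left_mono sum_mono A B) auto
  also have "\<dots> = ennreal (4 * C\<^sup>2 * ((u - t) + 6 * m\<^sup>2)) * ?E"
  proof -
    have "(\<Sum>k=1..m. ennreal (2 * m) * (6 * (ennreal (2 * C\<^sup>2) * ?E))) = ennreal m * (ennreal (2 * m) * (6 * (ennreal (2 * C\<^sup>2) * ?E)))"
      by (simp add: ennreal_of_nat_eq_real_of_nat)
    also have "\<dots> = ennreal (m * (2 * m * (6 * (2 * C\<^sup>2)))) * ?E"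
      by (simp add: ennreal_mult mult_ac)
    finally have 1: "(\<Sum>k=1..m. ennreal (2 * m) * (6 * (ennreal (2 * C\<^sup>2) * ?E))) = ennreal (m * (2 * m * (6 * (2 * C\<^sup>2)))) * ?E" .
    have 2: "2 * (ennreal (u - t) * (ennreal (2 * C\<^sup>2) * ?E)) = ennreal (2 * ((u - t) * (2 * C\<^sup>2))) * ?E"
      using tu by (simp add: ennreal_mult mult_ac)
    have h: "0 \<le> 2 * ((u - t) * (2 * C\<^sup>2))" "0 \<le> m * (2 * m * (6 * (2 * C\<^sup>2)))"
      using tu by (intro mult_nonneg_nonneg; simp)+
    have "ennreal (2 * ((u - t) * (2 * C\<^sup>2))) + ennreal (m * (2 * m * (6 * (2 * C\<^sup>2)))) = ennreal (4 * C\<^sup>2 * ((u - t) + 6 * m\<^sup>2))"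
      unfolding ennreal_plus[OF h, symmetric]
      by (intro arg_cong[where f=ennreal]) (simp add: power2_eq_square algebra_simps)
    then show ?thesis unfolding 1 2 by (simp add: distrib_right[symmetric])
  qed
  finally show ?thesis .
qed

text \<open>The increment from time 0 is bounded by the energy integrated over
  \<open>[0, T]\<close>, which is finite for the given solution; together with the bounded initial
  value this controls the energy at every single time.\<close>

lemma energy_bounded:
  assumes T: "0 \<le> T"
  obtains K where "0 \<le> K" "\<And>t. t \<in> {0..T} \<Longrightarrow> energy t \<le> ennreal K"
proof -
  obtain K0 where K0: "AE \<omega> in M. norm (X0 \<omega>) \<le> K0" using X0_bounded by blast
  have "AE \<omega> in M. X 0 \<omega> = X0 \<omega>" using X_increment by blast
  then have X00: "AE \<omega> in M. norm (X 0 \<omega>) \<le> K0" using K0 by eventually_elim simp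
  note Xm [measurable (raw)] = measurable_process_compose[OF X_process(1)]
  have E0: "energy 0 \<le> ennreal (K0\<^sup>2)"
  proof -
    have "energy 0 \<le> (\<integral>\<^sup>+\<omega>. ennreal (K0\<^sup>2) \<partial>M)"
      unfolding energy_def by (rule nn_integral_mono_AE) (use X00 in \<open>eventually_elim, auto intro!: ennreal_leI power_mono\<close>)
    then show ?thesis by (simp add: emeasure_space_1)
  qed
  let ?I = "\<integral>\<^sup>+s\<in>{0..T}. (1 + energy s) \<partial>lborel"
  have "?I = (\<integral>\<^sup>+s. indicator {0..T} s + energy s * indicator {0..T} s \<partial>lborel)"
    by (intro nn_integral_cong) (auto simp: indicator_def)
  also have "\<dots> = (\<integral>\<^sup>+s. indicator {0..T} s + energy (max 0 s) * indicator {0..T} s \<partial>lborel)"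
    by (intro nn_integral_cong) (auto simp: indicator_def max_def)
  also have "\<dots> = (\<integral>\<^sup>+s. indicator {0..T} s \<partial>lborel) + (\<integral>\<^sup>+s\<in>{0..T}. energy (max 0 s) \<partial>lborel)"
    unfolding energy_def by (rule nn_integral_add) measurable
  also have "(\<integral>\<^sup>+s\<in>{0..T}. energy (max 0 s) \<partial>lborel) = (\<integral>\<^sup>+s\<in>{0..T}. energy s \<partial>lborel)"
    by (intro nn_integral_cong) (auto simp: indicator_def max_def)
  finally have If: "?I < \<infinity>" using energy_integral_finite[OF T] T by simp
  define K where "K = ennreal (4 * C\<^sup>2 * (T + 6 * m\<^sup>2)) * ?I"
  have Kf: "2 * ennreal (K0\<^sup>2) + 2 * K < \<infinity>" using If by (simp add: K_def ennreal_mult_less_top)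
  have "energy t \<le> 2 * ennreal (K0\<^sup>2) + 2 * K" if t: "t \<in> {0..T}" for t
  proof -
    have t0: "0 \<le> t" using t by simp
    have [measurable]: "X t \<in> borel_measurable M" "X 0 \<in> borel_measurable M" using X_measurable t0 by auto
    have "energy t \<le> (\<integral>\<^sup>+\<omega>. 2 * ennreal ((norm (X 0 \<omega>))\<^sup>2) + 2 * ennreal ((norm (X t \<omega> - X 0 \<omega>))\<^sup>2) \<partial>M)"
      unfolding energy_def
    proof (rule nn_integral_mono)
      fix \<omega>
      have "(norm (X t \<omega>))\<^sup>2 \<le> 2 * (norm (X 0 \<omega>))\<^sup>2 + 2 * (norm (X t \<omega> - X 0 \<omega>))\<^sup>2"
        using norm_add_square_le[of "X 0 \<omega>" "X t \<omega> - X 0 \<omega>"] by simp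
      from ennreal_leI[OF this]
      show "ennreal ((norm (X t \<omega>))\<^sup>2) \<le> 2 * ennreal ((norm (X 0 \<omega>))\<^sup>2) + 2 * ennreal ((norm (X t \<omega> - X 0 \<omega>))\<^sup>2)"
        by (simp add: ennreal_mult)
    qed
    also have "\<dots> = 2 * energy 0 + 2 * (\<integral>\<^sup>+\<omega>. ennreal ((norm (X t \<omega> - X 0 \<omega>))\<^sup>2) \<partial>M)"
      unfolding energy_def by (simp add: nn_integral_add nn_integral_cmult)
    also have "(\<integral>\<^sup>+\<omega>. ennreal ((norm (X t \<omega> - X 0 \<omega>))\<^sup>2) \<partial>M) \<le> K"
    proof -
      have "(\<integral>\<^sup>+\<omega>. ennreal ((norm (X t \<omega> - X 0 \<omega>))\<^sup>2) \<partial>M)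
        \<le> ennreal (4 * C\<^sup>2 * ((t - 0) + 6 * m\<^sup>2)) * (\<integral>\<^sup>+s\<in>{0..t}. (1 + energy s) \<partial>lborel)"
        by (rule X_increment_energy[OF order_refl t0])
      also have "\<dots> \<le> K"
        unfolding K_def using t
        by (intro mult_mono ennreal_leI nn_integral_mono) (auto simp: indicator_def intro!: mult_left_mono)
      finally show ?thesis .
    qed
    finally show ?thesis using E0 by (meson add_mono mult_left_mono order_trans order_refl zero_le)
  qed
  moreover obtain K' where "0 \<le> K'" "2 * ennreal (K0\<^sup>2) + 2 * K = ennreal K'"
    using Kf by (metis ennreal_cases infinity_ennreal_def less_irrefl)
  ultimately show ?thesis using that by metis
qed

lemma X_square_integrable:
  assumes t: "0 \<le> t"
  shows "square_integrable M (X t)"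
proof (rule nn_integral_square_norm_finite_imp[OF X_measurable[OF t]])
  obtain K where "\<And>s. s \<in> {0..t} \<Longrightarrow> energy s \<le> ennreal K" using energy_bounded[OF t] by blast
  then have "energy t \<le> ennreal K" using t by simp
  then show "(\<integral>\<^sup>+ \<omega>. ennreal ((norm (X t \<omega>))\<^sup>2) \<partial>M) < \<infinity>"
    unfolding energy_def using le_less_trans by fastforce
qed

text \<open>With the energy uniformly bounded, its integral over \<open>[t, u]\<close> in
  \<open>X_increment_energy\<close> is at most a multiple of \<open>u - t\<close>.\<close>

lemma X_Lipschitz_in_mean_square:
  assumes T: "0 \<le> T"
  obtains K where "0 \<le> K"
    "\<And>t u. 0 \<le> t \<Longrightarrow> t \<le> u \<Longrightarrow> u \<le> T \<Longrightarrow> expectation (\<lambda>\<omega>. (norm (X u \<omega> - X t \<omega>))\<^sup>2) \<le> K * (u - t)"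
proof -
  obtain K where K: "0 \<le> K" "\<And>t. t \<in> {0..T} \<Longrightarrow> energy t \<le> ennreal K" using energy_bounded[OF T] by blast
  define L where "L = 4 * C\<^sup>2 * (T + 6 * m\<^sup>2) * (1 + K)"
  have L: "0 \<le> L" using T K by (simp add: L_def)
  moreover have "expectation (\<lambda>\<omega>. (norm (X u \<omega> - X t \<omega>))\<^sup>2) \<le> L * (u - t)" if tu: "0 \<le> t" "t \<le> u" "u \<le> T" for t u
  proof -
    have i: "integrable M (\<lambda>\<omega>. (norm (X u \<omega> - X t \<omega>))\<^sup>2)"
      using square_integrable_diff[OF X_square_integrable X_square_integrable, of u t] tu
      by (simp add: square_integrable_def)
    have "ennreal (expectation (\<lambda>\<omega>. (norm (X u \<omega> - X t \<omega>))\<^sup>2)) = (\<integral>\<^sup>+\<omega>. ennreal ((norm (X u \<omega> - X t \<omega>))\<^sup>2) \<partial>M)"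
      by (rule nn_integral_eq_integral[symmetric, OF i]) simp
    also have "\<dots> \<le> ennreal (4 * C\<^sup>2 * ((u - t) + 6 * m\<^sup>2)) * (\<integral>\<^sup>+s\<in>{t..u}. (1 + energy s) \<partial>lborel)"
      by (rule X_increment_energy[OF tu(1,2)])
    also have "\<dots> \<le> ennreal (4 * C\<^sup>2 * (T + 6 * m\<^sup>2)) * (\<integral>\<^sup>+s. ennreal (1 + K) * indicator {t..u} s \<partial>lborel)"
    proof -
      have "(1 + energy s) * indicator {t..u} s \<le> ennreal (1 + K) * indicator {t..u} s" for s
        using K tu by (cases "s \<in> {t..u}") (auto intro!: add_left_mono)
      then have 1: "(\<integral>\<^sup>+s\<in>{t..u}. (1 + energy s) \<partial>lborel) \<le> (\<integral>\<^sup>+s. ennreal (1 + K) * indicator {t..u} s \<partial>lborel)"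
        by (rule nn_integral_mono)
      have "ennreal (4 * C\<^sup>2 * ((u - t) + 6 * m\<^sup>2)) \<le> ennreal (4 * C\<^sup>2 * (T + 6 * m\<^sup>2))"
        using tu by (intro ennreal_leI mult_left_mono) auto
      from mult_mono[OF this 1] show ?thesis by simp
    qed
    also have "\<dots> = ennreal (4 * C\<^sup>2 * (T + 6 * m\<^sup>2)) * (ennreal (1 + K) * ennreal (u - t))"
      using tu by (simp add: nn_integral_cmult_indicator)
    also have "\<dots> = ennreal (L * (u - t))"
      unfolding L_def using tu K T by (simp add: ennreal_mult mult.assoc)
    finally show ?thesis using L tu by (simp add: ennreal_le_iff)
  qed
  ultimately show ?thesis using that by blast
qed

lemma regular_square_integrable:
  assumes c: "regular_coefficient c" and t: "0 \<le> t" and f: "square_integrable M f"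
  shows "square_integrable M (\<lambda>\<omega>. c t (f \<omega>) \<omega>)"
proof (rule square_integrable_bound[where g="\<lambda>\<omega>. 2 * C\<^sup>2 * (1 + (norm (f \<omega>))\<^sup>2)"])
  show "(\<lambda>\<omega>. c t (f \<omega>) \<omega>) \<in> borel_measurable M"
    using f by (intro regular_measurable[OF c t]) (simp add: square_integrable_def)
  show "integrable M (\<lambda>\<omega>. 2 * C\<^sup>2 * (1 + (norm (f \<omega>))\<^sup>2))"
    using f by (simp add: square_integrable_def)
  show "AE \<omega> in M. (norm (c t (f \<omega>) \<omega>))\<^sup>2 \<le> 2 * C\<^sup>2 * (1 + (norm (f \<omega>))\<^sup>2)"
    using regular_growth_square[OF c] by eventually_elim (use t in blast)
qed

section \<open>Mean-square oscillation of the coefficients along the solution\<close>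

definition mean_gap :: "(real \<Rightarrow> real ^ 'd \<Rightarrow> 'w \<Rightarrow> real ^ 'd) \<Rightarrow> real \<Rightarrow> real \<Rightarrow> real" where
  "mean_gap c s t = expectation (\<lambda>\<omega>. (norm (c s (X s \<omega>) \<omega> - c t (X t \<omega>) \<omega>))\<^sup>2)"

lemma mean_gap_integrable:
  assumes c: "regular_coefficient c" and st: "0 \<le> s" "0 \<le> t"
  shows "integrable M (\<lambda>\<omega>. (norm (c s (X s \<omega>) \<omega> - c t (X t \<omega>) \<omega>))\<^sup>2)"
  using square_integrable_diff[OF regular_square_integrable[OF c st(1) X_square_integrable[OF st(1)]]
      regular_square_integrable[OF c st(2) X_square_integrable[OF st(2)]]]
  by (simp add: square_integrable_def)

lemma mean_gap_triangle:
  assumes c: "regular_coefficient c" and str: "0 \<le> s" "0 \<le> t" "0 \<le> r"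
  shows "mean_gap c s t \<le> 2 * mean_gap c s r + 2 * mean_gap c t r"
proof -
  note i = mean_gap_integrable[OF c]
  have "mean_gap c s t \<le> expectation (\<lambda>\<omega>. 2 * (norm (c s (X s \<omega>) \<omega> - c r (X r \<omega>) \<omega>))\<^sup>2
      + 2 * (norm (c t (X t \<omega>) \<omega> - c r (X r \<omega>) \<omega>))\<^sup>2)"
    unfolding mean_gap_def
  proof (rule integral_mono)
    fix \<omega>
    show "(norm (c s (X s \<omega>) \<omega> - c t (X t \<omega>) \<omega>))\<^sup>2 \<le> 2 * (norm (c s (X s \<omega>) \<omega> - c r (X r \<omega>) \<omega>))\<^sup>2
      + 2 * (norm (c t (X t \<omega>) \<omega> - c r (X r \<omega>) \<omega>))\<^sup>2"
      using norm_add_square_le[of "c s (X s \<omega>) \<omega> - c r (X r \<omega>) \<omega>" "c r (X r \<omega>) \<omega> - c t (X t \<omega>) \<omega>"]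
      by (simp add: norm_minus_commute)
  qed (use i str in auto)
  also have "\<dots> = 2 * mean_gap c s r + 2 * mean_gap c t r"
    unfolding mean_gap_def using i str by simp
  finally show ?thesis .
qed

text \<open>Space and time are varied separately. Replacing \<open>X (s n)\<close> by
  \<open>X r\<close> is controlled by the Lipschitz condition and the mean-square continuity of
  \<open>X\<close>; the remaining change in time, \<open>q n\<close>, tends to 0 almost surely and
  is dominated through linear growth.\<close>

lemma mean_gap_tendsto:
  assumes c: "regular_coefficient c" and r: "0 \<le> r" and s: "\<And>n. 0 \<le> s n" "s \<longlonglongrightarrow> r"
  shows "(\<lambda>n. mean_gap c (s n) r) \<longlonglongrightarrow> 0"
proof -
  obtain T where T: "\<And>n. s n \<le> T"
  proof -
    have "Bseq s" using s(2) convergentI convergent_imp_Bseq by blast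
    then show ?thesis using that unfolding Bseq_def by (metis abs_le_D1 real_norm_def)
  qed
  have T0: "0 \<le> T" and rT: "r \<le> T"
    using s T order_trans[of 0 "s 0" T] LIMSEQ_le_const2[OF s(2), of T] by auto
  obtain K where K: "0 \<le> K" "\<And>t u. 0 \<le> t \<Longrightarrow> t \<le> u \<Longrightarrow> u \<le> T \<Longrightarrow> expectation (\<lambda>\<omega>. (norm (X u \<omega> - X t \<omega>))\<^sup>2) \<le> K * (u - t)"
    using X_Lipschitz_in_mean_square[OF T0] by blast
  have X: "expectation (\<lambda>\<omega>. (norm (X (s n) \<omega> - X r \<omega>))\<^sup>2) \<le> K * \<bar>s n - r\<bar>" for n
  proof (cases "s n \<le> r")
    case True
    then show ?thesis using K(2)[OF s(1) True rT] by (simp add: norm_minus_commute)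
  next
    case False
    then show ?thesis using K(2)[OF r _ T, of n] by simp
  qed
  define q where "q n \<omega> = c (s n) (X r \<omega>) \<omega> - c r (X r \<omega>) \<omega>" for n \<omega>
  note sqX = X_square_integrable[OF r]
  have sqq: "square_integrable M (q n)" for n
    unfolding q_def[abs_def]
    by (intro square_integrable_diff regular_square_integrable[OF c] s r sqX)
  have sqd: "square_integrable M (\<lambda>\<omega>. X (s n) \<omega> - X r \<omega>)" for n
    by (intro square_integrable_diff X_square_integrable s r)
  have limq: "(\<lambda>n. expectation (\<lambda>\<omega>. (norm (q n \<omega>))\<^sup>2)) \<longlonglongrightarrow> expectation (\<lambda>\<omega>. 0)"
  proof (rule integral_dominated_convergence)
    show "integrable M (\<lambda>\<omega>. 8 * C\<^sup>2 * (1 + (norm (X r \<omega>))\<^sup>2))" using sqX by (simp add: square_integrable_def)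
    show "AE \<omega> in M. (\<lambda>n. (norm (q n \<omega>))\<^sup>2) \<longlonglongrightarrow> 0"
    proof -
      have "AE \<omega> in M. continuous_on ({0..} \<times> UNIV) (\<lambda>(t, x). c t x \<omega>)"
        using c by (auto simp: regular_coefficient_def elim!: eventually_mono)
      then show ?thesis
      proof eventually_elim
        case (elim \<omega>)
        have "continuous_on {0..} (\<lambda>t. c t (X r \<omega>) \<omega>)"
          using continuous_on_compose2[OF elim, of "{0..}" "\<lambda>t. (t, X r \<omega>)"]
          by (force intro!: continuous_intros)
        from continuous_on_tendsto_compose[OF this s(2)]
        have "(\<lambda>n. c (s n) (X r \<omega>) \<omega>) \<longlonglongrightarrow> c r (X r \<omega>) \<omega>"
          using s(1) r by simp
        then have "(\<lambda>n. q n \<omega>) \<longlonglongrightarrow> 0" unfolding q_def by (rule LIM_zero)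
        then have "(\<lambda>n. (norm (q n \<omega>))\<^sup>2) \<longlonglongrightarrow> (norm (0 :: real ^ 'd))\<^sup>2" by (intro tendsto_intros)
        then show ?case by simp
      qed
    qed
    show "AE \<omega> in M. norm ((norm (q n \<omega>))\<^sup>2) \<le> 8 * C\<^sup>2 * (1 + (norm (X r \<omega>))\<^sup>2)" for n
      using regular_growth_square[OF c]
    proof eventually_elim
      case (elim \<omega>)
      have "(norm (c (s n) (X r \<omega>) \<omega>))\<^sup>2 \<le> 2 * C\<^sup>2 * (1 + (norm (X r \<omega>))\<^sup>2)"
        "(norm (c r (X r \<omega>) \<omega>))\<^sup>2 \<le> 2 * C\<^sup>2 * (1 + (norm (X r \<omega>))\<^sup>2)" using elim s r by blast+
      then show ?case
        using norm_add_square_le[of "c (s n) (X r \<omega>) \<omega>" "- c r (X r \<omega>) \<omega>"] by (simp add: q_def)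
    qed
  qed (use sqq in \<open>auto simp: square_integrable_def\<close>)
  have le: "mean_gap c (s n) r \<le> 2 * C\<^sup>2 * (K * \<bar>s n - r\<bar>) + 2 * expectation (\<lambda>\<omega>. (norm (q n \<omega>))\<^sup>2)" for n
  proof -
    have "mean_gap c (s n) r \<le> expectation (\<lambda>\<omega>. 2 * C\<^sup>2 * (norm (X (s n) \<omega> - X r \<omega>))\<^sup>2 + 2 * (norm (q n \<omega>))\<^sup>2)"
      unfolding mean_gap_def
    proof (rule integral_mono_AE)
      show "AE \<omega> in M. (norm (c (s n) (X (s n) \<omega>) \<omega> - c r (X r \<omega>) \<omega>))\<^sup>2
          \<le> 2 * C\<^sup>2 * (norm (X (s n) \<omega> - X r \<omega>))\<^sup>2 + 2 * (norm (q n \<omega>))\<^sup>2"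
      proof -
        have "AE \<omega> in M. \<forall>t\<ge>0. \<forall>x y. norm (c t x \<omega> - c t y \<omega>) \<le> C * norm (x - y)"
          using c by (auto simp: regular_coefficient_def elim!: eventually_mono)
        then show ?thesis
        proof eventually_elim
          case (elim \<omega>)
          have "norm (c (s n) (X (s n) \<omega>) \<omega> - c (s n) (X r \<omega>) \<omega>) \<le> C * norm (X (s n) \<omega> - X r \<omega>)"
            using elim s by blast
          then have "(norm (c (s n) (X (s n) \<omega>) \<omega> - c (s n) (X r \<omega>) \<omega>))\<^sup>2 \<le> (C * norm (X (s n) \<omega> - X r \<omega>))\<^sup>2"
            by (intro power_mono) auto
          then show ?case
            using norm_add_square_le[of "c (s n) (X (s n) \<omega>) \<omega> - c (s n) (X r \<omega>) \<omega>" "q n \<omega>"]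
            by (simp add: q_def power_mult_distrib)
        qed
      qed
      show "integrable M (\<lambda>\<omega>. 2 * C\<^sup>2 * (norm (X (s n) \<omega> - X r \<omega>))\<^sup>2 + 2 * (norm (q n \<omega>))\<^sup>2)"
        using sqq sqd by (simp add: square_integrable_def)
    qed (use mean_gap_integrable[OF c] s r in auto)
    also have "\<dots> = 2 * C\<^sup>2 * expectation (\<lambda>\<omega>. (norm (X (s n) \<omega> - X r \<omega>))\<^sup>2) + 2 * expectation (\<lambda>\<omega>. (norm (q n \<omega>))\<^sup>2)"
      using sqq sqd by (simp add: square_integrable_def)
    also have "\<dots> \<le> 2 * C\<^sup>2 * (K * \<bar>s n - r\<bar>) + 2 * expectation (\<lambda>\<omega>. (norm (q n \<omega>))\<^sup>2)"
      using X by (intro add_right_mono mult_left_mono) auto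
    finally show ?thesis .
  qed
  have "(\<lambda>n. \<bar>s n - r\<bar>) \<longlonglongrightarrow> 0" using tendsto_rabs[OF LIM_zero[OF s(2)]] by simp
  then have lim: "(\<lambda>n. 2 * C\<^sup>2 * (K * \<bar>s n - r\<bar>) + 2 * expectation (\<lambda>\<omega>. (norm (q n \<omega>))\<^sup>2)) \<longlonglongrightarrow> 2 * C\<^sup>2 * (K * 0) + 2 * 0"
    using limq by (intro tendsto_intros) auto
  show ?thesis
    by (rule tendsto_sandwich[OF _ _ tendsto_const]) (use le lim in \<open>auto simp: mean_gap_def\<close>)
qed

text \<open>This is the error of freezing a coefficient at time \<open>t\<close>. The mean gap is
  uniformly small by compactness of \<open>[0, T]\<close>; integrating it gives an arbitrarily small
  multiple of the length, the best that continuity in time without a modulus allows.\<close>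

lemma coefficient_oscillation:
  assumes c: "regular_coefficient c" and e: "e > 0"
  shows "\<exists>d>0. \<forall>t u. 0 \<le> t \<longrightarrow> t \<le> u \<longrightarrow> u \<le> T \<longrightarrow> u - t < d \<longrightarrow>
      (\<integral>\<^sup>+\<omega>. (\<integral>\<^sup>+s\<in>{t..u}. ennreal ((norm (c s (X s \<omega>) \<omega> - c t (X t \<omega>) \<omega>))\<^sup>2) \<partial>lborel) \<partial>M) \<le> ennreal (e * (u - t))"
proof -
  have "\<exists>d>0. \<forall>s\<in>{0..T}. \<forall>t\<in>{0..T}. \<bar>s - t\<bar> < d \<longrightarrow> mean_gap c s t < e"
    by (rule uniform_of_pointwise_quasimetric[OF mean_gap_triangle[OF c] mean_gap_tendsto[OF c] e])
  then obtain d where d: "d > 0" "\<And>s t. s \<in> {0..T} \<Longrightarrow> t \<in> {0..T} \<Longrightarrow> \<bar>s - t\<bar> < d \<Longrightarrow> mean_gap c s t < e"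
    by blast
  note cm [measurable (raw)] = measurable_process_compose[OF regular_process[OF c]]
  show ?thesis
  proof (intro exI[of _ d] conjI d(1) allI impI)
    fix t u :: real assume tu: "0 \<le> t" "t \<le> u" "u \<le> T" "u - t < d"
    have [measurable]: "(\<lambda>\<omega>. c t (X t \<omega>) \<omega>) \<in> borel_measurable M"
      by (rule regular_measurable[OF c tu(1) X_measurable[OF tu(1)]])
    have "(\<integral>\<^sup>+\<omega>. (\<integral>\<^sup>+s\<in>{t..u}. ennreal ((norm (c s (X s \<omega>) \<omega> - c t (X t \<omega>) \<omega>))\<^sup>2) \<partial>lborel) \<partial>M)
      = (\<integral>\<^sup>+s\<in>{t..u}. (\<integral>\<^sup>+\<omega>. ennreal ((norm (c s (X s \<omega>) \<omega> - c t (X t \<omega>) \<omega>))\<^sup>2) \<partial>M) \<partial>lborel)"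
      by (rule nn_integral_path_eq[OF _ tu(1)]) measurable
    also have "\<dots> \<le> (\<integral>\<^sup>+s. ennreal e * indicator {t..u} s \<partial>lborel)"
    proof (rule nn_integral_mono)
      fix s :: real
      show "(\<integral>\<^sup>+\<omega>. ennreal ((norm (c s (X s \<omega>) \<omega> - c t (X t \<omega>) \<omega>))\<^sup>2) \<partial>M) * indicator {t..u} s \<le> ennreal e * indicator {t..u} s"
      proof (cases "s \<in> {t..u}")
        case True
        then have s: "0 \<le> s" "s \<in> {0..T}" "\<bar>s - t\<bar> < d" using tu by auto
        have "(\<integral>\<^sup>+\<omega>. ennreal ((norm (c s (X s \<omega>) \<omega> - c t (X t \<omega>) \<omega>))\<^sup>2) \<partial>M) = ennreal (mean_gap c s t)"
          unfolding mean_gap_def by (rule nn_integral_eq_integral[OF mean_gap_integrable[OF c s(1) tu(1)]]) simp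
        also have "\<dots> \<le> ennreal e" using d(2)[OF s(2) _ s(3)] tu by (intro ennreal_leI) auto
        finally show ?thesis using True by simp
      qed simp
    qed
    also have "\<dots> = ennreal (e * (u - t))"
      using tu e by (simp add: nn_integral_cmult_indicator ennreal_mult)
    finally show "(\<integral>\<^sup>+\<omega>. (\<integral>\<^sup>+s\<in>{t..u}. ennreal ((norm (c s (X s \<omega>) \<omega> - c t (X t \<omega>) \<omega>))\<^sup>2) \<partial>lborel) \<partial>M) \<le> ennreal (e * (u - t))" .
  qed
qed

end

subsection \<open>The distance to the viability set\<close>

lemma borel_measurable_infdist: "(\<lambda>x :: 'a :: metric_space. infdist x D) \<in> borel_measurable borel"
  by (intro borel_measurable_continuous_onI continuous_on_infdist continuous_on_id)

text \<open>The first point of a dense sequence in \<open>D\<close> that comes within the slack of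
  the distance is chosen. Strict inequality against a positive slack guarantees that such an index
  exists, and taking the least one makes the map measurable.\<close>

lemma approximate_projection:
  fixes D :: "'v :: euclidean_space set"
  assumes D: "D \<noteq> {}" and \<delta>: "\<delta> > 0"
  obtains \<pi> where "\<pi> \<in> borel_measurable borel" "\<And>x. \<pi> x \<in> D"
    "\<And>x. (norm (x - \<pi> x))\<^sup>2 \<le> (infdist x D)\<^sup>2 + \<delta>"
proof -
  obtain T where T: "countable T" "T \<subseteq> D" "D \<subseteq> closure T" using separable[of D] by blast
  then have T0: "T \<noteq> {}" using D by auto
  define q where "q = from_nat_into T"
  define J where "J x = (LEAST n. (dist x (q n))\<^sup>2 < (infdist x D)\<^sup>2 + \<delta>)" for x
  have ex: "\<exists>n. (dist x (q n))\<^sup>2 < (infdist x D)\<^sup>2 + \<delta>" for x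
  proof -
    have "infdist x D < sqrt ((infdist x D)\<^sup>2 + \<delta>)"
      using \<delta> by (intro real_less_rsqrt) simp
    then obtain z where z: "z \<in> D" "dist x z < sqrt ((infdist x D)\<^sup>2 + \<delta>)"
      unfolding infdist_notempty[OF D] using D by (subst (asm) cINF_less_iff) auto
    have "z \<in> closure T" using z T by blast
    then obtain y where y: "y \<in> T" "dist y z < sqrt ((infdist x D)\<^sup>2 + \<delta>) - dist x z"
      using z(2) by (metis closure_approachable diff_gt_0_iff_gt)
    have "dist x y < sqrt ((infdist x D)\<^sup>2 + \<delta>)"
      using y(2) dist_triangle[of x y z] by (simp add: dist_commute)
    then have "(dist x y)\<^sup>2 < (sqrt ((infdist x D)\<^sup>2 + \<delta>))\<^sup>2" by (intro power_strict_mono) auto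
    also have "\<dots> = (infdist x D)\<^sup>2 + \<delta>" using \<delta> by simp
    finally show ?thesis using from_nat_into_surj[OF T(1) y(1)] by (auto simp: q_def)
  qed
  note [measurable] = borel_measurable_infdist
  have "J \<in> measurable borel (count_space UNIV)"
    unfolding J_def[abs_def] by measurable
  then have "(\<lambda>x. q (J x)) \<in> borel_measurable borel"
    by (rule measurable_compose) simp
  moreover have "q (J x) \<in> D" for x using from_nat_into[OF T0] T(2) by (auto simp: q_def)
  moreover have "(norm (x - q (J x)))\<^sup>2 \<le> (infdist x D)\<^sup>2 + \<delta>" for x
    using LeastI_ex[OF ex[of x]] by (simp add: J_def dist_norm)
  ultimately show ?thesis using that[of "\<lambda>x. q (J x)"] by blast
qed

text \<open>Here \<open>z\<close> is the current offset from \<open>D\<close>, \<open>P\<close> and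
  \<open>N\<close> are the errors of drift and noise, \<open>Q\<close> is the correction and
  \<open>r\<close> the miss of the corrected step. The inner products with \<open>z\<close> are kept
  exactly, so that their expectations can be used; apart from \<open>norm z * r\<close>, all other
  products are absorbed into squares.\<close>

lemma distance_square_step:
  fixes z P N Q :: "'v :: real_inner" and d r :: real
  assumes "0 \<le> d" "0 \<le> r" "d \<le> norm (z + (P + N - Q)) + r"
  shows "d\<^sup>2 \<le> (norm z)\<^sup>2 + 2 * (z \<bullet> P) + 2 * (z \<bullet> N) - 2 * (z \<bullet> Q)
    + 6 * (norm P)\<^sup>2 + 6 * (norm N)\<^sup>2 + 6 * (norm Q)\<^sup>2 + 2 * norm z * r + 2 * r\<^sup>2"
proof -
  define G where "G = P + N - Q"
  have G: "(norm G)\<^sup>2 \<le> 3 * (norm P)\<^sup>2 + 3 * (norm N)\<^sup>2 + 3 * (norm Q)\<^sup>2"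
    using norm_add3_square_le[of P N "- Q"] by (simp add: G_def)
  have "d\<^sup>2 \<le> (norm (z + G) + r)\<^sup>2" using assms by (intro power_mono) (auto simp: G_def)
  also have "\<dots> = (norm (z + G))\<^sup>2 + 2 * norm (z + G) * r + r\<^sup>2" by (simp add: power2_sum)
  also have "(norm (z + G))\<^sup>2 = (norm z)\<^sup>2 + 2 * (z \<bullet> G) + (norm G)\<^sup>2"
    by (simp add: power2_norm_eq_inner inner_add_left inner_add_right inner_commute)
  also have "2 * norm (z + G) * r \<le> 2 * (norm z + norm G) * r"
    using assms(2) norm_triangle_ineq[of z G] by (intro mult_right_mono mult_left_mono) auto
  also have "2 * (norm z + norm G) * r = 2 * norm z * r + 2 * norm G * r" by (simp add: algebra_simps)
  also have "2 * norm G * r \<le> (norm G)\<^sup>2 + r\<^sup>2" by (rule sum_squares_bound)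
  finally have "d\<^sup>2 \<le> (norm z)\<^sup>2 + 2 * (z \<bullet> G) + 2 * (norm G)\<^sup>2 + 2 * norm z * r + 2 * r\<^sup>2" by linarith
  then show ?thesis using G by (simp add: G_def inner_add_right inner_diff_right)
qed

context random_coefficient_sde
begin

definition noise_square :: "real \<Rightarrow> real \<Rightarrow> 'w \<Rightarrow> real" where
  "noise_square t u \<omega> = (\<Sum>k=1..m. (W k u \<omega> - W k t \<omega>)\<^sup>2)"

lemma noise_square_nonneg: "0 \<le> noise_square t u \<omega>"
  by (auto simp: noise_square_def intro: sum_nonneg)

text \<open>Cauchy-Schwarz over \<open>k\<close> reduces the second moment to the fourth moments
  \<open>3 * (u - t)\<^sup>2\<close> of the single increments.\<close>

lemma noise_square_moments:
  fixes t u :: real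
  assumes tu: "0 \<le> t" "t \<le> u"
  shows "integrable M (noise_square t u)" "expectation (noise_square t u) = m * (u - t)"
    "integrable M (\<lambda>\<omega>. (noise_square t u \<omega>)\<^sup>2)"
    "expectation (\<lambda>\<omega>. (noise_square t u \<omega>)\<^sup>2) \<le> 3 * m\<^sup>2 * (u - t)\<^sup>2"
proof -
  have mom: "integrable M (\<lambda>\<omega>. (W k u \<omega> - W k t \<omega>) ^ n)"
    "expectation (\<lambda>\<omega>. (W k u \<omega> - W k t \<omega>)\<^sup>2) = u - t"
    "expectation (\<lambda>\<omega>. (W k u \<omega> - W k t \<omega>) ^ 4) = 3 * (u - t)\<^sup>2" if "k \<in> {1..m}" for k n
    using wiener_increment_moments[OF wiener[OF that] tu] by auto
  show 1: "integrable M (noise_square t u)"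
    unfolding noise_square_def[abs_def] using mom(1) by (intro Bochner_Integration.integrable_sum) auto
  show "expectation (noise_square t u) = m * (u - t)"
    unfolding noise_square_def[abs_def] using mom(1,2) by (subst Bochner_Integration.integral_sum) auto
  have le: "(noise_square t u \<omega>)\<^sup>2 \<le> m * (\<Sum>k=1..m. (W k u \<omega> - W k t \<omega>) ^ 4)" for \<omega>
    using norm_sum_square_le[of "{1..m}" "\<lambda>k. (W k u \<omega> - W k t \<omega>)\<^sup>2"]
    by (simp add: noise_square_def power_mult[symmetric])
  have i: "integrable M (\<lambda>\<omega>. m * (\<Sum>k=1..m. (W k u \<omega> - W k t \<omega>) ^ 4))"
    using mom(1) by (intro integrable_mult_right Bochner_Integration.integrable_sum) auto
  show 2: "integrable M (\<lambda>\<omega>. (noise_square t u \<omega>)\<^sup>2)"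
    by (rule Bochner_Integration.integrable_bound[OF i])
       (use 1 le in \<open>auto intro!: AE_I2 intro: order_trans[OF _ abs_ge_self]\<close>)
  have "expectation (\<lambda>\<omega>. (noise_square t u \<omega>)\<^sup>2) \<le> expectation (\<lambda>\<omega>. m * (\<Sum>k=1..m. (W k u \<omega> - W k t \<omega>) ^ 4))"
    using 2 i le by (intro integral_mono) auto
  also have "\<dots> = m * (\<Sum>k=1..m. 3 * (u - t)\<^sup>2)"
    using mom(1,3) by (subst integral_mult_right_zero, subst Bochner_Integration.integral_sum) auto
  also have "\<dots> = 3 * m\<^sup>2 * (u - t)\<^sup>2" by (simp add: power2_eq_square)
  finally show "expectation (\<lambda>\<omega>. (noise_square t u \<omega>)\<^sup>2) \<le> 3 * m\<^sup>2 * (u - t)\<^sup>2" .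
qed

lemma noise_square_add_moment:
  fixes t h :: real
  assumes t: "0 \<le> t" and h: "0 \<le> h"
  shows "integrable M (\<lambda>\<omega>. (noise_square t (t + h) \<omega> + h)\<^sup>2)"
    "expectation (\<lambda>\<omega>. (noise_square t (t + h) \<omega> + h)\<^sup>2) \<le> (6 * m\<^sup>2 + 2) * h\<^sup>2"
proof -
  note mom = noise_square_moments[of t "t + h"]
  have tu: "0 \<le> t" "t \<le> t + h" using assms by auto
  show 1: "integrable M (\<lambda>\<omega>. (noise_square t (t + h) \<omega> + h)\<^sup>2)"
    using mom[OF tu] by (simp add: power2_sum)
  have "(noise_square t (t + h) \<omega> + h)\<^sup>2 \<le> 2 * (noise_square t (t + h) \<omega>)\<^sup>2 + 2 * h\<^sup>2" for \<omega>
    using norm_add_square_le[of "noise_square t (t + h) \<omega>" h] by simp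
  then have "expectation (\<lambda>\<omega>. (noise_square t (t + h) \<omega> + h)\<^sup>2) \<le> expectation (\<lambda>\<omega>. 2 * (noise_square t (t + h) \<omega>)\<^sup>2 + 2 * h\<^sup>2)"
    using 1 mom(3)[OF tu] by (intro integral_mono) auto
  also have "\<dots> = 2 * expectation (\<lambda>\<omega>. (noise_square t (t + h) \<omega>)\<^sup>2) + 2 * h\<^sup>2"
    using mom(3)[OF tu] by (simp add: prob_space)
  also have "\<dots> \<le> (6 * m\<^sup>2 + 2) * h\<^sup>2" using mom(4)[OF tu] by (simp add: algebra_simps)
  finally show "expectation (\<lambda>\<omega>. (noise_square t (t + h) \<omega> + h)\<^sup>2) \<le> (6 * m\<^sup>2 + 2) * h\<^sup>2" .
qed

text \<open>With weights built from the correction and the offset, this makes the correction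
  orthogonal to the past. Diagonal terms are centred by the variance, the others by independence of
  distinct Wiener processes.\<close>

lemma centred_products_orthogonal:
  fixes t u :: real
  assumes tu: "0 \<le> t" "t \<le> u"
    and Z: "\<And>k l. k \<in> {1..m} \<Longrightarrow> l \<in> {1..m} \<Longrightarrow> Z k l \<in> borel_measurable (F t)"
      "\<And>k l \<omega>. k \<in> {1..m} \<Longrightarrow> l \<in> {1..m} \<Longrightarrow> \<omega> \<in> space M \<Longrightarrow> \<bar>Z k l \<omega>\<bar> \<le> K"
  defines "S \<equiv> \<lambda>\<omega>. \<Sum>k=1..m. \<Sum>l=1..m. Z k l \<omega> * ((W k u \<omega> - W k t \<omega>) * (W l u \<omega> - W l t \<omega>) - (if k = l then u - t else 0))"
  shows "integrable M S" "expectation S = 0"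
proof -
  have kl: "integrable M (\<lambda>\<omega>. Z k l \<omega> * ((W k u \<omega> - W k t \<omega>) * (W l u \<omega> - W l t \<omega>) - (if k = l then u - t else 0)))
    \<and> expectation (\<lambda>\<omega>. Z k l \<omega> * ((W k u \<omega> - W k t \<omega>) * (W l u \<omega> - W l t \<omega>) - (if k = l then u - t else 0))) = 0"
    if k: "k \<in> {1..m}" and l: "l \<in> {1..m}" for k l
  proof (cases "k = l")
    case True
    have iZ: "integrable M (Z k l)"
      using integrable_bounded[OF measurable_F_M[OF tu(1) Z(1)[OF k l]] Z(2)[OF k l]] .
    note 2 = expectation_mult_increment(3,4)[OF wiener[OF k] tu Z(1)[OF k l] iZ]
    have eq: "Z k l \<omega> * ((W k u \<omega> - W k t \<omega>) * (W l u \<omega> - W l t \<omega>) - (if k = l then u - t else 0))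
      = Z k l \<omega> * (W k u \<omega> - W k t \<omega>)\<^sup>2 - Z k l \<omega> * (u - t)" for \<omega>
      using True by (simp add: power2_eq_square algebra_simps)
    show ?thesis unfolding eq using 2 iZ by simp
  next
    case False
    then show ?thesis
      using expectation_mult_independent_increments[OF wiener indep k l False tu Z(1)[OF k l] Z(2)[OF k l]]
      by simp
  qed
  show "integrable M S"
    unfolding S_def using kl by (intro Bochner_Integration.integrable_sum) auto
  show "expectation S = 0"
    unfolding S_def using kl
    by (subst Bochner_Integration.integral_sum; (intro Bochner_Integration.integrable_sum)?; simp)+
qed

lemma drift_increment_estimate:
  fixes t h :: real
  assumes t: "0 \<le> t" and h: "0 < h"
    and osc: "(\<integral>\<^sup>+\<omega>. (\<integral>\<^sup>+s\<in>{t..t + h}. ennreal ((norm (a s (X s \<omega>) \<omega> - a t (X t \<omega>) \<omega>))\<^sup>2) \<partial>lborel) \<partial>M) \<le> ennreal (e * h)"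
    and e: "0 \<le> e"
  defines "P \<equiv> \<lambda>\<omega>. (LINT s:{t..t + h}|lborel. a s (X s \<omega>) \<omega>) - h *\<^sub>R a t (X t \<omega>) \<omega>"
  shows "integrable M (\<lambda>\<omega>. (norm (P \<omega>))\<^sup>2)" "expectation (\<lambda>\<omega>. (norm (P \<omega>))\<^sup>2) \<le> e * h\<^sup>2"
proof -
  let ?osc = "\<lambda>\<omega>. (\<integral>\<^sup>+s\<in>{t..t + h}. ennreal ((norm (a s (X s \<omega>) \<omega> - a t (X t \<omega>) \<omega>))\<^sup>2) \<partial>lborel)"
  note am [measurable (raw)] = measurable_process_compose[OF regular_process[OF regular_a]]
  have atm [measurable]: "(\<lambda>\<omega>. a t (X t \<omega>) \<omega>) \<in> borel_measurable M"
    by (rule regular_measurable[OF regular_a t X_measurable[OF t]])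
  have a_eq: "indicator {t..t + h} s *\<^sub>R a s (X s \<omega>) \<omega> = indicator {t..t + h} s *\<^sub>R a (max 0 s) (X (max 0 s) \<omega>) \<omega>" for s \<omega>
    using t by (auto simp: indicator_def max_def)
  have a_eq2: "ennreal ((norm (a s (X s \<omega>) \<omega> - a t (X t \<omega>) \<omega>))\<^sup>2) * indicator {t..t + h} s
     = ennreal ((norm (a (max 0 s) (X (max 0 s) \<omega>) \<omega> - a t (X t \<omega>) \<omega>))\<^sup>2) * indicator {t..t + h} s" for s \<omega>
    using t by (auto simp: indicator_def max_def)
  have Pm [measurable]: "P \<in> borel_measurable M"
    unfolding P_def set_lebesgue_integral_def a_eq by measurable
  have "(\<integral>\<^sup>+\<omega>. ennreal ((norm (P \<omega>))\<^sup>2) \<partial>M) \<le> (\<integral>\<^sup>+\<omega>. ennreal h * ?osc \<omega> \<partial>M)"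
  proof (rule nn_integral_mono_AE)
    show "AE \<omega> in M. ennreal ((norm (P \<omega>))\<^sup>2) \<le> ennreal h * ?osc \<omega>"
      using regular_path_continuous[OF regular_a]
    proof eventually_elim
      case (elim \<omega>)
      have c: "continuous_on {t..t + h} (\<lambda>s. a s (X s \<omega>) \<omega>)"
        using elim t by (auto elim: continuous_on_subset)
      have "(LINT s:{t..t + h}|lborel. a s (X s \<omega>) \<omega> - a t (X t \<omega>) \<omega>)
        = (LINT s:{t..t + h}|lborel. a s (X s \<omega>) \<omega>) - (LINT s:{t..t + h}|lborel. a t (X t \<omega>) \<omega>)"
        using c by (intro set_integral_diff) (auto intro!: borel_integrable_atLeastAtMost')
      also have "(LINT s:{t..t + h}|lborel. a t (X t \<omega>) \<omega>) = h *\<^sub>R a t (X t \<omega>) \<omega>"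
        using h by (simp add: set_lebesgue_integral_def)
      finally have P: "P \<omega> = (LINT s:{t..t + h}|lborel. a s (X s \<omega>) \<omega> - a t (X t \<omega>) \<omega>)"
        by (simp add: P_def)
      have "ennreal ((norm (P \<omega>))\<^sup>2) \<le> ennreal ((t + h) - t) * ?osc \<omega>"
        unfolding P using c h by (intro set_integral_norm_square_le continuous_intros) auto
      then show ?case by simp
    qed
  qed
  also have "\<dots> = ennreal h * (\<integral>\<^sup>+\<omega>. ?osc \<omega> \<partial>M)"
    unfolding a_eq2 by (rule nn_integral_cmult) measurable
  also have "\<dots> \<le> ennreal h * ennreal (e * h)" by (intro mult_left_mono osc) auto
  also have "\<dots> = ennreal (e * h\<^sup>2)"
    using h e by (simp add: ennreal_mult[symmetric] power2_eq_square mult_ac)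
  finally have le: "(\<integral>\<^sup>+\<omega>. ennreal ((norm (P \<omega>))\<^sup>2) \<partial>M) \<le> ennreal (e * h\<^sup>2)" .
  then have "square_integrable M P"
    by (intro nn_integral_square_norm_finite_imp Pm) (auto intro: le_less_trans)
  then show i: "integrable M (\<lambda>\<omega>. (norm (P \<omega>))\<^sup>2)" by (simp add: square_integrable_def)
  then show "expectation (\<lambda>\<omega>. (norm (P \<omega>))\<^sup>2) \<le> e * h\<^sup>2"
    using le e by (simp add: nn_integral_eq_integral ennreal_le_iff)
qed

text \<open>The isometry yields only one power of \<open>h\<close>. That is enough, because the
  noise error enters the squared distance linearly with mean zero and otherwise through its
  square.\<close>

lemma noise_increment_estimate:
  fixes t h :: real
  assumes k: "k \<in> {1..m}" and Y: "ito_integral M F (W k) (\<lambda>s \<omega>. b k s (X s \<omega>) \<omega>) Y"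
    and t: "0 \<le> t" and h: "0 < h" and B: "B \<in> sets (F t)"
    and bd: "\<And>\<omega>. \<omega> \<in> B \<Longrightarrow> norm (X t \<omega>) \<le> K"
    and osc: "(\<integral>\<^sup>+\<omega>. (\<integral>\<^sup>+s\<in>{t..t + h}. ennreal ((norm (b k s (X s \<omega>) \<omega> - b k t (X t \<omega>) \<omega>))\<^sup>2) \<partial>lborel) \<partial>M) \<le> ennreal (e * h)"
    and e: "0 \<le> e"
  defines "N \<equiv> \<lambda>\<omega>. indicator B \<omega> *\<^sub>R (Y (t + h) \<omega> - Y t \<omega> - (W k (t + h) \<omega> - W k t \<omega>) *\<^sub>R b k t (X t \<omega>) \<omega>)"
  shows "integrable M (\<lambda>\<omega>. (norm (N \<omega>))\<^sup>2)" "expectation (\<lambda>\<omega>. (norm (N \<omega>))\<^sup>2) \<le> 6 * e * h"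
proof -
  have u: "0 \<le> t + h" "t \<le> t + h" using t h by auto
  \<comment> \<open>Truncation: the growth bound holds only almost surely, while heights of simple processes are bounded everywhere.\<close>
  define \<eta> where "\<eta> \<omega> = (if \<omega> \<in> B \<and> norm (b k t (X t \<omega>) \<omega>) \<le> C * (1 + K) then b k t (X t \<omega>) \<omega> else 0)" for \<omega>
  have bF [measurable]: "(\<lambda>\<omega>. b k t (X t \<omega>) \<omega>) \<in> borel_measurable (F t)"
    by (rule regular_measurable_F[OF regular_b[OF k] t X_measurable_F[OF t]])
  have \<eta>F: "\<eta> \<in> borel_measurable (F t)"
    unfolding \<eta>_def[abs_def] using B by measurable
  have \<eta>b: "norm (\<eta> \<omega>) \<le> \<bar>C * (1 + K)\<bar>" for \<omega> by (auto simp: \<eta>_def)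
  have \<eta>_eq: "AE \<omega> in M. \<omega> \<in> B \<longrightarrow> \<eta> \<omega> = b k t (X t \<omega>) \<omega>"
    using regular_growth[OF regular_b[OF k]]
  proof eventually_elim
    case (elim \<omega>)
    show ?case
    proof
      assume \<omega>: "\<omega> \<in> B"
      have "norm (b k t (X t \<omega>) \<omega>) \<le> C * (1 + norm (X t \<omega>))" using elim t by blast
      also have "\<dots> \<le> C * (1 + K)" using bd[OF \<omega>] C_nonneg by (intro mult_left_mono) auto
      finally show "\<eta> \<omega> = b k t (X t \<omega>) \<omega>" using \<omega> by (simp add: \<eta>_def)
    qed
  qed
  have N_eq: "AE \<omega> in M. N \<omega> = indicator B \<omega> *\<^sub>R (Y (t + h) \<omega> - Y t \<omega> - (W k (t + h) \<omega> - W k t \<omega>) *\<^sub>R \<eta> \<omega>)"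
    using \<eta>_eq by eventually_elim (auto simp: N_def indicator_def)
  have BM [measurable]: "B \<in> sets M" using B subalgebra_F[OF t] by (auto simp: subalgebra_def)
  have Nm [measurable]: "N \<in> borel_measurable M"
    using ito_integral_measurable[OF Y] u t wiener_measurable[OF wiener[OF k]] measurable_F_M[OF t bF]
    unfolding N_def by measurable
  have "(\<integral>\<^sup>+\<omega>. ennreal ((norm (N \<omega>))\<^sup>2) \<partial>M)
    = (\<integral>\<^sup>+\<omega>. ennreal ((norm (indicator B \<omega> *\<^sub>R (Y (t + h) \<omega> - Y t \<omega> - (W k (t + h) \<omega> - W k t \<omega>) *\<^sub>R \<eta> \<omega>)))\<^sup>2) \<partial>M)"
    by (rule nn_integral_cong_AE) (use N_eq in \<open>eventually_elim, simp\<close>)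
  also have "\<dots> \<le> 6 * (\<integral>\<^sup>+\<omega>. indicator B \<omega> * (\<integral>\<^sup>+s\<in>{t..t + h}. ennreal ((norm (b k s (X s \<omega>) \<omega> - \<eta> \<omega>))\<^sup>2) \<partial>lborel) \<partial>M)"
    by (rule ito_integral_increment_estimate[OF wiener[OF k] Y t u(2) B \<eta>F \<eta>b])
  also have "\<dots> \<le> 6 * (\<integral>\<^sup>+\<omega>. (\<integral>\<^sup>+s\<in>{t..t + h}. ennreal ((norm (b k s (X s \<omega>) \<omega> - b k t (X t \<omega>) \<omega>))\<^sup>2) \<partial>lborel) \<partial>M)"
    by (intro mult_left_mono nn_integral_mono_AE) (use \<eta>_eq in \<open>eventually_elim, auto simp: indicator_def\<close>)
  also have "\<dots> \<le> 6 * ennreal (e * h)" by (intro mult_left_mono osc) auto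
  also have "\<dots> = ennreal (6 * e * h)" using e h by (simp add: ennreal_mult mult.assoc)
  finally have le: "(\<integral>\<^sup>+\<omega>. ennreal ((norm (N \<omega>))\<^sup>2) \<partial>M) \<le> ennreal (6 * e * h)" .
  then have "square_integrable M N"
    by (intro nn_integral_square_norm_finite_imp Nm) (auto intro: le_less_trans)
  then show i: "integrable M (\<lambda>\<omega>. (norm (N \<omega>))\<^sup>2)" by (simp add: square_integrable_def)
  then show "expectation (\<lambda>\<omega>. (norm (N \<omega>))\<^sup>2) \<le> 6 * e * h"
    using le e h by (simp add: nn_integral_eq_integral ennreal_le_iff)
qed

lemma distance_integrable:
  assumes D: "D \<noteq> {}" and t: "0 \<le> t" and B: "B \<in> sets M"
  shows "integrable M (\<lambda>\<omega>. indicator B \<omega> * (infdist (X t \<omega>) D)\<^sup>2)"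
proof -
  obtain x0 where x0: "x0 \<in> D" using D by blast
  show ?thesis
  proof (rule Bochner_Integration.integrable_bound)
    show "integrable M (\<lambda>\<omega>. 2 * (norm (X t \<omega>))\<^sup>2 + 2 * (norm x0)\<^sup>2)"
      using X_square_integrable[OF t] by (simp add: square_integrable_def)
    have "(infdist y D)\<^sup>2 \<le> 2 * (norm y)\<^sup>2 + 2 * (norm x0)\<^sup>2" for y
    proof -
      have "(infdist y D)\<^sup>2 \<le> (norm (y - x0))\<^sup>2"
        using infdist_le[OF x0, of y] by (intro power_mono infdist_nonneg) (simp add: dist_norm)
      then show ?thesis using norm_add_square_le[of y "- x0"] by simp
    qed
    then show "AE \<omega> in M. norm (indicator B \<omega> * (infdist (X t \<omega>) D)\<^sup>2) \<le> norm (2 * (norm (X t \<omega>))\<^sup>2 + 2 * (norm x0)\<^sup>2)"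
      by (intro AE_I2) (auto simp: indicator_def)
    have [measurable]: "X t \<in> borel_measurable M" "B \<in> sets M" using X_measurable[OF t] B by auto
    note [measurable] = borel_measurable_infdist
    show "(\<lambda>\<omega>. indicator B \<omega> * (infdist (X t \<omega>) D)\<^sup>2) \<in> borel_measurable M" by measurable
  qed
qed

text \<open>The inequality of \<open>distance_square_step\<close> is used at almost every point of
  \<open>B\<close>, with \<open>\<xi>\<close> as foot point, and then integrated. The hypothesis
  \<open>near\<close> isolates the geometry, so that only moments are computed here. Each error
  carries \<open>e\<close>, \<open>\<epsilon>\<close> or a second factor \<open>h\<close>; the rate
  in front of the first expectation contains \<open>C\<close> and \<open>m\<close> only.\<close>

lemma Euler_step_estimate:
  fixes t h K0 K\<nu> KH K2 e \<epsilon> L Kc :: real and B :: "'w set" and D :: "(real ^ 'd) set"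
    and \<xi> \<nu> :: "'w \<Rightarrow> real ^ 'd" and H :: "'w \<Rightarrow> real ^ 'd ^ 'd"
  assumes t: "0 \<le> t" and h: "0 < h" "h \<le> 1" and B: "B \<in> sets (F t)"
    and \<xi>: "\<xi> \<in> borel_measurable (F t)" "\<And>\<omega>. \<omega> \<in> space M \<Longrightarrow> norm (\<xi> \<omega>) \<le> K0"
    and \<nu>: "\<nu> \<in> borel_measurable (F t)" "\<And>\<omega>. \<omega> \<in> space M \<Longrightarrow> norm (\<nu> \<omega>) \<le> K\<nu>"
    and H: "H \<in> borel_measurable (F t)" "\<And>\<omega>. \<omega> \<in> space M \<Longrightarrow> norm (H \<omega>) \<le> KH"
    and XB: "\<And>\<omega>. \<omega> \<in> B \<Longrightarrow> norm (X t \<omega>) \<le> K0" "\<And>\<omega>. \<omega> \<in> B \<Longrightarrow> norm (X t \<omega> - \<xi> \<omega>) \<le> K2"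
    and nonneg: "0 \<le> e" "0 \<le> \<epsilon>" "0 \<le> L" "0 \<le> K2" "D \<noteq> {}"
    and osc: "\<And>c. c = a \<or> c \<in> b ` {1..m} \<Longrightarrow>
      (\<integral>\<^sup>+\<omega>. (\<integral>\<^sup>+s\<in>{t..t + h}. ennreal ((norm (c s (X s \<omega>) \<omega> - c t (X t \<omega>) \<omega>))\<^sup>2) \<partial>lborel) \<partial>M) \<le> ennreal (e * h)"
    and near: "AE \<omega> in M. \<omega> \<in> B \<longrightarrow> (\<exists>p r. p \<in> D
        \<and> norm (p - (\<xi> \<omega> + h *\<^sub>R a t (\<xi> \<omega>) \<omega> + (\<Sum>k=1..m. (W k (t + h) \<omega> - W k t \<omega>) *\<^sub>R b k t (\<xi> \<omega>) \<omega>)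
            + ito_correction {1..m} (H \<omega>) (\<lambda>k. b k t (\<xi> \<omega>) \<omega>) h (\<lambda>k. W k (t + h) \<omega> - W k t \<omega>) *\<^sub>R \<nu> \<omega>)) \<le> r
        \<and> r \<le> \<epsilon> * (noise_square t (t + h) \<omega> + h) + L * (noise_square t (t + h) \<omega>)\<^sup>2
        \<and> r \<le> L * (noise_square t (t + h) \<omega> + h))"
  defines "Kc \<equiv> KH * (C * (1 + K0))\<^sup>2 * m\<^sup>2 * K\<nu>"
  shows "expectation (\<lambda>\<omega>. indicator B \<omega> * (infdist (X (t + h) \<omega>) D)\<^sup>2)
    \<le> (1 + (1 + 2 * C + 12 * C\<^sup>2 + 12 * m\<^sup>2 * C\<^sup>2) * h) * expectation (\<lambda>\<omega>. indicator B \<omega> * (norm (X t \<omega> - \<xi> \<omega>))\<^sup>2)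
      + h * (e * (13 + 72 * m\<^sup>2) + \<epsilon> * (2 * K2 * (m + 1))
          + h * ((6 * Kc\<^sup>2 + 2 * L\<^sup>2) * (6 * m\<^sup>2 + 2) + 6 * K2 * L * m\<^sup>2))"
proof -
  define u where "u = t + h"
  have u: "0 \<le> u" "t \<le> u" "u - t = h" using t h by (auto simp: u_def)
  obtain Y where Y: "\<forall>k\<in>{1..m}. ito_integral M F (W k) (\<lambda>s \<omega>. b k s (X s \<omega>) \<omega>) (Y k)"
    and inc: "AE \<omega> in M. X u \<omega> - X t \<omega> = (LINT s:{t..u}|lborel. a s (X s \<omega>) \<omega>) + (\<Sum>k=1..m. Y k u \<omega> - Y k t \<omega>)"
    using X_increment t u by blast
  have Yk: "ito_integral M F (W k) (\<lambda>s \<omega>. b k s (X s \<omega>) \<omega>) (Y k)" if "k \<in> {1..m}" for k using Y that by blast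
  obtain \<omega>0 where \<omega>0: "\<omega>0 \<in> space M" using not_empty by blast
  have K0: "0 \<le> K0" using \<xi>(2)[OF \<omega>0] norm_ge_zero order_trans by blast
  have K\<nu>: "0 \<le> K\<nu>" using \<nu>(2)[OF \<omega>0] norm_ge_zero order_trans by blast
  have KH: "0 \<le> KH" using H(2)[OF \<omega>0] norm_ge_zero order_trans by blast
  define Kb where "Kb = C * (1 + K0)"
  have Kb: "0 \<le> Kb" using C_nonneg K0 by (simp add: Kb_def)
  define w where "w k \<omega> = W k u \<omega> - W k t \<omega>" for k \<omega>
  define s where "s = noise_square t u"
  have s0: "0 \<le> s \<omega>" for \<omega> using noise_square_nonneg by (simp add: s_def)
  define Z where "Z \<omega> = indicator B \<omega> *\<^sub>R (X t \<omega> - \<xi> \<omega>)" for \<omega>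
  \<comment> \<open>Truncation at \<open>Kb\<close> bounds the coefficient for every \<omega>, as
    the orthogonality lemmas demand; by linear growth it changes nothing almost surely.\<close>
  define \<beta> where "\<beta> k \<omega> = (if norm (b k t (\<xi> \<omega>) \<omega>) \<le> Kb then b k t (\<xi> \<omega>) \<omega> else 0)" for k \<omega>
  define P where "P \<omega> = (LINT s:{t..u}|lborel. a s (X s \<omega>) \<omega>) - h *\<^sub>R a t (X t \<omega>) \<omega>" for \<omega>
  define N where "N k \<omega> = indicator B \<omega> *\<^sub>R (Y k u \<omega> - Y k t \<omega> - w k \<omega> *\<^sub>R b k t (X t \<omega>) \<omega>)" for k \<omega>
  \<comment> \<open>Chosen such that \<open>S3\<close> is the inner product of \<open>Z\<close> with
    the correction shift; the factor -1/2 is the one in \<open>ito_correction\<close>.\<close>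
  define \<kappa> where "\<kappa> k l \<omega> = - (1/2) * (\<beta> k \<omega> \<bullet> (H \<omega> *v \<beta> l \<omega>)) * (Z \<omega> \<bullet> \<nu> \<omega>)" for k l \<omega>
  have BF [measurable]: "B \<in> sets (F t)" by (rule B)
  have BM: "B \<in> sets M" using B subalgebra_F[OF t] by (auto simp: subalgebra_def)
  have Bsp: "B \<subseteq> space M" using sets.sets_into_space[OF BM] .
  have [measurable]: "X t \<in> borel_measurable (F t)" "\<xi> \<in> borel_measurable (F t)"
    "\<nu> \<in> borel_measurable (F t)" "H \<in> borel_measurable (F t)"
    using X_measurable_F[OF t] \<xi> \<nu> H by auto
  have ZF [measurable]: "Z \<in> borel_measurable (F t)" unfolding Z_def[abs_def] by measurable
  have Zb: "norm (Z \<omega>) \<le> K2" for \<omega> using XB(2) nonneg by (auto simp: Z_def indicator_def)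
  have \<beta>F [measurable]: "\<beta> k \<in> borel_measurable (F t)" if "k \<in> {1..m}" for k
  proof -
    have [measurable]: "(\<lambda>\<omega>. b k t (\<xi> \<omega>) \<omega>) \<in> borel_measurable (F t)"
      by (rule regular_measurable_F[OF regular_b[OF that] t \<xi>(1)])
    show ?thesis unfolding \<beta>_def[abs_def] by measurable
  qed
  have \<beta>b: "norm (\<beta> k \<omega>) \<le> Kb" for k \<omega> using Kb by (auto simp: \<beta>_def)
  have \<beta>_eq: "AE \<omega> in M. \<forall>k\<in>{1..m}. \<beta> k \<omega> = b k t (\<xi> \<omega>) \<omega>"
  proof (rule AE_ball_countable[THEN iffD2]; (intro ballI)?)
    fix k assume k: "k \<in> {1..m}"
    show "AE \<omega> in M. \<beta> k \<omega> = b k t (\<xi> \<omega>) \<omega>"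
      using regular_growth[OF regular_b[OF k]] AE_space
    proof eventually_elim
      case (elim \<omega>)
      have "norm (b k t (\<xi> \<omega>) \<omega>) \<le> C * (1 + norm (\<xi> \<omega>))" using elim t by blast
      also have "\<dots> \<le> Kb" unfolding Kb_def using \<xi>(2)[OF elim(2)] C_nonneg by (intro mult_left_mono) auto
      finally show ?case by (simp add: \<beta>_def)
    qed
  qed auto
  have \<kappa>F: "\<kappa> k l \<in> borel_measurable (F t)" if "k \<in> {1..m}" "l \<in> {1..m}" for k l
  proof -
    have "continuous_on UNIV (\<lambda>p. fst p *v snd p :: real ^ 'd)" for p :: "real ^ 'd ^ 'd \<times> real ^ 'd"
      unfolding matrix_vector_mult_def by (intro continuous_intros)
    then have "(\<lambda>p. fst p *v snd p :: real ^ 'd) \<in> borel_measurable borel"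
      by (intro borel_measurable_continuous_onI) auto
    moreover have "(\<lambda>\<omega>. (H \<omega>, \<beta> l \<omega>)) \<in> borel_measurable (F t)" using that by measurable
    ultimately have "(\<lambda>\<omega>. (\<lambda>p. fst p *v snd p) (H \<omega>, \<beta> l \<omega>)) \<in> borel_measurable (F t)"
      by (rule measurable_compose[rotated])
    then have [measurable]: "(\<lambda>\<omega>. H \<omega> *v \<beta> l \<omega>) \<in> borel_measurable (F t)" by simp
    show ?thesis unfolding \<kappa>_def[abs_def] using that by measurable
  qed
  have \<kappa>b: "\<bar>\<kappa> k l \<omega>\<bar> \<le> KH * Kb * Kb * (K2 * K\<nu>)" if \<omega>: "\<omega> \<in> space M" for k l \<omega>
  proof -
    have "\<bar>\<beta> k \<omega> \<bullet> (H \<omega> *v \<beta> l \<omega>)\<bar> \<le> norm (H \<omega>) * norm (\<beta> k \<omega>) * norm (\<beta> l \<omega>)" by (rule abs_quadratic_form_le)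
    also have "\<dots> \<le> KH * Kb * Kb" using H(2)[OF \<omega>] \<beta>b KH Kb by (intro mult_mono) auto
    finally have 1: "\<bar>\<beta> k \<omega> \<bullet> (H \<omega> *v \<beta> l \<omega>)\<bar> \<le> KH * Kb * Kb" .
    have "\<bar>Z \<omega> \<bullet> \<nu> \<omega>\<bar> \<le> norm (Z \<omega>) * norm (\<nu> \<omega>)" by (rule Cauchy_Schwarz_ineq2)
    also have "\<dots> \<le> K2 * K\<nu>" using Zb \<nu>(2)[OF \<omega>] nonneg by (intro mult_mono) auto
    finally have 2: "\<bar>Z \<omega> \<bullet> \<nu> \<omega>\<bar> \<le> K2 * K\<nu>" .
    have "\<bar>\<kappa> k l \<omega>\<bar> \<le> \<bar>\<beta> k \<omega> \<bullet> (H \<omega> *v \<beta> l \<omega>)\<bar> * \<bar>Z \<omega> \<bullet> \<nu> \<omega>\<bar>"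
      by (simp add: \<kappa>_def abs_mult)
    also have "\<dots> \<le> KH * Kb * Kb * (K2 * K\<nu>)" using 1 2 KH Kb by (intro mult_mono) auto
    finally show ?thesis .
  qed
  \<comment> \<open>\<open>S1\<close>, \<open>S2\<close>, \<open>S3\<close> are the terms linear in \<open>Z\<close> with mean zero; \<open>S4\<close>, \<open>S5\<close> and \<open>P\<close> enter quadratically.\<close>
  define S1 where "S1 \<omega> = (\<Sum>k=1..m. Z \<omega> \<bullet> (Y k u \<omega> - Y k t \<omega>))" for \<omega>
  define S2 where "S2 \<omega> = (\<Sum>k=1..m. (Z \<omega> \<bullet> \<beta> k \<omega>) * w k \<omega>)" for \<omega>
  define S3 where "S3 \<omega> = (\<Sum>k=1..m. \<Sum>l=1..m. \<kappa> k l \<omega> * (w k \<omega> * w l \<omega> - (if k = l then u - t else 0)))" for \<omega>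
  define S4 where "S4 \<omega> = (\<Sum>k=1..m. (norm (N k \<omega>))\<^sup>2)" for \<omega>
  define S5 where "S5 \<omega> = (\<Sum>k=1..m. (norm (Z \<omega>))\<^sup>2 * (w k \<omega>)\<^sup>2)" for \<omega>
  have sqZ: "square_integrable M Z"
    using square_integrable_bounded[OF measurable_F_M[OF t ZF] Zb] .
  have iZ: "integrable M (\<lambda>\<omega>. (norm (Z \<omega>))\<^sup>2)" using sqZ by (simp add: square_integrable_def)
  have S1: "integrable M S1" "expectation S1 = 0"
  proof -
    note o = ito_integral_increment_orthogonal[OF wiener Yk t u(2) ZF Zb]
    show "integrable M S1" unfolding S1_def[abs_def] using o(1) by (intro Bochner_Integration.integrable_sum) auto
    show "expectation S1 = 0" unfolding S1_def[abs_def] using o by (subst Bochner_Integration.integral_sum) auto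
  qed
  have S2: "integrable M S2" "expectation S2 = 0"
  proof -
    have o: "integrable M (\<lambda>\<omega>. (Z \<omega> \<bullet> \<beta> k \<omega>) * w k \<omega>) \<and> expectation (\<lambda>\<omega>. (Z \<omega> \<bullet> \<beta> k \<omega>) * w k \<omega>) = 0"
      if k: "k \<in> {1..m}" for k
    proof -
      have m: "(\<lambda>\<omega>. Z \<omega> \<bullet> \<beta> k \<omega>) \<in> borel_measurable (F t)" using k by measurable
      have "\<bar>Z \<omega> \<bullet> \<beta> k \<omega>\<bar> \<le> K2 * Kb" for \<omega>
        using Cauchy_Schwarz_ineq2[of "Z \<omega>" "\<beta> k \<omega>"] Zb \<beta>b by (meson mult_mono norm_ge_zero order_trans)
      then have "integrable M (\<lambda>\<omega>. Z \<omega> \<bullet> \<beta> k \<omega>)" using measurable_F_M[OF t m] by (intro integrable_bounded) auto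
      then show ?thesis unfolding w_def using expectation_mult_increment(1,2)[OF wiener[OF k] t u(2) m] by blast
    qed
    show "integrable M S2" unfolding S2_def[abs_def] using o by (intro Bochner_Integration.integrable_sum) auto
    show "expectation S2 = 0" unfolding S2_def[abs_def] using o by (subst Bochner_Integration.integral_sum) auto
  qed
  have S3: "integrable M S3" "expectation S3 = 0"
    using centred_products_orthogonal[OF t u(2) \<kappa>F \<kappa>b] unfolding S3_def w_def by auto
  have N: "integrable M (\<lambda>\<omega>. (norm (N k \<omega>))\<^sup>2)" "expectation (\<lambda>\<omega>. (norm (N k \<omega>))\<^sup>2) \<le> 6 * e * h"
    if k: "k \<in> {1..m}" for k
    using noise_increment_estimate[OF k Yk[OF k] t h(1) B XB(1) osc[OF disjI2[OF imageI[OF k]]] nonneg(1)]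
    unfolding N_def w_def u_def by auto
  have S4: "integrable M S4" "expectation S4 \<le> m * (6 * e * h)"
  proof -
    show "integrable M S4" unfolding S4_def[abs_def] using N(1) by (intro Bochner_Integration.integrable_sum) auto
    have "expectation S4 = (\<Sum>k=1..m. expectation (\<lambda>\<omega>. (norm (N k \<omega>))\<^sup>2))"
      unfolding S4_def[abs_def] using N(1) by (intro Bochner_Integration.integral_sum) auto
    also have "\<dots> \<le> (\<Sum>k=1..m. 6 * e * h)" using N(2) by (intro sum_mono) auto
    finally show "expectation S4 \<le> m * (6 * e * h)" by simp
  qed
  have S5: "integrable M S5" "expectation S5 = m * (expectation (\<lambda>\<omega>. (norm (Z \<omega>))\<^sup>2) * h)"
  proof -
    have o: "integrable M (\<lambda>\<omega>. (norm (Z \<omega>))\<^sup>2 * (w k \<omega>)\<^sup>2)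
        \<and> expectation (\<lambda>\<omega>. (norm (Z \<omega>))\<^sup>2 * (w k \<omega>)\<^sup>2) = expectation (\<lambda>\<omega>. (norm (Z \<omega>))\<^sup>2) * h"
      if k: "k \<in> {1..m}" for k
      using expectation_mult_increment(3,4)[OF wiener[OF k] t u(2) _ iZ] unfolding w_def u(3)[symmetric] by auto
    show "integrable M S5" unfolding S5_def[abs_def] using o by (intro Bochner_Integration.integrable_sum) auto
    show "expectation S5 = m * (expectation (\<lambda>\<omega>. (norm (Z \<omega>))\<^sup>2) * h)"
      unfolding S5_def[abs_def] using o by (subst Bochner_Integration.integral_sum) auto
  qed
  have P: "integrable M (\<lambda>\<omega>. (norm (P \<omega>))\<^sup>2)" "expectation (\<lambda>\<omega>. (norm (P \<omega>))\<^sup>2) \<le> e * h\<^sup>2"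
    using drift_increment_estimate[OF t h(1) osc[OF disjI1[OF refl]] nonneg(1)] unfolding P_def u_def by auto
  have s: "integrable M s" "expectation s = m * h" "integrable M (\<lambda>\<omega>. (s \<omega>)\<^sup>2)"
    "expectation (\<lambda>\<omega>. (s \<omega>)\<^sup>2) \<le> 3 * m\<^sup>2 * h\<^sup>2"
    using noise_square_moments[OF t u(2)] unfolding s_def u(3) by auto
  have sh: "integrable M (\<lambda>\<omega>. (s \<omega> + h)\<^sup>2)" "expectation (\<lambda>\<omega>. (s \<omega> + h)\<^sup>2) \<le> (6 * m\<^sup>2 + 2) * h\<^sup>2"
    using noise_square_add_moment[OF t less_imp_le[OF h(1)]] unfolding s_def u_def by auto
  \<comment> \<open>An integrable majorant of the squared distance on \<open>B\<close>. Off
    \<open>B\<close> all terms with \<open>Z\<close> vanish and what remains is nonnegative, so it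
    dominates there as well.\<close>
  define R where "R \<omega> = (1 + h + 2 * h * C + 12 * h\<^sup>2 * C\<^sup>2) * (norm (Z \<omega>))\<^sup>2 + (1 / h + 12) * (norm (P \<omega>))\<^sup>2
      + 2 * S1 \<omega> - 2 * S2 \<omega> - 2 * S3 \<omega> + 12 * m * S4 \<omega> + 12 * m * C\<^sup>2 * S5 \<omega>
      + (6 * Kc\<^sup>2 + 2 * L\<^sup>2) * (s \<omega> + h)\<^sup>2 + 2 * K2 * (\<epsilon> * (s \<omega> + h) + L * (s \<omega>)\<^sup>2)" for \<omega>
  have iR: "integrable M R"
    unfolding R_def[abs_def] using iZ P S1 S2 S3 S4 S5 s sh by simp
  have Lip: "AE \<omega> in M. (\<forall>x y. norm (a t x \<omega> - a t y \<omega>) \<le> C * norm (x - y))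
      \<and> (\<forall>k\<in>{1..m}. \<forall>x y. norm (b k t x \<omega> - b k t y \<omega>) \<le> C * norm (x - y))"
  proof -
    have 1: "AE \<omega> in M. \<forall>x y. norm (c t x \<omega> - c t y \<omega>) \<le> C * norm (x - y)" if "regular_coefficient c" for c
    proof -
      have "AE \<omega> in M. \<forall>t\<ge>0. \<forall>x y. norm (c t x \<omega> - c t y \<omega>) \<le> C * norm (x - y)"
        using that by (auto simp: regular_coefficient_def elim!: eventually_mono)
      then show ?thesis by eventually_elim (use t in blast)
    qed
    have "AE \<omega> in M. \<forall>k\<in>{1..m}. \<forall>x y. norm (b k t x \<omega> - b k t y \<omega>) \<le> C * norm (x - y)"
      using 1[OF regular_b] by (intro AE_ball_countable[THEN iffD2]) auto
    then show ?thesis using 1[OF regular_a] by eventually_elim blast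
  qed
  have pointwise: "AE \<omega> in M. indicator B \<omega> * (infdist (X u \<omega>) D)\<^sup>2 \<le> R \<omega>"
    using near inc \<beta>_eq Lip
  proof eventually_elim
    case (elim \<omega>)
    show ?case
    proof (cases "\<omega> \<in> B")
      case True
      then have \<omega>: "\<omega> \<in> space M" using Bsp by blast
      have bk: "b k t (\<xi> \<omega>) \<omega> = \<beta> k \<omega>" if "k \<in> {1..m}" for k using elim(3) that by simp
      have ic: "ito_correction {1..m} (H \<omega>) (\<lambda>k. b k t (\<xi> \<omega>) \<omega>) h (\<lambda>k. W k (t + h) \<omega> - W k t \<omega>)
          = ito_correction {1..m} (H \<omega>) (\<lambda>k. \<beta> k \<omega>) h (\<lambda>k. w k \<omega>)"
        unfolding ito_correction_def w_def u_def using bk by (intro arg_cong2[where f="(*)"] sum.cong refl) auto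
      define q where "q = ito_correction {1..m} (H \<omega>) (\<lambda>k. \<beta> k \<omega>) h (\<lambda>k. w k \<omega>)"
      define N' where "N' = (\<Sum>k=1..m. Y k u \<omega> - Y k t \<omega> - w k \<omega> *\<^sub>R \<beta> k \<omega>)"
      define P' where "P' = (LINT s:{t..u}|lborel. a s (X s \<omega>) \<omega>) - h *\<^sub>R a t (\<xi> \<omega>) \<omega>"
      define z where "z = X t \<omega> - \<xi> \<omega>"
      have zZ: "Z \<omega> = z" using True by (simp add: Z_def z_def)
      define ctr where "ctr = \<xi> \<omega> + h *\<^sub>R a t (\<xi> \<omega>) \<omega> + (\<Sum>k=1..m. w k \<omega> *\<^sub>R \<beta> k \<omega>) + q *\<^sub>R \<nu> \<omega>"
      have sum_eq: "(\<Sum>k=1..m. (W k (t + h) \<omega> - W k t \<omega>) *\<^sub>R b k t (\<xi> \<omega>) \<omega>) = (\<Sum>k=1..m. w k \<omega> *\<^sub>R \<beta> k \<omega>)"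
        using bk by (intro sum.cong refl) (simp add: w_def u_def)
      have "\<exists>p r. p \<in> D \<and> norm (p - ctr) \<le> r \<and> r \<le> \<epsilon> * (s \<omega> + h) + L * (s \<omega>)\<^sup>2 \<and> r \<le> L * (s \<omega> + h)"
        using mp[OF elim(1) True] unfolding ic sum_eq q_def[symmetric] ctr_def[symmetric]
        unfolding s_def u_def .
      then obtain p r where p: "p \<in> D" "norm (p - ctr) \<le> r"
        "r \<le> \<epsilon> * (s \<omega> + h) + L * (s \<omega>)\<^sup>2" "r \<le> L * (s \<omega> + h)"
        by blast
      have r0: "0 \<le> r" using p(2) norm_ge_zero order_trans by blast
      have "N' = (\<Sum>k=1..m. Y k u \<omega> - Y k t \<omega>) - (\<Sum>k=1..m. w k \<omega> *\<^sub>R \<beta> k \<omega>)"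
        by (simp add: N'_def sum_subtractf)
      then have "X u \<omega> - ctr = z + (P' + N' - q *\<^sub>R \<nu> \<omega>)"
        using elim(2) by (simp add: z_def P'_def ctr_def algebra_simps)
      moreover have "infdist (X u \<omega>) D \<le> norm (X u \<omega> - p)"
        using infdist_le[OF p(1), of "X u \<omega>"] by (simp add: dist_norm)
      moreover have "norm (X u \<omega> - p) \<le> norm (X u \<omega> - ctr) + norm (p - ctr)"
        using norm_triangle_ineq4[of "X u \<omega> - ctr" "p - ctr"] by simp
      ultimately have "infdist (X u \<omega>) D \<le> norm (z + (P' + N' - q *\<^sub>R \<nu> \<omega>)) + r"
        using p(2) by simp
      note step = distance_square_step[OF infdist_nonneg r0 this]
      have zr: "2 * norm z * r \<le> 2 * K2 * (\<epsilon> * (s \<omega> + h) + L * (s \<omega>)\<^sup>2)"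
        using Zb[of \<omega>] p(3) r0 nonneg unfolding zZ by (intro mult_mono) auto
      have rr: "2 * r\<^sup>2 \<le> 2 * L\<^sup>2 * (s \<omega> + h)\<^sup>2"
        using power_mono[OF p(4) r0, of 2] by (simp add: power_mult_distrib)
      define g where "g = a t (X t \<omega>) \<omega> - a t (\<xi> \<omega>) \<omega>"
      have g: "norm g \<le> C * norm z" using elim(4) by (simp add: g_def z_def)
      have P': "P' = P \<omega> + h *\<^sub>R g" by (simp add: P'_def P_def g_def algebra_simps)
      \<comment> \<open>Young's inequality with weight \<open>h\<close>: the offset pays
        \<open>h\<close> times its square, which joins the growth rate, and the drift error pays
        \<open>1 / h\<close>, affordable as its mean square is at most
        \<open>e * h\<^sup>2\<close>.\<close>
      have zP: "2 * (z \<bullet> P') \<le> h * (norm z)\<^sup>2 + 1 / h * (norm (P \<omega>))\<^sup>2 + 2 * h * C * (norm z)\<^sup>2"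
      proof -
        have "z \<bullet> P \<omega> \<le> norm z * norm (P \<omega>)" by (rule norm_cauchy_schwarz)
        moreover have "2 * (norm z * norm (P \<omega>)) \<le> h * (norm z)\<^sup>2 + 1 / h * (norm (P \<omega>))\<^sup>2"
        proof -
          have "0 \<le> (h * norm z - norm (P \<omega>))\<^sup>2 / h" using h by simp
          also have "\<dots> = h * (norm z)\<^sup>2 + 1 / h * (norm (P \<omega>))\<^sup>2 - 2 * (norm z * norm (P \<omega>))"
            using h by (simp add: power2_diff field_simps power2_eq_square)
          finally show ?thesis by simp
        qed
        moreover have "z \<bullet> g \<le> C * (norm z)\<^sup>2"
          using order_trans[OF norm_cauchy_schwarz[of z g] mult_left_mono[OF g norm_ge_zero[of z]]]
          by (simp add: power2_eq_square mult_ac)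
        then have "2 * h * (z \<bullet> g) \<le> 2 * h * (C * (norm z)\<^sup>2)" using h by (intro mult_left_mono) auto
        ultimately show ?thesis unfolding P' by (simp add: inner_add_right)
      qed
      have PP: "6 * (norm P')\<^sup>2 \<le> 12 * (norm (P \<omega>))\<^sup>2 + 12 * h\<^sup>2 * C\<^sup>2 * (norm z)\<^sup>2"
      proof -
        have "(norm (h *\<^sub>R g))\<^sup>2 \<le> (h * (C * norm z))\<^sup>2"
          using g h by (intro power_mono) (auto intro!: mult_left_mono)
        then show ?thesis using norm_add_square_le[of "P \<omega>" "h *\<^sub>R g"] unfolding P'
          by (simp add: power_mult_distrib)
      qed
      have zN: "2 * (z \<bullet> N') = 2 * S1 \<omega> - 2 * S2 \<omega>"
        by (simp add: N'_def S1_def S2_def zZ inner_sum_right inner_diff_right sum_subtractf mult.commute)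
      have NN: "6 * (norm N')\<^sup>2 \<le> 12 * m * S4 \<omega> + 12 * m * C\<^sup>2 * S5 \<omega>"
      proof -
        \<comment> \<open>The noise error relative to \<open>\<xi>\<close> splits into the freezing
          error \<open>N k\<close> and the Lipschitz difference between \<open>X t\<close> and
          \<open>\<xi>\<close>; the latter is proportional to the offset and feeds the growth rate
          through \<open>S5\<close>.\<close>
        have "(norm (Y k u \<omega> - Y k t \<omega> - w k \<omega> *\<^sub>R \<beta> k \<omega>))\<^sup>2
            \<le> 2 * (norm (N k \<omega>))\<^sup>2 + 2 * C\<^sup>2 * ((norm (Z \<omega>))\<^sup>2 * (w k \<omega>)\<^sup>2)" if k: "k \<in> {1..m}" for k
        proof -
          have "norm (b k t (X t \<omega>) \<omega> - \<beta> k \<omega>) \<le> C * norm z"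
            using elim(4) k bk[OF k] unfolding z_def by metis
          then have "(norm (w k \<omega> *\<^sub>R (b k t (X t \<omega>) \<omega> - \<beta> k \<omega>)))\<^sup>2 \<le> (\<bar>w k \<omega>\<bar> * (C * norm z))\<^sup>2"
            by (intro power_mono) (auto intro!: mult_left_mono)
          then show ?thesis
            using norm_add_square_le[of "N k \<omega>" "w k \<omega> *\<^sub>R (b k t (X t \<omega>) \<omega> - \<beta> k \<omega>)"] True
            by (simp add: N_def zZ power_mult_distrib algebra_simps)
        qed
        then have "(\<Sum>k=1..m. (norm (Y k u \<omega> - Y k t \<omega> - w k \<omega> *\<^sub>R \<beta> k \<omega>))\<^sup>2)
            \<le> (\<Sum>k=1..m. 2 * (norm (N k \<omega>))\<^sup>2 + 2 * C\<^sup>2 * ((norm (Z \<omega>))\<^sup>2 * (w k \<omega>)\<^sup>2))"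
          by (intro sum_mono)
        also have "\<dots> = 2 * S4 \<omega> + 2 * C\<^sup>2 * S5 \<omega>"
          by (simp add: S4_def S5_def sum.distrib sum_distrib_left)
        finally have "m * (\<Sum>k=1..m. (norm (Y k u \<omega> - Y k t \<omega> - w k \<omega> *\<^sub>R \<beta> k \<omega>))\<^sup>2) \<le> m * (2 * S4 \<omega> + 2 * C\<^sup>2 * S5 \<omega>)"
          by (intro mult_left_mono) auto
        then have "(norm N')\<^sup>2 \<le> m * (2 * S4 \<omega> + 2 * C\<^sup>2 * S5 \<omega>)"
          using norm_sum_square_le[of "{1..m}" "\<lambda>k. Y k u \<omega> - Y k t \<omega> - w k \<omega> *\<^sub>R \<beta> k \<omega>"] by (simp add: N'_def)
        then show ?thesis by (simp add: algebra_simps)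
      qed
      have zQ: "2 * (z \<bullet> (q *\<^sub>R \<nu> \<omega>)) = 2 * S3 \<omega>"
        unfolding S3_def \<kappa>_def zZ q_def ito_correction_def u(3)
        by (simp add: sum_distrib_left sum_distrib_right mult_ac)
      have QQ: "6 * (norm (q *\<^sub>R \<nu> \<omega>))\<^sup>2 \<le> 6 * Kc\<^sup>2 * (s \<omega> + h)\<^sup>2"
      proof -
        have "\<bar>q\<bar> \<le> KH * Kb\<^sup>2 * (card {1..m})\<^sup>2 * ((\<Sum>k=1..m. (w k \<omega>)\<^sup>2) + h)"
          unfolding q_def using h H(2)[OF \<omega>] \<beta>b by (intro abs_ito_correction_le) auto
        then have "\<bar>q\<bar> \<le> KH * Kb\<^sup>2 * m\<^sup>2 * (s \<omega> + h)" by (simp add: s_def noise_square_def w_def)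
        then have "\<bar>q\<bar> * norm (\<nu> \<omega>) \<le> (KH * Kb\<^sup>2 * m\<^sup>2 * (s \<omega> + h)) * K\<nu>"
          using \<nu>(2)[OF \<omega>] KH s0[of \<omega>] h by (intro mult_mono) auto
        also have "\<dots> = Kc * (s \<omega> + h)" by (simp add: Kc_def Kb_def mult_ac)
        finally have "(norm (q *\<^sub>R \<nu> \<omega>))\<^sup>2 \<le> (Kc * (s \<omega> + h))\<^sup>2" by (intro power_mono) auto
        then show ?thesis by (simp add: power_mult_distrib)
      qed
      have "(infdist (X u \<omega>) D)\<^sup>2 \<le> R \<omega>"
      proof -
        have "R \<omega> = (norm z)\<^sup>2 + (h * (norm z)\<^sup>2 + 1 / h * (norm (P \<omega>))\<^sup>2 + 2 * h * C * (norm z)\<^sup>2)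
          + (2 * S1 \<omega> - 2 * S2 \<omega>) - 2 * S3 \<omega> + (12 * (norm (P \<omega>))\<^sup>2 + 12 * h\<^sup>2 * C\<^sup>2 * (norm z)\<^sup>2)
          + (12 * m * S4 \<omega> + 12 * m * C\<^sup>2 * S5 \<omega>) + 6 * Kc\<^sup>2 * (s \<omega> + h)\<^sup>2
          + 2 * K2 * (\<epsilon> * (s \<omega> + h) + L * (s \<omega>)\<^sup>2) + 2 * L\<^sup>2 * (s \<omega> + h)\<^sup>2"
          unfolding R_def zZ distrib_right by linarith
        then show ?thesis using step zr rr zP PP zN NN zQ QQ by linarith
      qed
      then show ?thesis using True by simp
    next
      case False
      then have "Z \<omega> = 0" by (simp add: Z_def)
      then have "S1 \<omega> = 0" "S2 \<omega> = 0" "S3 \<omega> = 0" "S5 \<omega> = 0"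
        by (simp_all add: S1_def S2_def S3_def S5_def \<kappa>_def)
      moreover have "0 \<le> S4 \<omega>" by (auto simp: S4_def intro: sum_nonneg)
      ultimately have "0 \<le> R \<omega>"
        unfolding R_def using \<open>Z \<omega> = 0\<close> s0[of \<omega>] nonneg h by (simp add: add_nonneg_nonneg)
      then show ?thesis using False by simp
    qed
  qed
  note idist = distance_integrable[OF nonneg(5) u(1) BM]
  define z2 where "z2 = expectation (\<lambda>\<omega>. (norm (Z \<omega>))\<^sup>2)"
  have z2: "0 \<le> z2" by (simp add: z2_def)
  have "z2 = expectation (\<lambda>\<omega>. indicator B \<omega> * (norm (X t \<omega> - \<xi> \<omega>))\<^sup>2)"
    unfolding z2_def Z_def by (intro Bochner_Integration.integral_cong) (auto simp: indicator_def)
  moreover have "expectation (\<lambda>\<omega>. indicator B \<omega> * (infdist (X u \<omega>) D)\<^sup>2) \<le> expectation R"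
    using idist iR pointwise by (rule integral_mono_AE)
  moreover have "expectation R = (1 + h + 2 * h * C + 12 * h\<^sup>2 * C\<^sup>2) * z2
      + (1 / h + 12) * expectation (\<lambda>\<omega>. (norm (P \<omega>))\<^sup>2) + 12 * m * expectation S4
      + 12 * m * C\<^sup>2 * (m * (z2 * h)) + (6 * Kc\<^sup>2 + 2 * L\<^sup>2) * expectation (\<lambda>\<omega>. (s \<omega> + h)\<^sup>2)
      + 2 * K2 * (\<epsilon> * (m * h + h) + L * expectation (\<lambda>\<omega>. (s \<omega>)\<^sup>2))"
    unfolding R_def[abs_def] z2_def
    using iZ P(1) S1 S2 S3 S4(1) S5 s(1,2,3) sh(1) by (simp add: prob_space)
  \<comment> \<open>With \<open>h \<le> 1\<close> the two parts \<open>e * h\<close> and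
    \<open>12 * e * h\<^sup>2\<close> merge into 13 times \<open>e * h\<close>; the 72 in the
    conclusion is 12 times the 6 of the noise estimate.\<close>
  moreover have "(1 / h + 12) * expectation (\<lambda>\<omega>. (norm (P \<omega>))\<^sup>2) \<le> 13 * e * h"
  proof -
    have "(1 / h + 12) * expectation (\<lambda>\<omega>. (norm (P \<omega>))\<^sup>2) \<le> (1 / h + 12) * (e * h\<^sup>2)"
      using P(2) h by (intro mult_left_mono) auto
    also have "\<dots> = e * h + 12 * (e * h) * h" using h by (simp add: field_simps power2_eq_square)
    also have "12 * (e * h) * h \<le> 12 * (e * h) * 1" using h nonneg by (intro mult_left_mono) auto
    finally show ?thesis by simp
  qed
  moreover have "12 * m * expectation S4 \<le> 12 * m * (m * (6 * e * h))"
    by (intro mult_left_mono S4(2)) auto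
  moreover have "(6 * Kc\<^sup>2 + 2 * L\<^sup>2) * expectation (\<lambda>\<omega>. (s \<omega> + h)\<^sup>2) \<le> (6 * Kc\<^sup>2 + 2 * L\<^sup>2) * ((6 * m\<^sup>2 + 2) * h\<^sup>2)"
    by (intro mult_left_mono sh(2)) auto
  moreover have "2 * K2 * (\<epsilon> * (m * h + h) + L * expectation (\<lambda>\<omega>. (s \<omega>)\<^sup>2))
      \<le> 2 * K2 * (\<epsilon> * (m * h + h) + L * (3 * m\<^sup>2 * h\<^sup>2))"
    using nonneg s(4) by (intro mult_left_mono add_left_mono) auto
  moreover have "12 * h\<^sup>2 * C\<^sup>2 * z2 \<le> 12 * h * C\<^sup>2 * z2"
    using h z2 by (intro mult_right_mono) (auto simp: power2_eq_square mult_left_le)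
  ultimately show ?thesis
    unfolding u_def[symmetric] by (simp add: algebra_simps power2_eq_square)
qed

end

locale viable_sde = random_coefficient_sde M F m W a b C X0 X
  for M :: "'w measure" and F and m and W
    and a :: "real \<Rightarrow> real ^ 'd \<Rightarrow> 'w \<Rightarrow> real ^ 'd" and b and C and X0 and X +
  fixes \<phi> :: "real ^ 'd \<Rightarrow> real" and D :: "(real ^ 'd) set"
  assumes \<phi>_C2: "C2 \<phi>"
    and \<phi>_grad: "\<And>x. \<phi> x = 0 \<Longrightarrow> gradient \<phi> x \<noteq> 0"
    and D_def: "D = {x. \<phi> x \<ge> 0}"
    and D_nonempty: "D \<noteq> {}"
    and X0_in_D: "AE \<omega> in M. X0 \<omega> \<in> D"
    and V1: "AE \<omega> in M. \<forall>t\<ge>0. \<forall>x\<in>D.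
        gradient \<phi> x \<bullet> a t x \<omega>
        + 1 / 2 * (\<Sum>k=1..m. \<Sum>i\<in>UNIV. \<Sum>l\<in>UNIV.
            b k t x \<omega> $ i * b k t x \<omega> $ l * hessian \<phi> x $ i $ l) \<ge> 0"
    and V2: "AE \<omega> in M. \<forall>t\<ge>0. \<forall>x\<in>D. \<forall>k\<in>{1..m}. gradient \<phi> x \<bullet> b k t x \<omega> = 0"
begin

section \<open>From one step to a grid, and from the grid to all times\<close>

lemma D_closed: "closed D"
  unfolding D_def by (intro closed_Collect_le continuous_on_const C2_continuous(1)[OF \<phi>_C2])

lemmas distance_integrable_D = distance_integrable[OF D_nonempty]

text \<open>The order of the quantifiers matters: \<open>K1\<close> is fixed before the accuracy
  \<open>\<epsilon>\<close>, so the factor it accumulates over a grid stays bounded when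
  \<open>\<epsilon>\<close> tends to 0. The error \<open>\<epsilon> * h\<close> is shared out in
  quarters: miss of the corrected step, freezing of coefficients, inexact projection, and terms of
  order \<open>h\<^sup>2\<close>.\<close>

lemma one_step_contraction:
  fixes R T :: real
  assumes R: "0 \<le> R"
  shows "\<exists>K1\<ge>0. \<forall>\<epsilon>>0. \<exists>h0>0. \<forall>t h B. 0 \<le> t \<longrightarrow> 0 < h \<longrightarrow> h \<le> h0 \<longrightarrow> t + h \<le> T
    \<longrightarrow> B \<in> sets (F t) \<longrightarrow> (\<forall>\<omega>\<in>B. norm (X t \<omega>) \<le> R) \<longrightarrow>
    expectation (\<lambda>\<omega>. indicator B \<omega> * (infdist (X (t + h) \<omega>) D)\<^sup>2)
      \<le> (1 + K1 * h) * expectation (\<lambda>\<omega>. indicator B \<omega> * (infdist (X t \<omega>) D)\<^sup>2) + \<epsilon> * h"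
proof -
  obtain x0 where x0: "x0 \<in> D" using D_nonempty by blast
  \<comment> \<open>\<open>R2\<close> bounds the offset \<open>X t - \<xi>\<close> on
    \<open>B\<close>: the distance to \<open>D\<close> is at most \<open>R + norm x0\<close>, and
    the 1 covers the slack of the projection. \<open>R1\<close> then bounds \<open>\<xi>\<close>
    itself.\<close>
  define R2 where "R2 = R + norm x0 + 1"
  define R1 where "R1 = R + R2"
  have R2: "0 \<le> R2" "R \<le> R1" "norm x0 \<le> R1" using R by (auto simp: R1_def R2_def)
  obtain c where c: "c > 0" "\<And>x. norm x \<le> R1 \<Longrightarrow> \<bar>\<phi> x\<bar> \<le> c \<Longrightarrow> norm (gradient \<phi> x) \<ge> c"
    using gradient_bound_near_zero_set[OF \<phi>_C2 \<phi>_grad, where R=R1] by blast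
  have "compact (hessian \<phi> ` cball 0 R1)"
    using C2_continuous(3)[OF \<phi>_C2] by (intro compact_continuous_image) (auto intro: continuous_on_subset)
  then obtain KH where KH: "\<And>x. x \<in> cball 0 R1 \<Longrightarrow> norm (hessian \<phi> x) \<le> KH"
    using compact_imp_bounded bounded_iff by (metis imageI)
  define Kb where "Kb = C * (1 + R1)"
  have Kb: "0 \<le> Kb" using C_nonneg R R2 by (simp add: Kb_def)
  define K1 where "K1 = 1 + 2 * C + 12 * C\<^sup>2 + 12 * m\<^sup>2 * C\<^sup>2"
  have K1: "0 \<le> K1" using C_nonneg by (simp add: K1_def)
  define Kc where "Kc = KH * (C * (1 + R1))\<^sup>2 * m\<^sup>2 * (1 / c)"
  show ?thesis
  proof (rule exI[of _ K1], rule conjI[OF K1], intro allI impI)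
    fix \<epsilon> :: real assume \<epsilon>: "\<epsilon> > 0"
    have dm: "x / y * y = x" if "0 < y" for x y :: real using that by simp
    define \<epsilon>1 where "\<epsilon>1 = \<epsilon> / 4 / (2 * R2 * (m + 1) + 1)"
    have den1: "0 < 2 * R2 * real (m + 1) + 1" using R2 by (simp add: add_nonneg_pos)
    have \<epsilon>1: "\<epsilon>1 > 0" "\<epsilon>1 * (2 * R2 * (m + 1)) \<le> \<epsilon> / 4"
    proof -
      show "\<epsilon>1 > 0" unfolding \<epsilon>1_def using \<epsilon> den1 by (intro divide_pos_pos) auto
      then have "\<epsilon>1 * (2 * R2 * (m + 1)) \<le> \<epsilon>1 * (2 * R2 * (m + 1) + 1)" by (intro mult_left_mono) auto
      also have "\<dots> = \<epsilon> / 4" unfolding \<epsilon>1_def by (rule dm[OF den1])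
      finally show "\<epsilon>1 * (2 * R2 * (m + 1)) \<le> \<epsilon> / 4" .
    qed
    define e where "e = \<epsilon> / 4 / (13 + 72 * m\<^sup>2)"
    have den2: "0 < real (13 + 72 * m\<^sup>2)" by (subst of_nat_0_less_iff) simp
    have e: "e > 0" "e * (13 + 72 * m\<^sup>2) = \<epsilon> / 4"
      unfolding e_def using \<epsilon> by (intro divide_pos_pos den2 dm; simp)+
    define e4 where "e4 = \<epsilon> / 4 / (1 + K1)"
    have e4: "e4 > 0" "(1 + K1) * e4 = \<epsilon> / 4"
      unfolding e4_def mult.commute[of "1 + K1"] using \<epsilon> K1 dm[of "1 + K1" "\<epsilon> / 4"] by auto
    define near_step where "near_step h1 L \<longleftrightarrow>
      (\<forall>x \<alpha> \<beta> h w s. 0 \<le> \<phi> x \<longrightarrow> norm x \<le> R1 \<longrightarrow> norm \<alpha> \<le> Kb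
      \<longrightarrow> (\<forall>k\<in>{1..m}. norm (\<beta> k) \<le> Kb \<and> gradient \<phi> x \<bullet> \<beta> k = 0)
      \<longrightarrow> gradient \<phi> x \<bullet> \<alpha> + 1/2 * (\<Sum>k=1..m. \<beta> k \<bullet> (hessian \<phi> x *v \<beta> k)) \<ge> 0
      \<longrightarrow> 0 < h \<longrightarrow> h \<le> h1 \<longrightarrow> s = (\<Sum>k=1..m. (w k)\<^sup>2)
      \<longrightarrow> (\<exists>p r. 0 \<le> \<phi> p \<and> norm (p - (x + h *\<^sub>R \<alpha> + (\<Sum>k=1..m. w k *\<^sub>R \<beta> k)
              + ito_correction {1..m} (hessian \<phi> x) \<beta> h w *\<^sub>R scaled_gradient \<phi> R1 c x)) \<le> r
           \<and> r \<le> \<epsilon>1 * (s + h) + L * s\<^sup>2 \<and> r \<le> L * (s + h)))" for h1 L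
    have "\<exists>h1>0. \<exists>L\<ge>0. near_step h1 L"
      unfolding near_step_def
      by (rule superlevel_point_near_Euler_step[OF \<phi>_C2 finite_atLeastAtMost Kb c(1) _ \<epsilon>1(1)]) (rule c(2))
    then obtain h1 L where h1: "h1 > 0" and L: "L \<ge> 0" and geo: "near_step h1 L" by blast
    define Q where "Q f d \<longleftrightarrow> (\<forall>t u. 0 \<le> t \<longrightarrow> t \<le> u \<longrightarrow> u \<le> T \<longrightarrow> u - t < d \<longrightarrow>
      (\<integral>\<^sup>+\<omega>. (\<integral>\<^sup>+s\<in>{t..u}. ennreal ((norm (f s (X s \<omega>) \<omega> - f t (X t \<omega>) \<omega>))\<^sup>2) \<partial>lborel) \<partial>M) \<le> ennreal (e * (u - t)))"
      for f :: "real \<Rightarrow> real ^ 'd \<Rightarrow> 'w \<Rightarrow> real ^ 'd" and d :: real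
    let ?S = "insert a (b ` {1..m})"
    have "\<forall>f\<in>?S. \<exists>d>0. Q f d"
    proof
      fix f assume "f \<in> ?S"
      then have "regular_coefficient f" using regular_a regular_b by auto
      from coefficient_oscillation[OF this e(1), of T]
      show "\<exists>d>0. Q f d" unfolding Q_def .
    qed
    then obtain dd where dd: "\<And>f. f \<in> ?S \<Longrightarrow> dd f > 0 \<and> Q f (dd f)" by metis
    define d where "d = Min (dd ` ?S)"
    have d: "d > 0" using dd unfolding d_def by (subst Min_gr_iff) auto
    have d_le: "d \<le> dd f" if "f \<in> ?S" for f
      unfolding d_def using that by (intro Min_le finite_imageI imageI) auto
    define Kbig where "Kbig = (6 * Kc\<^sup>2 + 2 * L\<^sup>2) * (6 * m\<^sup>2 + 2) + 6 * R2 * L * m\<^sup>2"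
    have Kbig: "0 \<le> Kbig" using R2 L by (simp add: Kbig_def)
    \<comment> \<open>In turn: the normalisation \<open>h \<le> 1\<close>, the geometry, the
      freezing (halved, as the oscillation bound asks for a strict inequality), and the terms of
      order \<open>h\<^sup>2\<close>.\<close>
    define h0 where "h0 = min (min 1 h1) (min (d / 2) (\<epsilon> / 4 / (Kbig + 1)))"
    have h0: "h0 > 0" using h1 d \<epsilon> Kbig by (simp add: h0_def)
    show "\<exists>h0>0. \<forall>t h B. 0 \<le> t \<longrightarrow> 0 < h \<longrightarrow> h \<le> h0 \<longrightarrow> t + h \<le> T
    \<longrightarrow> B \<in> sets (F t) \<longrightarrow> (\<forall>\<omega>\<in>B. norm (X t \<omega>) \<le> R) \<longrightarrow>
    expectation (\<lambda>\<omega>. indicator B \<omega> * (infdist (X (t + h) \<omega>) D)\<^sup>2)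
      \<le> (1 + K1 * h) * expectation (\<lambda>\<omega>. indicator B \<omega> * (infdist (X t \<omega>) D)\<^sup>2) + \<epsilon> * h"
    proof (intro exI[of _ h0] conjI h0 allI impI)
      fix t h :: real and B
      assume t: "0 \<le> t" and h: "0 < h" "h \<le> h0" and T: "t + h \<le> T" and B: "B \<in> sets (F t)"
        and XB: "\<forall>\<omega>\<in>B. norm (X t \<omega>) \<le> R"
      have h': "h \<le> 1" "h \<le> h1" "h < d" "h \<le> \<epsilon> / 4 / (Kbig + 1)"
        using h h0 d by (auto simp: h0_def)
      have BM: "B \<in> sets M" using B subalgebra_F[OF t] by (auto simp: subalgebra_def)
      \<comment> \<open>The slack shrinks with the step, so its total over about 1/h steps remains
        small; the cap 1 is what \<open>R2\<close> allows for.\<close>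
      define \<delta> where "\<delta> = min 1 (h * e4)"
      have \<delta>: "\<delta> > 0" "\<delta> \<le> 1" "\<delta> \<le> h * e4" using h e4 by (auto simp: \<delta>_def)
      obtain \<pi> where \<pi>: "\<pi> \<in> borel_measurable borel" "\<And>x. \<pi> x \<in> D"
        "\<And>x. (norm (x - \<pi> x))\<^sup>2 \<le> (infdist x D)\<^sup>2 + \<delta>"
        using approximate_projection[OF D_nonempty \<delta>(1)] by blast
      \<comment> \<open>Off \<open>B\<close> the value \<open>x0\<close> keeps \<open>\<xi>\<close>
        bounded and inside \<open>D\<close> for every \<omega>.\<close>
      define \<xi> where "\<xi> \<omega> = (if \<omega> \<in> B then \<pi> (X t \<omega>) else x0)" for \<omega>
      have \<xi>D: "\<xi> \<omega> \<in> D" for \<omega> using \<pi>(2) x0 by (simp add: \<xi>_def)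
      have X\<xi>: "norm (X t \<omega> - \<xi> \<omega>) \<le> R2" if "\<omega> \<in> B" for \<omega>
      proof -
        have X: "norm (X t \<omega>) \<le> R" using XB that by blast
        have "infdist (X t \<omega>) D \<le> norm (X t \<omega> - x0)"
          using infdist_le[OF x0, of "X t \<omega>"] by (simp add: dist_norm)
        also have "\<dots> \<le> R + norm x0" using X norm_triangle_ineq4[of "X t \<omega>" x0] by linarith
        finally have "(infdist (X t \<omega>) D)\<^sup>2 \<le> (R + norm x0)\<^sup>2" by (intro power_mono infdist_nonneg)
        then have "(norm (X t \<omega> - \<pi> (X t \<omega>)))\<^sup>2 \<le> (R + norm x0)\<^sup>2 + 1"
          using \<pi>(3)[of "X t \<omega>"] \<delta> by linarith
        also have "\<dots> \<le> (R + norm x0)\<^sup>2 + 2 * (R + norm x0) + 1" using R by simp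
        also have "\<dots> = R2\<^sup>2" by (simp add: R2_def power2_eq_square algebra_simps)
        finally have "(norm (X t \<omega> - \<xi> \<omega>))\<^sup>2 \<le> R2\<^sup>2" using that by (simp add: \<xi>_def)
        then show ?thesis using R2(1) by (rule power2_le_imp_le)
      qed
      have \<xi>b: "norm (\<xi> \<omega>) \<le> R1" for \<omega>
      proof (cases "\<omega> \<in> B")
        case True
        then show ?thesis
          using X\<xi>[OF True] bspec[OF XB True] norm_triangle_ineq4[of "X t \<omega>" "X t \<omega> - \<xi> \<omega>"] by (simp add: R1_def)
      qed (use R2 in \<open>simp add: \<xi>_def\<close>)
      have [measurable]: "B \<in> sets (F t)" "X t \<in> borel_measurable (F t)" "\<pi> \<in> borel_measurable borel"
        using B X_measurable_F[OF t] \<pi> by auto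
      have \<xi>F [measurable]: "\<xi> \<in> borel_measurable (F t)" unfolding \<xi>_def[abs_def] by measurable
      have \<nu>F: "(\<lambda>\<omega>. scaled_gradient \<phi> R1 c (\<xi> \<omega>)) \<in> borel_measurable (F t)"
        using measurable_compose[OF \<xi>F scaled_gradient_measurable[OF \<phi>_C2]] .
      have HF: "(\<lambda>\<omega>. hessian \<phi> (\<xi> \<omega>)) \<in> borel_measurable (F t)"
        using measurable_compose[OF \<xi>F borel_measurable_continuous_onI[OF C2_continuous(3)[OF \<phi>_C2]]] .
      have near: "AE \<omega> in M. \<omega> \<in> B \<longrightarrow> (\<exists>p r. p \<in> D
        \<and> norm (p - (\<xi> \<omega> + h *\<^sub>R a t (\<xi> \<omega>) \<omega> + (\<Sum>k=1..m. (W k (t + h) \<omega> - W k t \<omega>) *\<^sub>R b k t (\<xi> \<omega>) \<omega>)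
            + ito_correction {1..m} (hessian \<phi> (\<xi> \<omega>)) (\<lambda>k. b k t (\<xi> \<omega>) \<omega>) h (\<lambda>k. W k (t + h) \<omega> - W k t \<omega>)
              *\<^sub>R scaled_gradient \<phi> R1 c (\<xi> \<omega>))) \<le> r
        \<and> r \<le> \<epsilon>1 * (noise_square t (t + h) \<omega> + h) + L * (noise_square t (t + h) \<omega>)\<^sup>2
        \<and> r \<le> L * (noise_square t (t + h) \<omega> + h))"
      proof -
        have "AE \<omega> in M. \<forall>k\<in>{1..m}. \<forall>t\<ge>0. \<forall>x. norm (b k t x \<omega>) \<le> C * (1 + norm x)"
          using regular_growth[OF regular_b] by (intro AE_ball_countable[THEN iffD2]) auto
        then show ?thesis
          using V1 V2 regular_growth[OF regular_a]
        proof eventually_elim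
          case (elim \<omega>)
          have lin: "C * (1 + norm (\<xi> \<omega>)) \<le> Kb"
            unfolding Kb_def using \<xi>b[of \<omega>] C_nonneg by (intro mult_left_mono) auto
          have \<alpha>: "norm (a t (\<xi> \<omega>) \<omega>) \<le> Kb" using elim(4) t lin order_trans by blast
          have \<beta>: "norm (b k t (\<xi> \<omega>) \<omega>) \<le> Kb \<and> gradient \<phi> (\<xi> \<omega>) \<bullet> b k t (\<xi> \<omega>) \<omega> = 0" if "k \<in> {1..m}" for k
            using elim(1,3) t lin order_trans that \<xi>D[of \<omega>] by blast
          have v: "gradient \<phi> (\<xi> \<omega>) \<bullet> a t (\<xi> \<omega>) \<omega>
            + 1/2 * (\<Sum>k=1..m. b k t (\<xi> \<omega>) \<omega> \<bullet> (hessian \<phi> (\<xi> \<omega>) *v b k t (\<xi> \<omega>) \<omega>)) \<ge> 0"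
            unfolding quadratic_form_eq_sum using elim(2) t \<xi>D[of \<omega>] by blast
          have "0 \<le> \<phi> (\<xi> \<omega>)" using \<xi>D[of \<omega>] by (simp add: D_def)
          from geo[unfolded near_step_def, rule_format, OF this \<xi>b \<alpha> \<beta> v h(1) h'(2) noise_square_def]
          show ?case by (simp add: D_def)
        qed
      qed
      have osc: "(\<integral>\<^sup>+\<omega>. (\<integral>\<^sup>+s\<in>{t..t + h}. ennreal ((norm (f s (X s \<omega>) \<omega> - f t (X t \<omega>) \<omega>))\<^sup>2) \<partial>lborel) \<partial>M) \<le> ennreal (e * h)"
        if "f = a \<or> f \<in> b ` {1..m}" for f
      proof -
        have f: "f \<in> ?S" using that by auto
        have "h < dd f" using d_le[OF f] h' by linarith
        moreover from dd[OF f] have "Q f (dd f)" by blast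
        ultimately show ?thesis
          using t h T unfolding Q_def by (elim allE[of _ t] allE[of _ "t + h"]) simp
      qed
      have step: "expectation (\<lambda>\<omega>. indicator B \<omega> * (infdist (X (t + h) \<omega>) D)\<^sup>2)
        \<le> (1 + K1 * h) * expectation (\<lambda>\<omega>. indicator B \<omega> * (norm (X t \<omega> - \<xi> \<omega>))\<^sup>2)
          + h * (e * (13 + 72 * m\<^sup>2) + \<epsilon>1 * (2 * R2 * (m + 1)) + h * Kbig)"
        unfolding K1_def Kbig_def Kc_def
      proof (rule Euler_step_estimate[where \<xi>=\<xi> and H="\<lambda>\<omega>. hessian \<phi> (\<xi> \<omega>)"
            and \<nu>="\<lambda>\<omega>. scaled_gradient \<phi> R1 c (\<xi> \<omega>)"])
        show "0 \<le> t" "0 < h" "h \<le> 1" "B \<in> sets (F t)" "\<xi> \<in> borel_measurable (F t)"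
          "(\<lambda>\<omega>. scaled_gradient \<phi> R1 c (\<xi> \<omega>)) \<in> borel_measurable (F t)"
          "(\<lambda>\<omega>. hessian \<phi> (\<xi> \<omega>)) \<in> borel_measurable (F t)" "0 \<le> L" "0 \<le> R2"
          by fact+
        show "D \<noteq> {}" by (rule D_nonempty)
        show "0 \<le> e" "0 \<le> \<epsilon>1" using e \<epsilon>1 by simp_all
        show "norm (\<xi> \<omega>) \<le> R1" for \<omega> by (rule \<xi>b)
        show "norm (X t \<omega> - \<xi> \<omega>) \<le> R2" if "\<omega> \<in> B" for \<omega> using that by (rule X\<xi>)
        show "(\<integral>\<^sup>+\<omega>. (\<integral>\<^sup>+s\<in>{t..t + h}. ennreal ((norm (f s (X s \<omega>) \<omega> - f t (X t \<omega>) \<omega>))\<^sup>2) \<partial>lborel) \<partial>M) \<le> ennreal (e * h)"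
          if "f = a \<or> f \<in> b ` {1..m}" for f using that by (rule osc)
        show "norm (scaled_gradient \<phi> R1 c (\<xi> \<omega>)) \<le> 1 / c" for \<omega>
          by (rule norm_scaled_gradient_le[OF c])
        show "norm (hessian \<phi> (\<xi> \<omega>)) \<le> KH" for \<omega> using KH \<xi>b by simp
        show "norm (X t \<omega>) \<le> R1" if "\<omega> \<in> B" for \<omega> using bspec[OF XB that] R2 by linarith
      qed (rule near)
      let ?E = "expectation (\<lambda>\<omega>. indicator B \<omega> * (infdist (X t \<omega>) D)\<^sup>2)"
      have "expectation (\<lambda>\<omega>. indicator B \<omega> * (norm (X t \<omega> - \<xi> \<omega>))\<^sup>2)
        \<le> expectation (\<lambda>\<omega>. indicator B \<omega> * (infdist (X t \<omega>) D)\<^sup>2 + \<delta>)"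
      proof (rule integral_mono)
        show "integrable M (\<lambda>\<omega>. indicator B \<omega> * (norm (X t \<omega> - \<xi> \<omega>))\<^sup>2)"
        proof (rule integrable_bounded)
          show "(\<lambda>\<omega>. indicator B \<omega> * (norm (X t \<omega> - \<xi> \<omega>))\<^sup>2) \<in> borel_measurable M"
            by (rule measurable_F_M[OF t]) measurable
          show "\<bar>indicator B \<omega> * (norm (X t \<omega> - \<xi> \<omega>))\<^sup>2\<bar> \<le> R2\<^sup>2" for \<omega>
            using X\<xi>[of \<omega>] by (auto simp: indicator_def intro!: power_mono)
        qed
        show "integrable M (\<lambda>\<omega>. indicator B \<omega> * (infdist (X t \<omega>) D)\<^sup>2 + \<delta>)"
          using distance_integrable_D[OF t BM] by simp
        show "indicator B \<omega> * (norm (X t \<omega> - \<xi> \<omega>))\<^sup>2 \<le> indicator B \<omega> * (infdist (X t \<omega>) D)\<^sup>2 + \<delta>" for \<omega>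
          using \<pi>(3)[of "X t \<omega>"] \<delta> by (auto simp: indicator_def \<xi>_def)
      qed
      also have "\<dots> = ?E + \<delta>" using distance_integrable_D[OF t BM] by (simp add: prob_space)
      finally have "(1 + K1 * h) * expectation (\<lambda>\<omega>. indicator B \<omega> * (norm (X t \<omega> - \<xi> \<omega>))\<^sup>2) \<le> (1 + K1 * h) * (?E + \<delta>)"
        using K1 h by (intro mult_left_mono) auto
      also have "\<dots> = (1 + K1 * h) * ?E + (1 + K1 * h) * \<delta>" by (rule distrib_left)
      also have "(1 + K1 * h) * \<delta> \<le> (1 + K1) * (h * e4)"
        using K1 h h' \<delta> by (intro mult_mono) (auto simp: mult_left_le)
      also have "\<dots> = h * (\<epsilon> / 4)" using e4(2) by (simp add: mult_ac)
      finally have 1: "(1 + K1 * h) * expectation (\<lambda>\<omega>. indicator B \<omega> * (norm (X t \<omega> - \<xi> \<omega>))\<^sup>2) \<le> (1 + K1 * h) * ?E + h * (\<epsilon> / 4)" by simp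
      have "h * Kbig \<le> \<epsilon> / 4 / (Kbig + 1) * (Kbig + 1)" using h h' Kbig \<epsilon> by (intro mult_mono) auto
      also have "\<dots> = \<epsilon> / 4" using Kbig by (intro dm) auto
      finally have "e * (13 + 72 * m\<^sup>2) + \<epsilon>1 * (2 * R2 * (m + 1)) + h * Kbig \<le> \<epsilon> / 4 + \<epsilon> / 4 + \<epsilon> / 4"
        using e(2) \<epsilon>1(2) by linarith
      then have "h * (e * (13 + 72 * m\<^sup>2) + \<epsilon>1 * (2 * R2 * (m + 1)) + h * Kbig) \<le> h * (\<epsilon> / 4 + \<epsilon> / 4 + \<epsilon> / 4)"
        using h by (intro mult_left_mono) auto
      then show "expectation (\<lambda>\<omega>. indicator B \<omega> * (infdist (X (t + h) \<omega>) D)\<^sup>2) \<le> (1 + K1 * h) * ?E + \<epsilon> * h"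
        using step 1 by (simp add: algebra_simps)
    qed
  qed
qed

lemma X_initial_in_D: "AE \<omega> in M. X 0 \<omega> \<in> D"
proof -
  have "AE \<omega> in M. X 0 \<omega> = X0 \<omega>" using X_increment by blast
  then show ?thesis using X0_in_D by eventually_elim simp
qed

text \<open>A discrete Gronwall inequality on a grid, started from distance 0. The boundedness is
  asked on all grids at once: the resulting event does not change with the grid chosen for a given
  accuracy, and only countably many times occur in it.\<close>

lemma X_in_D_on_bounded_grid:
  fixes R T :: real
  assumes R: "0 \<le> R" and T: "0 < T"
  shows "AE \<omega> in M. (\<forall>N::nat. \<forall>j::nat. j \<le> N \<longrightarrow> norm (X (j * (T / N)) \<omega>) \<le> R) \<longrightarrow> X T \<omega> \<in> D"
proof -
  obtain K1 where K1: "0 \<le> K1" and step: "\<And>\<epsilon>. \<epsilon> > 0 \<Longrightarrow> \<exists>h0>0. \<forall>t h B. 0 \<le> t \<longrightarrow> 0 < h \<longrightarrow> h \<le> h0 \<longrightarrow> t + h \<le> T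
    \<longrightarrow> B \<in> sets (F t) \<longrightarrow> (\<forall>\<omega>\<in>B. norm (X t \<omega>) \<le> R) \<longrightarrow>
    expectation (\<lambda>\<omega>. indicator B \<omega> * (infdist (X (t + h) \<omega>) D)\<^sup>2)
      \<le> (1 + K1 * h) * expectation (\<lambda>\<omega>. indicator B \<omega> * (infdist (X t \<omega>) D)\<^sup>2) + \<epsilon> * h"
    using one_step_contraction[OF R, of T] by blast
  \<comment> \<open>For \<open>N = 0\<close>, division by zero produces the time 0, which adds
    nothing new.\<close>
  define G where "G = {\<omega> \<in> space M. \<forall>N::nat. \<forall>j::nat. j \<le> N \<longrightarrow> norm (X (j * (T / N)) \<omega>) \<le> R}"
  have grid0: "0 \<le> real j * (T / real N)" for j N using T by simp
  have [measurable]: "X (real j * (T / real N)) \<in> borel_measurable M" for j N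
    by (rule X_measurable[OF grid0])
  have G: "G \<in> sets M" unfolding G_def by measurable
  have small: "expectation (\<lambda>\<omega>. indicator G \<omega> * (infdist (X T \<omega>) D)\<^sup>2) \<le> \<epsilon> * T * exp (K1 * T)" if \<epsilon>: "\<epsilon> > 0" for \<epsilon>
  proof -
    obtain h0 where h0: "h0 > 0" and st: "\<And>t h B. 0 \<le> t \<Longrightarrow> 0 < h \<Longrightarrow> h \<le> h0 \<Longrightarrow> t + h \<le> T
      \<Longrightarrow> B \<in> sets (F t) \<Longrightarrow> (\<forall>\<omega>\<in>B. norm (X t \<omega>) \<le> R) \<Longrightarrow>
      expectation (\<lambda>\<omega>. indicator B \<omega> * (infdist (X (t + h) \<omega>) D)\<^sup>2)
      \<le> (1 + K1 * h) * expectation (\<lambda>\<omega>. indicator B \<omega> * (infdist (X t \<omega>) D)\<^sup>2) + \<epsilon> * h"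
      using step[OF \<epsilon>] by blast
    obtain N :: nat where N: "real N > T / h0" using reals_Archimedean2 by blast
    moreover have "0 < T / h0" using T h0 by simp
    ultimately have N0: "0 < real N" by linarith
    define h where "h = T / N"
    have h: "0 < h" "h \<le> h0" using T N0 N h0 by (auto simp: h_def field_simps)
    have Nh: "real N * h = T" using N0 by (simp add: h_def)
    \<comment> \<open>\<open>A i\<close> looks no further than time \<open>i * h\<close>, so it is
      admissible for the step starting there. It decreases in \<open>i\<close>, which lets the
      expectation over \<open>A (Suc i)\<close> be bounded by the one over
      \<open>A i\<close>.\<close>
    define A where "A i = {\<omega> \<in> space M. \<forall>j\<le>i. norm (X (j * h) \<omega>) \<le> R}" for i :: nat
    define E where "E i = expectation (\<lambda>\<omega>. indicator (A i) \<omega> * (infdist (X (i * h) \<omega>) D)\<^sup>2)" for i :: nat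
    have ih: "0 \<le> real i * h" for i using h by simp
    have AF: "A i \<in> sets (F (i * h))" for i
    proof -
      have [measurable]: "X (real j * h) \<in> borel_measurable (F (i * h))" if "j \<in> {..i}" for j
        using that h by (intro measurable_F_mono[OF ih _ X_measurable_F[OF ih]]) auto
      have "A i = {\<omega> \<in> space (F (i * h)). \<forall>j\<in>{..i}. norm (X (j * h) \<omega>) \<le> R}"
        unfolding A_def space_F[OF ih] by auto
      also have "\<dots> \<in> sets (F (i * h))" by measurable
      finally show ?thesis .
    qed
    have AM: "A i \<in> sets M" for i using AF[of i] subalgebra_F[OF ih] by (auto simp: subalgebra_def)
    have bound: "i \<le> N \<Longrightarrow> E i \<le> \<epsilon> * (i * h) * (1 + K1 * h) ^ i" for i
    proof (induction i)
      case 0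
      have "E 0 = expectation (\<lambda>\<omega>. 0)"
        unfolding E_def
      proof (rule integral_cong_AE)
        show "AE \<omega> in M. indicator (A 0) \<omega> * (infdist (X (real 0 * h) \<omega>) D)\<^sup>2 = 0"
          using X_initial_in_D by eventually_elim simp
      qed (use borel_measurable_integrable[OF distance_integrable_D[OF ih[of 0] AM[of 0]]] in simp_all)
      then show ?case by simp
    next
      case (Suc i)
      have Ti: "real i * h + h \<le> T"
      proof -
        have "real (Suc i) * h \<le> real N * h" using Suc h by (intro mult_right_mono) auto
        then show ?thesis using Nh by (simp add: algebra_simps)
      qed
      have Si: "real (Suc i) * h = real i * h + h" by (simp add: algebra_simps)
      have "E (Suc i) \<le> expectation (\<lambda>\<omega>. indicator (A i) \<omega> * (infdist (X (real i * h + h) \<omega>) D)\<^sup>2)"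
        unfolding E_def Si
      proof (rule integral_mono)
        have "0 \<le> real i * h + h" using ih[of i] h by linarith
        then show "integrable M (\<lambda>\<omega>. indicator (A (Suc i)) \<omega> * (infdist (X (real i * h + h) \<omega>) D)\<^sup>2)"
          "integrable M (\<lambda>\<omega>. indicator (A i) \<omega> * (infdist (X (real i * h + h) \<omega>) D)\<^sup>2)"
          using distance_integrable_D AM by blast+
        show "indicator (A (Suc i)) \<omega> * (infdist (X (real i * h + h) \<omega>) D)\<^sup>2
            \<le> indicator (A i) \<omega> * (infdist (X (real i * h + h) \<omega>) D)\<^sup>2" for \<omega>
          by (intro mult_right_mono) (auto simp: indicator_def A_def)
      qed
      also have "\<dots> \<le> (1 + K1 * h) * E i + \<epsilon> * h"
        unfolding E_def by (rule st[OF ih h Ti AF]) (auto simp: A_def)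
      \<comment> \<open>The new error is inflated by \<open>(1 + K1 * h) ^ Suc i \<ge> 1\<close>, so
        that it merges with the propagated ones into the same closed form.\<close>
      also have "\<dots> \<le> (1 + K1 * h) * (\<epsilon> * (i * h) * (1 + K1 * h) ^ i) + \<epsilon> * h * (1 + K1 * h) ^ Suc i"
      proof (intro add_mono mult_left_mono)
        have "\<epsilon> * h * 1 \<le> \<epsilon> * h * (1 + K1 * h) ^ Suc i"
          using \<epsilon> h K1 by (intro mult_left_mono one_le_power) auto
        then show "\<epsilon> * h \<le> \<epsilon> * h * (1 + K1 * h) ^ Suc i" by simp
      qed (use Suc K1 h in auto)
      also have "\<dots> = \<epsilon> * (Suc i * h) * (1 + K1 * h) ^ Suc i" by (simp add: algebra_simps)
      finally show ?case .
    qed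
    have "E N \<le> \<epsilon> * T * (1 + K1 * h) ^ N" using bound[of N] Nh by simp
    also have "\<dots> \<le> \<epsilon> * T * exp (K1 * T)"
    proof (intro mult_left_mono)
      have "(1 + K1 * h) ^ N \<le> exp (K1 * h) ^ N"
        using K1 h by (intro power_mono exp_ge_add_one_self) auto
      also have "\<dots> = exp (K1 * T)" unfolding exp_of_nat_mult[symmetric] Nh[symmetric] by (simp add: mult_ac)
      finally show "(1 + K1 * h) ^ N \<le> exp (K1 * T)" .
    qed (use \<epsilon> T in auto)
    finally have EN: "E N \<le> \<epsilon> * T * exp (K1 * T)" .
    have "expectation (\<lambda>\<omega>. indicator G \<omega> * (infdist (X T \<omega>) D)\<^sup>2) \<le> E N"
      unfolding E_def Nh
    proof (rule integral_mono)
      show "indicator G \<omega> * (infdist (X T \<omega>) D)\<^sup>2 \<le> indicator (A N) \<omega> * (infdist (X T \<omega>) D)\<^sup>2" for \<omega>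
        by (intro mult_right_mono) (auto simp: indicator_def A_def G_def h_def)
    qed (use distance_integrable_D G AM T in auto)
    then show ?thesis using EN by linarith
  qed
  have i: "integrable M (\<lambda>\<omega>. indicator G \<omega> * (infdist (X T \<omega>) D)\<^sup>2)" using distance_integrable_D[OF _ G] T by simp
  have "expectation (\<lambda>\<omega>. indicator G \<omega> * (infdist (X T \<omega>) D)\<^sup>2) \<le> 0"
  proof (rule field_le_epsilon)
    fix e :: real assume "e > 0"
    then show "expectation (\<lambda>\<omega>. indicator G \<omega> * (infdist (X T \<omega>) D)\<^sup>2) \<le> 0 + e"
      using small[of "e / (T * exp (K1 * T))"] T by simp
  qed
  moreover have "0 \<le> expectation (\<lambda>\<omega>. indicator G \<omega> * (infdist (X T \<omega>) D)\<^sup>2)" by simp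
  ultimately have "expectation (\<lambda>\<omega>. indicator G \<omega> * (infdist (X T \<omega>) D)\<^sup>2) = 0" by linarith
  then have "AE \<omega> in M. indicator G \<omega> * (infdist (X T \<omega>) D)\<^sup>2 = 0"
    using integral_nonneg_eq_0_iff_AE[OF i] by simp
  then show ?thesis
    using AE_space
  proof eventually_elim
    case (elim \<omega>)
    show ?case
    proof
      assume "\<forall>N::nat. \<forall>j::nat. j \<le> N \<longrightarrow> norm (X (j * (T / N)) \<omega>) \<le> R"
      then have "\<omega> \<in> G" using elim(2) by (simp add: G_def)
      then have "infdist (X T \<omega>) D = 0" using elim(1) by simp
      then show "X T \<omega> \<in> D" using in_closed_iff_infdist_zero[OF D_closed D_nonempty] by simp
    qed
  qed
qed

text \<open>A continuous path is bounded on \<open>[0, T]\<close>, so almost every \<omega> meets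
  the boundedness condition for some natural number \<open>R\<close>; only countably many null sets
  are discarded.\<close>

lemma X_in_D_at:
  assumes T: "0 \<le> T"
  shows "AE \<omega> in M. X T \<omega> \<in> D"
proof (cases "T = 0")
  case True
  then show ?thesis using X_initial_in_D by simp
next
  case False
  then have T': "0 < T" using T by simp
  have "AE \<omega> in M. \<forall>R::nat. (\<forall>N::nat. \<forall>j::nat. j \<le> N \<longrightarrow> norm (X (j * (T / N)) \<omega>) \<le> real R) \<longrightarrow> X T \<omega> \<in> D"
    unfolding AE_all_countable using X_in_D_on_bounded_grid[OF _ T'] by simp
  then show ?thesis
    using X_process(3)
  proof eventually_elim
    case (elim \<omega>)
    have "compact ((\<lambda>t. X t \<omega>) ` {0..T})"
      using elim(2) by (intro compact_continuous_image) (auto elim: continuous_on_subset)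
    then obtain R where R: "\<And>t. t \<in> {0..T} \<Longrightarrow> norm (X t \<omega>) \<le> R"
      using compact_imp_bounded bounded_iff by (metis imageI)
    obtain n :: nat where n: "R \<le> real n" using real_arch_simple by blast
    have "norm (X (j * (T / N)) \<omega>) \<le> real n" if "j \<le> N" for j N :: nat
    proof -
      have "real j * (T / N) \<in> {0..T}"
      proof (cases "N = 0")
        case False
        then have "real j * T \<le> real N * T" using that T by (intro mult_right_mono) auto
        then show ?thesis using False T by (simp add: field_simps)
      qed (use T in simp)
      then show ?thesis using R n by (meson order_trans)
    qed
    then have "\<forall>N::nat. \<forall>j::nat. j \<le> N \<longrightarrow> norm (X (j * (T / N)) \<omega>) \<le> real n" by simp
    then show ?case by (rule mp[OF spec[OF elim(1), of n]])
  qed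
qed

text \<open>A countable dense set of times suffices, because the paths are continuous and
  \<open>D\<close> is closed.\<close>

lemma viability: "AE \<omega> in M. \<forall>t\<ge>0. X t \<omega> \<in> D"
proof -
  obtain S :: "real set" where S: "countable S" "S \<subseteq> {0..}" "{0..} \<subseteq> closure S"
    using separable[of "{0..}"] by blast
  have clS: "closure S = {0..}" using S by (simp add: closure_minimal subset_antisym)
  have "AE \<omega> in M. \<forall>t\<in>S. X t \<omega> \<in> D"
    using S X_in_D_at by (intro AE_ball_countable[THEN iffD2]) auto
  then show ?thesis
    using X_process(3)
  proof eventually_elim
    case (elim \<omega>)
    have "(\<lambda>t. X t \<omega>) ` closure S \<subseteq> D"
      using elim D_closed by (intro image_closure_subset) (auto simp: clS)
    then show ?case by (auto simp: clS)
  qed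
qed

end

theorem theorem7:
  fixes M :: "'w measure"
    and F :: "real \<Rightarrow> 'w measure"
    and m :: nat
    and W :: "nat \<Rightarrow> real \<Rightarrow> 'w \<Rightarrow> real"
    and a :: "real \<Rightarrow> real ^ 'd \<Rightarrow> 'w \<Rightarrow> real ^ 'd"
    and b :: "nat \<Rightarrow> real \<Rightarrow> real ^ 'd \<Rightarrow> 'w \<Rightarrow> real ^ 'd"
    and C :: real
    and X0 :: "'w \<Rightarrow> real ^ 'd"
    and X :: "real \<Rightarrow> 'w \<Rightarrow> real ^ 'd"
    and \<phi> :: "real ^ 'd \<Rightarrow> real"
    and D :: "(real ^ 'd) set"
  assumes basis: "usual_filtered_prob_space M F"
    and wiener: "\<And>k. k \<in> {1..m} \<Longrightarrow> wiener_process M F (W k)"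
    and indep: "independent_processes M {1..m} W"
    and X0_meas: "X0 \<in> borel_measurable (F 0)"
    and X0_bounded: "\<exists>K. AE \<omega> in M. norm (X0 \<omega>) \<le> K"
    and a_meas: "(\<lambda>(t, x, \<omega>). a t x \<omega>)
        \<in> borel_measurable (restrict_space borel {0..} \<Otimes>\<^sub>M borel \<Otimes>\<^sub>M M)"
    and b_meas: "\<And>k. k \<in> {1..m} \<Longrightarrow> (\<lambda>(t, x, \<omega>). b k t x \<omega>)
        \<in> borel_measurable (restrict_space borel {0..} \<Otimes>\<^sub>M borel \<Otimes>\<^sub>M M)"
    and H1_a: "\<And>t. 0 \<le> t \<Longrightarrow> (\<lambda>(x, \<omega>). a t x \<omega>) \<in> borel_measurable (borel \<Otimes>\<^sub>M F t)"
    and H1_b: "\<And>t k. 0 \<le> t \<Longrightarrow> k \<in> {1..m} \<Longrightarrow>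
        (\<lambda>(x, \<omega>). b k t x \<omega>) \<in> borel_measurable (borel \<Otimes>\<^sub>M F t)"
    and H2: "AE \<omega> in M. continuous_on ({0..} \<times> UNIV) (\<lambda>(t, x). a t x \<omega>)
        \<and> (\<forall>k\<in>{1..m}. continuous_on ({0..} \<times> UNIV) (\<lambda>(t, x). b k t x \<omega>))"
    and H3: "\<And>t. 0 \<le> t \<Longrightarrow> AE \<omega> in M. norm (a t 0 \<omega>) + (\<Sum>k=1..m. norm (b k t 0 \<omega>)) \<le> C"
    and H4: "\<And>t x y. 0 \<le> t \<Longrightarrow> AE \<omega> in M.
        norm (a t x \<omega> - a t y \<omega>) + (\<Sum>k=1..m. norm (b k t x \<omega> - b k t y \<omega>)) \<le> C * norm (x - y)"
    and X_sol: "sde_solution M F m W a b X0 X"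
    and \<phi>_C2: "C2 \<phi>"
    and \<phi>_grad: "\<And>x. \<phi> x = 0 \<Longrightarrow> gradient \<phi> x \<noteq> 0"
    and D_def: "D = {x. \<phi> x \<ge> 0}"
    and D_nonempty: "D \<noteq> {}"
    and X0_in_D: "AE \<omega> in M. X0 \<omega> \<in> D"
    and V1: "AE \<omega> in M. \<forall>t\<ge>0. \<forall>x\<in>D.
        gradient \<phi> x \<bullet> a t x \<omega>
        + 1 / 2 * (\<Sum>k=1..m. \<Sum>i\<in>UNIV. \<Sum>l\<in>UNIV.
            b k t x \<omega> $ i * b k t x \<omega> $ l * hessian \<phi> x $ i $ l) \<ge> 0"
    and V2: "AE \<omega> in M. \<forall>t\<ge>0. \<forall>x\<in>D. \<forall>k\<in>{1..m}. gradient \<phi> x \<bullet> b k t x \<omega> = 0"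
  shows "measure M {\<omega> \<in> space M. \<forall>t\<ge>0. X t \<omega> \<in> D} = 1"
proof -
  interpret viable_sde M F m W a b C X0 X \<phi> D
    by (intro viable_sde.intro random_coefficient_sde.intro random_coefficient_sde_axioms.intro
        viable_sde_axioms.intro) (fact assms)+
  have "prob {\<omega> \<in> space M. \<forall>t\<ge>0. X t \<omega> \<in> D} = 1"
  proof (rule prob_eq_1[THEN iffD2])
    \<comment> \<open>The event involves uncountably many times; it is measurable because its
      complement lies in a null set and the space is complete.\<close>
    have "{\<omega> \<in> space M. \<not> (\<forall>t\<ge>0. X t \<omega> \<in> D)} \<in> sets M"
      using viability unfolding AE_iff_null_sets by auto
    then have "space M - {\<omega> \<in> space M. \<not> (\<forall>t\<ge>0. X t \<omega> \<in> D)} \<in> sets M" by (rule sets.compl_sets)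
    moreover have "space M - {\<omega> \<in> space M. \<not> (\<forall>t\<ge>0. X t \<omega> \<in> D)} = {\<omega> \<in> space M. \<forall>t\<ge>0. X t \<omega> \<in> D}" by auto
    ultimately show "{\<omega> \<in> space M. \<forall>t\<ge>0. X t \<omega> \<in> D} \<in> sets M" by simp
    show "AE \<omega> in M. \<omega> \<in> {\<omega> \<in> space M. \<forall>t\<ge>0. X t \<omega> \<in> D}"
      using viability AE_space by eventually_elim simp
  qed
  then show ?thesis .
qed

end
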